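(* Let $\mathbf b=(b_1,\dots,b_K)$ be an ordered $K$-partition of $N$. Let $\alpha_1,\dots,\alpha_K$ be determined by $$b_i-\frac NK=\alpha_i-\alpha_{i+1}\ (\text{indices mod }K),\qquad\sum_{i=1}^K\alpha_i=0,$$ and let $$\mathcal{E}_{\mathbf b}=\bigoplus_{i=1}^K\mathcal{O}(\alpha_i),\qquad\varphi_{\mathbf b}=\begin{pmatrix}0&z^{b_1}&&\\ &&\ddots&\\ &&&z^{b_{K-1}}\\ z^{b_K}&&&\end{pmatrix}dz$$ in the basis of canonical sections $e_i$ of $\mathcal{O}(\alpha_i)$, i.e. $\varphi_{\mathbf b}(e_{i+1})=z^{b_i}e_i\,dz$ with indices mod $K$. Then $(\mathcal{E}_{\mathbf b},\varphi_{\mathbf b})\in\mathcal{C}_{K,N}$. Moreover, if for $t\in\mathbb{C}$ we define $g_t:\mathcal{E}_{\mathbf b}\to\rho_t^*\mathcal{E}_{\mathbf b}$ by $$g_t(e_i)=e^{-t\frac{K}{K+N}\alpha_i}\rho_t^*e_i,$$ then $$e^t\rho_t^*\varphi_{\mathbf b}=g_t\,\varphi_{\mathbf b}\,g_t^{-1}.$$ In particular, $[(\mathcal{E}_{\mathbf b},\varphi_{\mathbf b})]\in\mathcal{M}_{K,N}$ is a $\mathbb{C}^\times$-fixed point, depending only on the cyclic $K$-partition $[\mathbf b]$.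
   Context: $K\ge 2$ and $N\ge 1$ are coprime integers; $z$ is the standard coordinate on $\mathbb{C}\subset\mathbb{CP}^1$. Filtered bundles. A filtered rank $K$ bundle on $(\mathbb{CP}^1,\{\infty\})$ is a locally free $\mathcal{O}_{\mathbb{CP}^1}( *\{\infty\})$-module $\mathcal{E}$ of rank $K$ (where $\mathcal{O}_{\mathbb{CP}^1}( *\{\infty\})$ is the sheaf of meromorphic functions with poles only at $\infty$) with an increasing filtration by locally free $\mathcal{O}_{\mathbb{CP}^1}$-submodules $\mathcal{P}_\alpha\mathcal{E}$, $\alpha\in\mathbb{R}$, such that $\mathcal{P}_\alpha\mathcal{E}|_{\mathbb{C}}=\mathcal{E}|_{\mathbb{C}}$, $\mathcal{P}_\alpha\mathcal{E}=\bigcap_{\beta>\alpha}\mathcal{P}_\beta\mathcal{E}$, and near $\infty$, with $x=1/z$, $\mathcal{P}_{\alpha-1}\mathcal{E}=x\,\mathcal{P}_\alpha\mathcal{E}$ (similarly over a disc with a marked point). For a section $s$ near $\infty$, its order is $\nu_\infty(s)=\inf\{\alpha: s\in\mathcal{P}_\alpha\mathcal{E}\}$. Direct sums and tensor products are filtered by $\mathcal{P}_\alpha(\mathcal{E}\oplus\mathcal{E}')=\mathcal{P}_\alpha\mathcal{E}\oplus\mathcal{P}_\alpha\mathcal{E}'$, $\mathcal{P}_\alpha(\mathcal{E}\otimes\mathcal{E}')=\sum_{\beta+\gamma=\alpha}\mathcal{P}_\beta\mathcal{E}\otimes\mathcal{P}_\gamma\mathcal{E}'$, and exterior powers as subbundles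 of tensor powers. A filtered $SL(K)$-bundle is a filtered rank $K$ bundle with a global section $\omega$ of $\wedge^K\mathcal{E}$ trivializing it on $\mathbb{C}$, with $\nu_\infty(\omega)=0$. A filtered $SL(K)$-Higgs bundle is a pair $(\mathcal{E},\varphi)$ with $\mathcal{E}$ a filtered $SL(K)$-bundle and $\varphi$ a traceless meromorphic section of $\operatorname{End}\mathcal{E}\otimes K_{\mathbb{CP}^1}$, holomorphic on $\mathbb{C}$. For $\alpha\in\mathbb{R}$, $\mathcal{O}(\alpha)$ is the filtered line bundle with underlying module $\mathcal{O}_{\mathbb{CP}^1}( *\{\infty\})$ and filtration by pole order at $\infty$ shifted by $-\alpha$; its canonical section $e$ (the element $1$) trivializes it on $\mathbb{C}$ and has $\nu_\infty(e)=-\alpha$. The category $\mathcal{C}_{K,N}$. Objects are filtered $SL(K)$-Higgs bundles $(\mathcal{E},\varphi)$ such that, for a disc $U$ around $\infty$ with coordinate $x=1/z$ and the ramified covering $\psi:\widetilde U\to U$, $x=u^{2K}$, with $\psi^*\mathcal{E}$ given its natural filtration (for which $\nu_{u=0}(\psi^*s)=2K\,\nu_\infty(s)$), there is a decomposition of filtered bundles $\psi^*\mathcal{E}=\bigoplus_{r=1}^K\mathcal{L}_r$ into filtered line bundles preserved by $\psi^*\varphi$, each $\mathcal{L}_r$ being equivalent to an ordinary line bundle with the standard filtration by pole order at $u=0$, and such that the restriction $\varphi_r$ of $\psi^*\varphi$ to $\mathcal{L}_r$ satisfies $(\varphi_r-d\mathfrak{a}_r)(\mathcal{P}_\alpha\mathcal{L}_r)\subset\mathcal{P}_{\alpha+1}\mathcal{L}_r\otimes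 K_{\widetilde U}$ for all $\alpha$, with $\mathfrak{a}_r=\frac{K}{K+N}e^{2\pi\mathrm{i}r/K}u^{-2(N+K)}$. Equivalently: there is a trivialization $g:\psi^*\mathcal{E}\to\mathcal{O}_{\widetilde U}^{\oplus K}$, inducing the filtration from the standard pole-order filtration, with $g(\psi^*\varphi)g^{-1}=-2K\operatorname{diag}(e^{2\pi\mathrm{i}/K},e^{4\pi\mathrm{i}/K},\dots,1)\frac{du}{u^{2K+2N+1}}+(\text{holomorphic in }u)$. Morphisms are isomorphisms of filtered bundles preserving the Higgs fields. $\mathcal{M}_{K,N}$ is the set of isomorphism classes of objects of $\mathcal{C}_{K,N}$. $\mathbb{C}^\times$-action. For $t\in\mathbb{C}/2\pi\mathrm{i}(K+N)\mathbb{Z}$ let $\rho_t(z)=e^{-\frac{Kt}{K+N}}z$. The $\mathbb{C}^\times$-action on $\mathcal{M}_{K,N}$ is $[(\mathcal{E},\varphi)]\mapsto[(\rho_t^*\mathcal{E},e^t\rho_t^*\varphi)]$. Partitions. An ordered $K$-partition of $N$ is $\mathbf b=(b_1,\dots,b_K)\in\mathbb{Z}_{\ge0}^K$ with $\sum b_i=N$; a cyclic $K$-partition $[\mathbf b]$ is a class of these up to cyclic permutation of the indices. *)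

theory Defs
  imports
    "HOL-Complex_Analysis.Complex_Analysis"
    "HOL-Combinatorics.Permutations"
    "Jordan_Normal_Form.Gauss_Jordan_Elimination"
begin

hide_const (open) Finite_Cartesian_Product.vec Finite_Cartesian_Product.mat

section \<open>Marked surfaces and their structure sheaves\<close>

text \<open>
  The two surfaces needed are the projective line with marked point \<open>\<infinity>\<close> and a disc with
  marked point \<open>0\<close>. The complement of the marked point is parametrized by a complex
  coordinate through \<open>incl\<close>. The function \<open>loc\<close> expresses the local coordinate \<open>x\<close>
  at the marked point through that coordinate; it is an involution in both cases
  (\<open>x = 1/z\<close>, respectively \<open>x = u\<close>), so the same function also expresses the coordinate
  through \<open>x\<close>.
\<close>

record 'p marked_surface =
  opens :: "'p topology"
  incl :: "complex \<Rightarrow> 'p"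
  mark :: 'p
  loc :: "complex \<Rightarrow> complex"

definition CP1 :: "complex option marked_surface" where
  "CP1 = \<lparr>opens = Alexandroff_compactification euclidean, incl = Some, mark = None, loc = inverse\<rparr>"

definition disc :: "real \<Rightarrow> complex marked_surface" where
  "disc r = \<lparr>opens = top_of_set (ball 0 r), incl = id, mark = 0, loc = id\<rparr>"

definition dom_off_mark :: "'p marked_surface \<Rightarrow> 'p set \<Rightarrow> complex set" where
  "dom_off_mark S U = {z. incl S z \<in> U - {mark S}}"

text \<open>\<open>h\<close> is meromorphic at \<open>0\<close> with a pole of order at most \<open>n\<close> (a zero of order at
  least \<open>- n\<close> if \<open>n < 0\<close>).\<close>

definition pole_le :: "int \<Rightarrow> (complex \<Rightarrow> complex) \<Rightarrow> bool" where
  "pole_le n h \<longleftrightarrow>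
     (\<exists>g. g analytic_on {0} \<and> (\<forall>\<^sub>F x in at 0. h x = x powi (- n) * g x))"

text \<open>
  The structure sheaf \<open>O\<close> and the sheaf \<open>O(*m)\<close> of meromorphic functions with poles only
  at the marked point \<open>m\<close>. A section over \<open>U\<close> is recorded by its values on \<open>U - {m}\<close>,
  which determine it, and is \<open>undefined\<close> elsewhere, so that restriction of sections
  is \<^const>\<open>restrict\<close> and equality of sections is equality in HOL.
\<close>

definition O_mer :: "'p marked_surface \<Rightarrow> 'p set \<Rightarrow> (complex \<Rightarrow> complex) set" where
  "O_mer S U = {f \<in> extensional (dom_off_mark S U).
     f holomorphic_on dom_off_mark S U \<and>
     (mark S \<in> U \<longrightarrow> (\<lambda>x. f (loc S x)) meromorphic_on {0})}"

definition O_pole :: "'p marked_surface \<Rightarrow> int \<Rightarrow> 'p set \<Rightarrow> (complex \<Rightarrow> complex) set" where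
  "O_pole S n U = {f \<in> O_mer S U. mark S \<in> U \<longrightarrow> pole_le n (\<lambda>x. f (loc S x))}"

abbreviation O_hol :: "'p marked_surface \<Rightarrow> 'p set \<Rightarrow> (complex \<Rightarrow> complex) set" where
  "O_hol S \<equiv> O_pole S 0"

section \<open>Locally free sheaves and filtered bundles\<close>

text \<open>
  Sections of the sheaves below over \<open>U\<close> are functions on \<open>U - {m}\<close> with values in the
  fibres. For a locally free \<open>O(*m)\<close>-module of rank \<open>K\<close> the fibres off \<open>m\<close> are
  \<open>K\<close>-dimensional, and a section is determined by its values there. Choosing a basis of
  each fibre (with no continuity whatsoever in the point) identifies all fibres with
  \<open>\<complex>\<^sup>K\<close>; the holomorphic structure is carried by which functions are declared to be sections.
  So every locally free module occurs here, up to isomorphism, and no global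
  holomorphic frame is presupposed.
\<close>

definition is_sheaf :: "'p marked_surface \<Rightarrow> ('p set \<Rightarrow> (complex \<Rightarrow> 'v) set) \<Rightarrow> bool" where
  "is_sheaf S F \<longleftrightarrow>
     (\<forall>U. openin (opens S) U \<longrightarrow> F U \<subseteq> extensional (dom_off_mark S U)) \<and>
     (\<forall>U V s. openin (opens S) U \<and> openin (opens S) V \<and> V \<subseteq> U \<and> s \<in> F U \<longrightarrow>
        restrict s (dom_off_mark S V) \<in> F V) \<and>
     (\<forall>U s. openin (opens S) U \<and> s \<in> extensional (dom_off_mark S U) \<and>
        (\<forall>p\<in>U. \<exists>V. openin (opens S) V \<and> p \<in> V \<and> V \<subseteq> U \<and> restrict s (dom_off_mark S V) \<in> F V) \<longrightarrow>
        s \<in> F U)"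

definition is_module_sheaf ::
  "'p marked_surface \<Rightarrow> nat \<Rightarrow> ('p set \<Rightarrow> (complex \<Rightarrow> complex) set) \<Rightarrow>
   ('p set \<Rightarrow> (complex \<Rightarrow> complex vec) set) \<Rightarrow> bool" where
  "is_module_sheaf S K R F \<longleftrightarrow> is_sheaf S F \<and>
     (\<forall>U. openin (opens S) U \<longrightarrow>
        (\<forall>s\<in>F U. \<forall>z\<in>dom_off_mark S U. s z \<in> carrier_vec K) \<and>
        (\<lambda>z\<in>dom_off_mark S U. 0\<^sub>v K) \<in> F U \<and>
        (\<forall>s\<in>F U. \<forall>s'\<in>F U. (\<lambda>z\<in>dom_off_mark S U. s z + s' z) \<in> F U) \<and>
        (\<forall>f\<in>R U. \<forall>s\<in>F U. (\<lambda>z\<in>dom_off_mark S U. f z \<cdot>\<^sub>v s z) \<in> F U))"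

text \<open>
  Locally free of rank \<open>n\<close> over \<open>R\<close> (one of \<open>O\<close>, \<open>O(*m)\<close>), as a sheaf of functions
  with values in \<open>\<complex>\<^sup>K\<close>. The columns of \<open>A\<close> are a local frame; they are linearly independent
  at every point other than the marked one, so the coefficients \<open>f\<close> are unique. Rank \<open>n = K\<close>
  is the case of a bundle with fibres \<open>\<complex>\<^sup>K\<close>, rank \<open>n < K\<close> that of a subbundle.
\<close>

definition locally_free ::
  "'p marked_surface \<Rightarrow> nat \<Rightarrow> nat \<Rightarrow> ('p set \<Rightarrow> (complex \<Rightarrow> complex) set) \<Rightarrow>
   ('p set \<Rightarrow> (complex \<Rightarrow> complex vec) set) \<Rightarrow> bool" where
  "locally_free S K n R F \<longleftrightarrow> is_module_sheaf S K R F \<and>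
     (\<forall>p\<in>topspace (opens S). \<exists>U A. openin (opens S) U \<and> p \<in> U \<and>
        (\<forall>z\<in>dom_off_mark S U. A z \<in> carrier_mat K n \<and>
           (\<forall>v\<in>carrier_vec n. A z *\<^sub>v v = 0\<^sub>v K \<longrightarrow> v = 0\<^sub>v n)) \<and>
        (\<forall>V. openin (opens S) V \<and> V \<subseteq> U \<longrightarrow>
           F V = {\<lambda>z\<in>dom_off_mark S V. A z *\<^sub>v Matrix.vec n (\<lambda>j. f j z) | f. \<forall>j<n. f j \<in> R V}))"

record ('p, 'v) fsheaf =
  sec :: "'p set \<Rightarrow> (complex \<Rightarrow> 'v) set"
  filt :: "real \<Rightarrow> 'p set \<Rightarrow> (complex \<Rightarrow> 'v) set"

definition filtered_bundle ::
  "'p marked_surface \<Rightarrow> nat \<Rightarrow> nat \<Rightarrow> ('p, complex vec) fsheaf \<Rightarrow> bool" where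
  "filtered_bundle S K n E \<longleftrightarrow>
     locally_free S K n (O_mer S) (sec E) \<and>
     (\<forall>\<alpha>. locally_free S K n (O_hol S) (filt E \<alpha>)) \<and>
     (\<forall>\<alpha> U. openin (opens S) U \<longrightarrow> filt E \<alpha> U \<subseteq> sec E U) \<and>
     (\<forall>\<alpha> \<beta> U. openin (opens S) U \<and> \<alpha> \<le> \<beta> \<longrightarrow> filt E \<alpha> U \<subseteq> filt E \<beta> U) \<and>
     (\<forall>\<alpha> U. openin (opens S) U \<and> mark S \<notin> U \<longrightarrow> filt E \<alpha> U = sec E U) \<and>
     (\<forall>\<alpha> U. openin (opens S) U \<longrightarrow> filt E \<alpha> U = (\<Inter>\<beta>\<in>{\<alpha><..}. filt E \<beta> U)) \<and>
     (\<exists>U0. openin (opens S) U0 \<and> mark S \<in> U0 \<and>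
        (\<forall>\<alpha> U. openin (opens S) U \<and> U \<subseteq> U0 \<longrightarrow>
           filt E (\<alpha> - 1) U =
             (\<lambda>s. \<lambda>z\<in>dom_off_mark S U. loc S z \<cdot>\<^sub>v s z) ` filt E \<alpha> U))"

text \<open>The infimum is taken in the extended reals, so that the zero section has order \<open>- \<infinity>\<close>.\<close>

definition order_at_mark ::
  "'p marked_surface \<Rightarrow> ('p, 'v) fsheaf \<Rightarrow> (complex \<Rightarrow> 'v) \<Rightarrow> ereal" where
  "order_at_mark S E s = Inf (ereal ` {\<alpha>. \<exists>V. openin (opens S) V \<and> mark S \<in> V \<and>
     restrict s (dom_off_mark S V) \<in> filt E \<alpha> V})"

definition apply_fibrewise ::
  "'p marked_surface \<Rightarrow> (complex \<Rightarrow> complex mat) \<Rightarrow> 'p set \<Rightarrow>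
   (complex \<Rightarrow> complex vec) \<Rightarrow> complex \<Rightarrow> complex vec" where
  "apply_fibrewise S g U s = (\<lambda>z\<in>dom_off_mark S U. g z *\<^sub>v s z)"

text \<open>A morphism of \<open>O(*m)\<close>-modules is determined by the linear maps it induces on the
  fibres off \<open>m\<close>.\<close>

definition filtered_iso ::
  "'p marked_surface \<Rightarrow> nat \<Rightarrow> ('p, complex vec) fsheaf \<Rightarrow> ('p, complex vec) fsheaf \<Rightarrow>
   (complex \<Rightarrow> complex mat) \<Rightarrow> bool" where
  "filtered_iso S K E E' g \<longleftrightarrow>
     (\<forall>z\<in>dom_off_mark S (topspace (opens S)). g z \<in> carrier_mat K K \<and> invertible_mat (g z)) \<and>
     (\<forall>U. openin (opens S) U \<longrightarrow>
        apply_fibrewise S g U ` sec E U = sec E' U \<and>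
        (\<forall>\<alpha>. apply_fibrewise S g U ` filt E \<alpha> U = filt E' \<alpha> U))"

section \<open>Line bundles, direct sums and exterior powers\<close>

definition O_line :: "real \<Rightarrow> (complex option, complex) fsheaf" where
  "O_line a = \<lparr>sec = O_mer CP1, filt = (\<lambda>\<beta>. O_pole CP1 \<lfloor>\<beta> + a\<rfloor>)\<rparr>"

definition direct_sum ::
  "'p marked_surface \<Rightarrow> nat \<Rightarrow> (nat \<Rightarrow> ('p, complex) fsheaf) \<Rightarrow> ('p, complex vec) fsheaf" where
  "direct_sum S n L = \<lparr>
     sec = (\<lambda>U. {s \<in> dom_off_mark S U \<rightarrow>\<^sub>E carrier_vec n.
              \<forall>i<n. (\<lambda>z\<in>dom_off_mark S U. vec_index (s z) i) \<in> sec (L i) U}),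
     filt = (\<lambda>\<beta> U. {s \<in> dom_off_mark S U \<rightarrow>\<^sub>E carrier_vec n.
              \<forall>i<n. (\<lambda>z\<in>dom_off_mark S U. vec_index (s z) i) \<in> filt (L i) \<beta> U})\<rparr>"

text \<open>An element of \<open>(\<complex>\<^sup>K)\<^sup>\<otimes>\<^sup>n\<close> is given by its coefficients, indexed by lists of length
  \<open>n\<close> with entries below \<open>K\<close> and \<open>0\<close> on all other lists.\<close>

definition pure_tensor :: "nat \<Rightarrow> nat \<Rightarrow> (nat \<Rightarrow> complex vec) \<Rightarrow> nat list \<Rightarrow> complex" where
  "pure_tensor K n v J =
     (if length J = n \<and> set J \<subseteq> {..<K} then \<Prod>j<n. vec_index (v j) (J ! j) else 0)"

text \<open>
  Iterating \<open>P\<^sub>\<alpha>(E \<otimes> E') = \<Sum>\<^bsub>\<beta>+\<gamma>=\<alpha>\<^esub> P\<^sub>\<beta>E \<otimes> P\<^sub>\<gamma>E'\<close> gives the formula below; sums of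
  subsheaves are formed locally. For \<open>n > 0\<close> scalar coefficients are absorbed in a factor.
\<close>

definition tensor_power ::
  "'p marked_surface \<Rightarrow> nat \<Rightarrow> nat \<Rightarrow> ('p, complex vec) fsheaf \<Rightarrow> ('p, nat list \<Rightarrow> complex) fsheaf"
where
  "tensor_power S K n E = \<lparr>
     sec = (\<lambda>U. {\<tau> \<in> extensional (dom_off_mark S U).
       \<forall>p\<in>U. \<exists>V m s. openin (opens S) V \<and> p \<in> V \<and> V \<subseteq> U \<and>
         (\<forall>k<m. \<forall>j<n. s k j \<in> sec E V) \<and>
         (\<forall>z\<in>dom_off_mark S V. \<tau> z = (\<lambda>J. \<Sum>k<(m::nat). pure_tensor K n (\<lambda>j. s k j z) J))}),
     filt = (\<lambda>\<alpha> U. {\<tau> \<in> extensional (dom_off_mark S U).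
       \<forall>p\<in>U. \<exists>V m s \<beta>. openin (opens S) V \<and> p \<in> V \<and> V \<subseteq> U \<and>
         (\<forall>k<m. (\<Sum>j<n. \<beta> k j) = \<alpha> \<and> (\<forall>j<n. s k j \<in> filt E (\<beta> k j) V)) \<and>
         (\<forall>z\<in>dom_off_mark S V. \<tau> z = (\<lambda>J. \<Sum>k<(m::nat). pure_tensor K n (\<lambda>j. s k j z) J))})\<rparr>"

definition alternating :: "nat \<Rightarrow> (nat list \<Rightarrow> complex) \<Rightarrow> bool" where
  "alternating n T \<longleftrightarrow>
     (\<forall>J i j. length J = n \<and> i < j \<and> j < n \<longrightarrow> T (J[i := J ! j, j := J ! i]) = - T J)"

definition exterior_power ::
  "'p marked_surface \<Rightarrow> nat \<Rightarrow> nat \<Rightarrow> ('p, complex vec) fsheaf \<Rightarrow> ('p, nat list \<Rightarrow> complex) fsheaf"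
where
  "exterior_power S K n E = \<lparr>
     sec = (\<lambda>U. {\<tau> \<in> sec (tensor_power S K n E) U. \<forall>z\<in>dom_off_mark S U. alternating n (\<tau> z)}),
     filt = (\<lambda>\<alpha> U. {\<tau> \<in> filt (tensor_power S K n E) \<alpha> U.
              \<forall>z\<in>dom_off_mark S U. alternating n (\<tau> z)})\<rparr>"

definition wedge :: "nat \<Rightarrow> nat \<Rightarrow> (nat \<Rightarrow> complex vec) \<Rightarrow> nat list \<Rightarrow> complex" where
  "wedge K n v J =
     (\<Sum>\<sigma> | \<sigma> permutes {..<n}. of_int (sign \<sigma>) * pure_tensor K n (\<lambda>j. v (\<sigma> j)) J)"

section \<open>Filtered \<open>SL(K)\<close>-Higgs bundles\<close>

text \<open>
  \<open>Hig\<close> is the coefficient \<open>\<Phi>\<close> of \<open>\<phi> = \<Phi> dz\<close>, an endomorphism of each fibre over \<open>\<complex>\<close>; as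
  \<open>dz\<close> is meromorphic and without zeros or poles on \<open>\<complex>\<close>, a section \<open>\<phi>\<close> of
  \<open>End E \<otimes> K\<close>, meromorphic and holomorphic on \<open>\<complex>\<close>, is the same as an \<open>O(*\<infinity>)\<close>-linear
  endomorphism \<open>\<Phi>\<close> of \<open>E\<close>.
\<close>

record sl_higgs =
  Bun :: "(complex option, complex vec) fsheaf"
  Vol :: "complex \<Rightarrow> nat list \<Rightarrow> complex"
  Hig :: "complex \<Rightarrow> complex mat"

definition sl_bundle ::
  "nat \<Rightarrow> (complex option, complex vec) fsheaf \<Rightarrow> (complex \<Rightarrow> nat list \<Rightarrow> complex) \<Rightarrow> bool" where
  "sl_bundle K E \<omega> \<longleftrightarrow> filtered_bundle CP1 K K E \<and>
     \<omega> \<in> sec (exterior_power CP1 K K E) (topspace (opens CP1)) \<and>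
     (\<forall>V. openin (opens CP1) V \<and> mark CP1 \<notin> V \<longrightarrow>
        bij_betw (\<lambda>f. \<lambda>z\<in>dom_off_mark CP1 V. (\<lambda>J. f z * \<omega> z J))
          (O_hol CP1 V) (sec (exterior_power CP1 K K E) V)) \<and>
     order_at_mark CP1 (exterior_power CP1 K K E) \<omega> = 0"

definition higgs_field ::
  "nat \<Rightarrow> (complex option, complex vec) fsheaf \<Rightarrow> (complex \<Rightarrow> complex mat) \<Rightarrow> bool" where
  "higgs_field K E \<Phi> \<longleftrightarrow>
     (\<forall>z. \<Phi> z \<in> carrier_mat K K \<and> (\<Sum>i<K. \<Phi> z $$ (i, i)) = 0) \<and>
     (\<forall>U. openin (opens CP1) U \<longrightarrow> apply_fibrewise CP1 \<Phi> U ` sec E U \<subseteq> sec E U)"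

definition sl_higgs_bundle :: "nat \<Rightarrow> sl_higgs \<Rightarrow> bool" where
  "sl_higgs_bundle K X \<longleftrightarrow> sl_bundle K (Bun X) (Vol X) \<and> higgs_field K (Bun X) (Hig X)"

text \<open>Coefficient of the pullback of the matrix-valued 1-form \<open>\<Phi> dz\<close> under \<open>z = r w\<close>.\<close>

definition pullback_form ::
  "(complex \<Rightarrow> complex) \<Rightarrow> (complex \<Rightarrow> complex mat) \<Rightarrow> complex \<Rightarrow> complex mat" where
  "pullback_form r \<Phi> w = deriv r w \<cdot>\<^sub>m \<Phi> (r w)"

section \<open>The category and its moduli set\<close>

text \<open>The covering \<open>x = u\<^sup>2\<^sup>K\<close> in terms of \<open>z = 1/x\<close>.\<close>

definition cover :: "nat \<Rightarrow> complex \<Rightarrow> complex" where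
  "cover K u = u powi (- 2 * int K)"

definition cover_point :: "nat \<Rightarrow> complex \<Rightarrow> complex option" where
  "cover_point K u = (if u = 0 then None else Some (cover K u))"

text \<open>
  The pullback \<open>\<psi>\<^sup>*E\<close> to the disc of radius \<open>r\<close>: its fibre at \<open>u \<noteq> 0\<close> is that of \<open>E\<close> at
  \<open>\<psi>(u)\<close>, and its sections are locally the \<open>O(*0)\<close>-linear combinations of sections
  \<open>\<psi>\<^sup>*\<sigma>\<close>. In the filtration \<open>h \<psi>\<^sup>*\<sigma>\<close> has order at most \<open>n + 2K a\<close> if \<open>h\<close> has a pole of
  order at most \<open>n\<close> and \<open>\<sigma>\<close> lies in \<open>P\<^sub>aE\<close>.
\<close>

definition cover_pullback ::
  "real \<Rightarrow> nat \<Rightarrow> (complex option, complex vec) fsheaf \<Rightarrow> (complex, complex vec) fsheaf" where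
  "cover_pullback r K E = \<lparr>
     sec = (\<lambda>W. {s \<in> dom_off_mark (disc r) W \<rightarrow>\<^sub>E carrier_vec K.
       \<forall>p\<in>W. \<exists>W' V m h \<sigma>. openin (opens (disc r)) W' \<and> p \<in> W' \<and> W' \<subseteq> W \<and>
         openin (opens CP1) V \<and> cover_point K ` W' \<subseteq> V \<and>
         (\<forall>k<m. h k \<in> O_mer (disc r) W' \<and> \<sigma> k \<in> sec E V) \<and>
         (\<forall>u\<in>dom_off_mark (disc r) W'.
            s u = Matrix.vec K (\<lambda>i. \<Sum>k<(m::nat). h k u * vec_index (\<sigma> k (cover K u)) i))}),
     filt = (\<lambda>\<beta> W. {s \<in> dom_off_mark (disc r) W \<rightarrow>\<^sub>E carrier_vec K.
       \<forall>p\<in>W. \<exists>W' V m h \<sigma> n a. openin (opens (disc r)) W' \<and> p \<in> W' \<and> W' \<subseteq> W \<and>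
         openin (opens CP1) V \<and> cover_point K ` W' \<subseteq> V \<and>
         (\<forall>k<m. h k \<in> O_pole (disc r) (n k) W' \<and> \<sigma> k \<in> filt E (a k) V \<and>
            real_of_int (n k) + 2 * real K * a k \<le> \<beta>) \<and>
         (\<forall>u\<in>dom_off_mark (disc r) W'.
            s u = Matrix.vec K (\<lambda>i. \<Sum>k<(m::nat). h k u * vec_index (\<sigma> k (cover K u)) i))})\<rparr>"

definition decomposes_into ::
  "'p marked_surface \<Rightarrow> nat \<Rightarrow> ('p, complex vec) fsheaf \<Rightarrow> nat set \<Rightarrow>
   (nat \<Rightarrow> ('p, complex vec) fsheaf) \<Rightarrow> bool" where
  "decomposes_into S K E I L \<longleftrightarrow>
     (\<forall>U. openin (opens S) U \<longrightarrow>
        (let add_up = (\<lambda>\<sigma>. \<lambda>z\<in>dom_off_mark S U. Matrix.vec K (\<lambda>i. \<Sum>l\<in>I. vec_index (\<sigma> l z) i)) in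
         bij_betw add_up (\<Pi>\<^sub>E l\<in>I. sec (L l) U) (sec E U) \<and>
         (\<forall>\<beta>. bij_betw add_up (\<Pi>\<^sub>E l\<in>I. filt (L l) \<beta> U) (filt E \<beta> U))))"

text \<open>\<open>L\<close> is the ordinary line bundle \<open>L0\<close> with its filtration by pole order at \<open>0\<close>.\<close>

definition standard_filtered_line ::
  "real \<Rightarrow> nat \<Rightarrow> (complex, complex vec) fsheaf \<Rightarrow> bool" where
  "standard_filtered_line r K L \<longleftrightarrow> filtered_bundle (disc r) K 1 L \<and>
     (\<exists>L0. locally_free (disc r) K 1 (O_hol (disc r)) L0 \<and>
        (\<forall>\<beta> W. openin (opens (disc r)) W \<longrightarrow>
           filt L \<beta> W = {s \<in> sec L W.
             (\<lambda>u\<in>dom_off_mark (disc r) W. (u powi \<lfloor>\<beta>\<rfloor>) \<cdot>\<^sub>v s u) \<in> L0 W}))"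

definition sing_part :: "nat \<Rightarrow> nat \<Rightarrow> nat \<Rightarrow> complex \<Rightarrow> complex" where
  "sing_part K N l u =
     of_real (real K / real (K + N)) * exp (2 * pi * \<i> * of_nat l / of_nat K)
       * u powi (- 2 * int (N + K))"

text \<open>As \<open>du\<close> has no zeros or poles on the disc, 1-forms there are again written by
  their coefficients.\<close>

definition good_at_infinity ::
  "nat \<Rightarrow> nat \<Rightarrow> (complex option, complex vec) fsheaf \<Rightarrow> (complex \<Rightarrow> complex mat) \<Rightarrow> bool" where
  "good_at_infinity K N E \<Phi> \<longleftrightarrow>
     (\<exists>r>0. \<exists>L.
        (\<forall>l\<in>{1..K}. standard_filtered_line r K (L l)) \<and>
        decomposes_into (disc r) K (cover_pullback r K E) {1..K} L \<and>
        (\<forall>l\<in>{1..K}. \<forall>W. openin (opens (disc r)) W \<longrightarrow>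
           apply_fibrewise (disc r) (pullback_form (cover K) \<Phi>) W ` sec (L l) W \<subseteq> sec (L l) W \<and>
           (\<forall>\<alpha>. \<forall>s\<in>filt (L l) \<alpha> W.
              (\<lambda>u\<in>dom_off_mark (disc r) W.
                 pullback_form (cover K) \<Phi> u *\<^sub>v s u - deriv (sing_part K N l) u \<cdot>\<^sub>v s u)
              \<in> filt (L l) (\<alpha> + 1) W)))"

definition objs :: "nat \<Rightarrow> nat \<Rightarrow> sl_higgs set" where
  "objs K N = {X. sl_higgs_bundle K X \<and> good_at_infinity K N (Bun X) (Hig X)}"

text \<open>Morphisms preserve filtrations and Higgs fields; they are not required to preserve the
  trivialization of the determinant.\<close>

definition higgs_iso :: "nat \<Rightarrow> sl_higgs \<Rightarrow> sl_higgs \<Rightarrow> bool" where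
  "higgs_iso K X Y \<longleftrightarrow>
     (\<exists>g. filtered_iso CP1 K (Bun X) (Bun Y) g \<and> (\<forall>z. g z * Hig X z = Hig Y z * g z))"

definition iso_rel :: "nat \<Rightarrow> nat \<Rightarrow> (sl_higgs \<times> sl_higgs) set" where
  "iso_rel K N = {(X, Y). X \<in> objs K N \<and> Y \<in> objs K N \<and> higgs_iso K X Y}"

definition moduli :: "nat \<Rightarrow> nat \<Rightarrow> sl_higgs set set" where
  "moduli K N = objs K N // iso_rel K N"

definition iso_class :: "nat \<Rightarrow> nat \<Rightarrow> sl_higgs \<Rightarrow> sl_higgs set" where
  "iso_class K N X = iso_rel K N `` {X}"

section \<open>The action of the multiplicative group\<close>

text \<open>The parameter \<open>t\<close> ranges over \<open>\<complex>\<close>; \<open>rho K N t\<close> and \<open>exp t\<close> only depend on \<open>t\<close> modulo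
  \<open>2\<pi>i(K + N)\<close>.\<close>

definition rho :: "nat \<Rightarrow> nat \<Rightarrow> complex \<Rightarrow> complex \<Rightarrow> complex" where
  "rho K N t z = exp (- (of_nat K * t / of_nat (K + N))) * z"

text \<open>Pullback under an automorphism of the projective line fixing \<open>\<infinity>\<close>.\<close>

definition pullback_bundle ::
  "(complex \<Rightarrow> complex) \<Rightarrow> (complex option, 'v) fsheaf \<Rightarrow> (complex option, 'v) fsheaf" where
  "pullback_bundle r E = \<lparr>
     sec = (\<lambda>U. (\<lambda>s. \<lambda>z\<in>dom_off_mark CP1 U. s (r z)) ` sec E (map_option r ` U)),
     filt = (\<lambda>\<alpha> U. (\<lambda>s. \<lambda>z\<in>dom_off_mark CP1 U. s (r z)) ` filt E \<alpha> (map_option r ` U))\<rparr>"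

definition act_obj :: "nat \<Rightarrow> nat \<Rightarrow> complex \<Rightarrow> sl_higgs \<Rightarrow> sl_higgs" where
  "act_obj K N t X = \<lparr>
     Bun = pullback_bundle (rho K N t) (Bun X),
     Vol = (\<lambda>z. Vol X (rho K N t z)),
     Hig = (\<lambda>z. exp t \<cdot>\<^sub>m pullback_form (rho K N t) (Hig X) z)\<rparr>"

definition act :: "nat \<Rightarrow> nat \<Rightarrow> complex \<Rightarrow> sl_higgs set \<Rightarrow> sl_higgs set" where
  "act K N t c = iso_rel K N `` (act_obj K N t ` c)"

section \<open>Partitions and the associated Higgs bundles\<close>

text \<open>Indices of partitions, weights and basis vectors run from \<open>0\<close> to \<open>K - 1\<close>.\<close>

definition ordered_partition :: "nat \<Rightarrow> nat \<Rightarrow> nat list \<Rightarrow> bool" where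
  "ordered_partition K N b \<longleftrightarrow> length b = K \<and> sum_list b = N"

definition cyclic_partition :: "nat list \<Rightarrow> nat list set" where
  "cyclic_partition b = {rotate n b | n. True}"

definition is_weights :: "nat \<Rightarrow> nat \<Rightarrow> nat list \<Rightarrow> real list \<Rightarrow> bool" where
  "is_weights K N b a \<longleftrightarrow> length a = K \<and>
     (\<forall>i<K. real (b ! i) - real N / real K = a ! i - a ! (Suc i mod K)) \<and> sum_list a = 0"

definition weights :: "nat \<Rightarrow> nat \<Rightarrow> nat list \<Rightarrow> real list" where
  "weights K N b = (THE a. is_weights K N b a)"

definition canonical_section :: "nat \<Rightarrow> nat \<Rightarrow> complex \<Rightarrow> complex vec" where
  "canonical_section K i z = unit_vec K i"

definition partition_bundle :: "nat \<Rightarrow> nat \<Rightarrow> nat list \<Rightarrow> (complex option, complex vec) fsheaf" where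
  "partition_bundle K N b = direct_sum CP1 K (\<lambda>i. O_line (weights K N b ! i))"

definition partition_field :: "nat \<Rightarrow> nat list \<Rightarrow> complex \<Rightarrow> complex mat" where
  "partition_field K b z = Matrix.mat K K (\<lambda>(i, j). if j = Suc i mod K then z ^ (b ! i) else 0)"

definition partition_higgs :: "nat \<Rightarrow> nat \<Rightarrow> nat list \<Rightarrow> sl_higgs" where
  "partition_higgs K N b = \<lparr>
     Bun = partition_bundle K N b,
     Vol = (\<lambda>z. wedge K K (\<lambda>i. canonical_section K i z)),
     Hig = partition_field K b\<rparr>"

definition gauge_factor :: "nat \<Rightarrow> nat \<Rightarrow> nat list \<Rightarrow> complex \<Rightarrow> nat \<Rightarrow> complex" where
  "gauge_factor K N b t i =
     exp (- t * of_real (real K / real (K + N)) * of_real (weights K N b ! i))"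

text \<open>The matrix of \<open>g\<^sub>t\<close> with respect to the \<open>e\<^sub>i\<close> and the \<open>\<rho>\<^sub>t\<^sup>*e\<^sub>i\<close>.\<close>

definition gauge_map :: "nat \<Rightarrow> nat \<Rightarrow> nat list \<Rightarrow> complex \<Rightarrow> complex \<Rightarrow> complex mat" where
  "gauge_map K N b t z = mat_diag K (gauge_factor K N b t)"

end

theory Submission
  imports Defs
begin

text \<open>
  Why the theorem holds. In the basis \<open>e\<^sub>i\<close> everything is monomial. The pulled back field
  on the disc with \<open>z = u\<^sup>-\<^sup>2\<^sup>K\<close> sends \<open>e\<^sub>i\<^sub>+\<^sub>1\<close> to a power of \<open>u\<close> times \<open>e\<^sub>i\<close>, and the
  defining relation \<open>b\<^sub>i - N/K = \<alpha>\<^sub>i - \<alpha>\<^sub>i\<^sub>+\<^sub>1\<close> of the weights says that after replacing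
  \<open>e\<^sub>i\<close> by \<open>u\<^sup>-\<^sup>m\<^sup>(\<^sup>i\<^sup>) e\<^sub>i\<close>, with \<open>m(i) = 2K \<alpha>\<^sub>i\<close>, all these powers agree: the
  field becomes \<open>- 2K u\<^sup>-\<^sup>2\<^sup>K\<^sup>-\<^sup>2\<^sup>N\<^sup>-\<^sup>1\<close> times the cyclic permutation matrix, which the discrete
  Fourier transform diagonalizes. Its eigenvalues are exactly the derivatives of the prescribed
  singular parts, so the remainder is zero and not merely holomorphic
  (\<open>twisted_field_eigenvector\<close>, \<open>good_at_infinity_twisted_field\<close>). The \<open>m(i)\<close> are integers
  (\<open>weights_half_integral\<close>), hence the rescaled basis is an ordinary frame at \<open>u = 0\<close> and the
  eigenlines carry the filtration by pole order (\<open>mem_filt_cover_pullback\<close>,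
  \<open>decomposition_into_eigenlines\<close>).

  The weights add up to \<open>0\<close>, so each summand \<open>e\<^sub>\<sigma>\<^sub>(\<^sub>1\<^sub>) \<otimes> \<dots> \<otimes> e\<^sub>\<sigma>\<^sub>(\<^sub>K\<^sub>)\<close> of the volume form has order
  \<open>0\<close>, and the volume form can have no smaller order because its coefficient \<open>1\<close> does not
  vanish at \<open>\<infinity>\<close> (\<open>sl_bundle_line_sum\<close>). That the sheaves in question are filtered bundles
  follows from one statement about sheaves given by a frame, applied both to the sum of the lines
  \<open>O(\<alpha>\<^sub>i)\<close> on the projective line and to the eigenlines on the disc
  (\<open>filtered_bundle_framed_bundle\<close>).

  Scaling \<open>z\<close> does not change pole orders at \<open>\<infinity>\<close>; therefore \<open>\<rho>\<^sub>t\<^sup>*E\<close> and \<open>E\<close> have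
  literally the same sections (\<open>pullback_line_sum\<close>), and \<open>e\<^sup>t \<rho>\<^sub>t\<^sup>*\<phi>\<close> is the conjugate of \<open>\<phi>\<close>
  by a constant diagonal matrix (\<open>gauge_factor_ratio\<close>). Rotating the partition rotates the
  weights, by their uniqueness, and relabelling the summands is an isomorphism
  (\<open>higgs_iso_rotate\<close>). Diagonal conjugations and relabellings are both given by constant
  monomial matrices (\<open>filtered_iso_monomial_mat\<close>). Isomorphisms compose and pull back under
  \<open>\<rho>\<^sub>t\<close>, so with the object its whole isomorphism class is fixed by the action.
\<close>

section \<open>Poles of bounded order\<close>

lemma pole_le_cong:
  assumes "\<forall>\<^sub>F x in at 0. f x = g x" and "pole_le n f"
  shows "pole_le n g"
proof -
  obtain h where "h analytic_on {0}" and h: "\<forall>\<^sub>F x in at 0. f x = x powi (- n) * h x"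
    using assms(2) unfolding pole_le_def by blast
  moreover have "\<forall>\<^sub>F x in at 0. g x = x powi (- n) * h x"
    using h assms(1) by eventually_elim simp
  ultimately show ?thesis unfolding pole_le_def by blast
qed

lemma eventually_nonzero: "\<forall>\<^sub>F x::complex in at 0. x \<noteq> 0"
  by (simp add: eventually_at_filter)

lemma pole_le_mult:
  assumes "pole_le m f" and "pole_le n g"
  shows "pole_le (m + n) (\<lambda>x. f x * g x)"
proof -
  obtain f' where f': "f' analytic_on {0}" "\<forall>\<^sub>F x in at 0. f x = x powi (- m) * f' x"
    using assms(1) unfolding pole_le_def by blast
  obtain g' where g': "g' analytic_on {0}" "\<forall>\<^sub>F x in at 0. g x = x powi (- n) * g' x"
    using assms(2) unfolding pole_le_def by blast
  have "\<forall>\<^sub>F x in at 0. f x * g x = x powi (- (m + n)) * (f' x * g' x)"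
    using f'(2) g'(2) eventually_nonzero
  proof eventually_elim
    case (elim x)
    have "x powi (- (m + n)) = x powi (- m) * x powi (- n)"
      using power_int_add[of x "- m" "- n"] elim(3) by simp
    then show ?case using elim by simp
  qed
  moreover have "(\<lambda>x. f' x * g' x) analytic_on {0}"
    using f'(1) g'(1) by (rule analytic_on_mult)
  ultimately show ?thesis unfolding pole_le_def by blast
qed

lemma pole_le_powi: "pole_le n (\<lambda>x. x powi (- n))"
  unfolding pole_le_def by (rule exI[of _ "\<lambda>_. 1"]) auto

lemma pole_le_analytic: "f analytic_on {0} \<Longrightarrow> pole_le 0 f"
  unfolding pole_le_def by (rule exI[of _ f]) auto

lemma pole_le_mono:
  assumes "pole_le m f" and "m \<le> n"
  shows "pole_le n f"
proof -
  obtain f' where f': "f' analytic_on {0}" "\<forall>\<^sub>F x in at 0. f x = x powi (- m) * f' x"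
    using assms(1) unfolding pole_le_def by blast
  have "\<forall>\<^sub>F x in at 0. f x = x powi (- n) * (x ^ nat (n - m) * f' x)"
    using f'(2) eventually_nonzero
  proof eventually_elim
    case (elim x)
    have "x powi (- m) = x powi (- n) * x powi (n - m)"
      using elim(2) power_int_add[of x "- n" "n - m"] by simp
    then show ?case using elim(1) assms(2) by (simp add: power_int_def mult.assoc)
  qed
  moreover have "(\<lambda>x. x ^ nat (n - m) * f' x) analytic_on {0}"
    using f'(1) by (intro analytic_intros)
  ultimately show ?thesis
    unfolding pole_le_def by blast
qed

lemma pole_le_add:
  assumes "pole_le n f" and "pole_le n g"
  shows "pole_le n (\<lambda>x. f x + g x)"
proof -
  obtain f' where f': "f' analytic_on {0}" "\<forall>\<^sub>F x in at 0. f x = x powi (- n) * f' x"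
    using assms(1) unfolding pole_le_def by blast
  obtain g' where g': "g' analytic_on {0}" "\<forall>\<^sub>F x in at 0. g x = x powi (- n) * g' x"
    using assms(2) unfolding pole_le_def by blast
  have "\<forall>\<^sub>F x in at 0. f x + g x = x powi (- n) * (f' x + g' x)"
    using f'(2) g'(2) by eventually_elim (simp add: algebra_simps)
  moreover have "(\<lambda>x. f' x + g' x) analytic_on {0}"
    using f'(1) g'(1) by (rule analytic_on_add)
  ultimately show ?thesis unfolding pole_le_def by blast
qed

lemma pole_le_zero: "pole_le n (\<lambda>_. 0)"
  unfolding pole_le_def by (rule exI[of _ "\<lambda>_. 0"]) auto

lemma pole_le_imp_meromorphic:
  assumes "pole_le n f" shows "f meromorphic_on {0}"
proof -
  obtain g where g: "g analytic_on {0}" "\<forall>\<^sub>F x in at 0. f x = x powi (- n) * g x"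
    using assms unfolding pole_le_def by blast
  have "(\<lambda>x. x powi (- n) * g x) meromorphic_on {0}"
    using g(1) by (intro meromorphic_intros analytic_on_imp_meromorphic_on)
  moreover have "f meromorphic_on {0} \<longleftrightarrow> (\<lambda>x. x powi (- n) * g x) meromorphic_on {0}"
    by (rule meromorphic_on_cong) (use g(2) in auto)
  ultimately show ?thesis by simp
qed

lemma pole_le_compose_root:
  assumes "pole_le n f" and "c \<noteq> 0" and "k > 0"
  shows "pole_le (int k * n) (\<lambda>u. f (c * u ^ k))"
proof -
  obtain g where g: "g analytic_on {0}" "\<forall>\<^sub>F x in at 0. f x = x powi (- n) * g x"
    using assms(1) unfolding pole_le_def by blast
  have lim: "filterlim (\<lambda>u::complex. c * u ^ k) (at 0) (at 0)"
  proof (rule filterlim_atI)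
    have "((\<lambda>u::complex. c * u ^ k) \<longlongrightarrow> c * 0 ^ k) (at 0)" by (intro tendsto_intros)
    moreover have "c * 0 ^ k = 0" using assms(3) by simp
    ultimately show "((\<lambda>u::complex. c * u ^ k) \<longlongrightarrow> 0) (at 0)" by (simp only:)
    show "\<forall>\<^sub>F u in at 0. c * u ^ k \<noteq> 0"
      using eventually_nonzero by eventually_elim (simp add: assms(2))
  qed
  have "\<forall>\<^sub>F u in at 0. f (c * u ^ k) = (c * u ^ k) powi (- n) * g (c * u ^ k)"
    using eventually_compose_filterlim[OF g(2) lim] .
  then have "\<forall>\<^sub>F u in at 0. f (c * u ^ k) = u powi (- (int k * n)) * (c powi (- n) * g (c * u ^ k))"
  proof eventually_elim
    case (elim u)
    have "(u ^ k) powi (- n) = u powi (- (int k * n))"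
      using power_int_mult[of u "int k" "- n"] by simp
    then show ?case using elim by (simp add: power_int_mult_distrib)
  qed
  moreover have "(\<lambda>u. c powi (- n) * g (c * u ^ k)) analytic_on {0}"
  proof -
    have "(g \<circ> (\<lambda>u. c * u ^ k)) analytic_on {0}"
    proof (rule analytic_on_compose)
      show "(\<lambda>u. c * u ^ k) analytic_on {0}" by (intro analytic_intros)
      show "g analytic_on (\<lambda>u. c * u ^ k) ` {0}" using g(1) assms(3) by (simp add: zero_power)
    qed
    then show ?thesis by (intro analytic_on_mult) (auto simp: o_def)
  qed
  ultimately show ?thesis unfolding pole_le_def by blast
qed

lemma not_pole_le_one:
  assumes "n < 0" shows "\<not> pole_le n (\<lambda>_. 1)"
proof
  assume "pole_le n (\<lambda>_. 1)"
  then obtain g where g: "g analytic_on {0}" "\<forall>\<^sub>F x in at 0. 1 = x powi (- n) * g x"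
    unfolding pole_le_def by blast
  have "isCont g 0" using g(1) analytic_at_imp_isCont by blast
  then have "(g \<longlongrightarrow> g 0) (at 0)" by (simp add: isCont_def)
  then have "((\<lambda>x. x ^ nat (- n) * g x) \<longlongrightarrow> 0 ^ nat (- n) * g 0) (at 0)"
    by (intro tendsto_intros)
  moreover have "\<forall>\<^sub>F x in at 0. x ^ nat (- n) * g x = 1"
    using g(2) by eventually_elim (use assms in \<open>simp add: power_int_def\<close>)
  ultimately have "((\<lambda>_. 1::complex) \<longlongrightarrow> 0 ^ nat (- n) * g 0) (at (0::complex))"
    using Lim_transform_eventually by fastforce
  then have "1 = (0::complex) ^ nat (- n) * g 0"
    by (rule LIM_const_eq)
  moreover have "(0::complex) ^ nat (- n) = 0" using assms by (cases "nat (- n)") auto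
  ultimately show False by simp
qed

lemma pole_le_mult_holomorphic: "pole_le 0 f \<Longrightarrow> pole_le n g \<Longrightarrow> pole_le n (\<lambda>x. f x * g x)"
  using pole_le_mult[of 0 f n g] by simp

section \<open>Functions regular off the marked point\<close>

definition regular ::
  "'p marked_surface \<Rightarrow> ((complex \<Rightarrow> complex) \<Rightarrow> bool) \<Rightarrow> 'p set \<Rightarrow> (complex \<Rightarrow> complex) \<Rightarrow> bool" where
  "regular S P U f \<longleftrightarrow>
     f holomorphic_on dom_off_mark S U \<and> (mark S \<in> U \<longrightarrow> P (\<lambda>x. f (loc S x)))"

text \<open>
  The sheaves \<open>O(*m)\<close> and \<open>O(n m)\<close> differ only in the condition on the germ at the marked
  point. With that condition as a parameter, one argument serves both.
\<close>

definition O_germ ::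
  "'p marked_surface \<Rightarrow> ((complex \<Rightarrow> complex) \<Rightarrow> bool) \<Rightarrow> 'p set \<Rightarrow> (complex \<Rightarrow> complex) set" where
  "O_germ S P U = {f \<in> extensional (dom_off_mark S U). regular S P U f}"

abbreviation mero :: "(complex \<Rightarrow> complex) \<Rightarrow> bool" where
  "mero h \<equiv> h meromorphic_on {0}"

text \<open>
  Sections carry an arbitrary value off their domain, so only conditions that ignore values away
  from a punctured neighbourhood of \<open>0\<close> make sense for them.
\<close>

definition germ_property :: "((complex \<Rightarrow> complex) \<Rightarrow> bool) \<Rightarrow> bool" where
  "germ_property P \<longleftrightarrow> (\<forall>f g. (\<forall>\<^sub>F x in at 0. f x = g x) \<longrightarrow> P f \<longrightarrow> P g)"

lemma germ_propertyD:
  "germ_property P \<Longrightarrow> \<forall>\<^sub>F x in at 0. f x = g x \<Longrightarrow> P f \<Longrightarrow> P g"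
  unfolding germ_property_def by blast

lemma O_mer_eq: "O_mer S = O_germ S mero"
  by (rule ext) (auto simp: O_mer_def O_germ_def regular_def)

lemma O_pole_eq: "O_pole S n = O_germ S (pole_le n)"
  by (rule ext) (auto simp: O_pole_def O_mer_def O_germ_def regular_def dest: pole_le_imp_meromorphic)

lemma germ_property_pole_le: "germ_property (pole_le n)"
  unfolding germ_property_def using pole_le_cong by blast

lemma germ_property_mero: "germ_property mero"
  unfolding germ_property_def
proof (intro allI impI)
  fix f g :: "complex \<Rightarrow> complex"
  assume "\<forall>\<^sub>F x in at 0. f x = g x" and "mero f"
  then show "mero g" using meromorphic_on_cong[of "{0}" f g "{0}"] by auto
qed

lemma regular_mono: "regular S P U f \<Longrightarrow> (\<And>h. P h \<Longrightarrow> Q h) \<Longrightarrow> regular S Q U f"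
  by (auto simp: regular_def)

lemma regular_add:
  assumes "regular S P U f" and "regular S P U g"
    and "\<And>h k. P h \<Longrightarrow> P k \<Longrightarrow> P (\<lambda>x. h x + k x)"
  shows "regular S P U (\<lambda>z. f z + g z)"
  using assms by (auto simp: regular_def intro!: holomorphic_on_add)

lemma regular_mult:
  assumes "regular S P U f" and "regular S Q U g"
    and "\<And>h k. P h \<Longrightarrow> Q k \<Longrightarrow> R (\<lambda>x. h x * k x)"
  shows "regular S R U (\<lambda>z. f z * g z)"
  using assms by (auto simp: regular_def intro!: holomorphic_on_mult)

lemma regular_sum:
  assumes "\<And>i. i \<in> I \<Longrightarrow> regular S P U (f i)"
    and "\<And>h k. P h \<Longrightarrow> P k \<Longrightarrow> P (\<lambda>x. h x + k x)" and "P (\<lambda>_. 0)"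
  shows "regular S P U (\<lambda>z. \<Sum>i\<in>I. f i z)"
  using assms(1)
proof (induction I rule: infinite_finite_induct)
  case (insert i I)
  then show ?case
    using regular_add[of S P U "f i" "\<lambda>z. \<Sum>i\<in>I. f i z"] assms(2) by simp
qed (auto simp: regular_def assms(3))

lemma regular_zero: "P (\<lambda>_. 0) \<Longrightarrow> regular S P U (\<lambda>_. 0)"
  by (auto simp: regular_def)

lemma dom_off_mark_mono: "U \<subseteq> V \<Longrightarrow> dom_off_mark S U \<subseteq> dom_off_mark S V"
  by (auto simp: dom_off_mark_def)

text \<open>
  What the two pairs \<open>(\<complex>P\<^sup>1, \<infinity>)\<close> and \<open>(disc, 0)\<close> have in common. A neighbourhood of the marked
  point that avoids \<open>z = 0\<close> is singled out because on the projective line the local coordinate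
  \<open>x = 1/z\<close> is not a function there.
\<close>

locale surface =
  fixes S :: "'p marked_surface"
  assumes open_dom: "openin (opens S) U \<Longrightarrow> open (dom_off_mark S U)"
    and near_mark: "openin (opens S) U \<Longrightarrow> mark S \<in> U \<Longrightarrow> \<forall>\<^sub>F x in at 0. loc S x \<in> dom_off_mark S U"
    and mark_in: "mark S \<in> topspace (opens S)"
    and open_off_mark: "openin (opens S) (topspace (opens S) - {mark S})"
    and mark_nbhd: "\<exists>U. openin (opens S) U \<and> mark S \<in> U \<and> 0 \<notin> dom_off_mark S U"
    and loc_holomorphic: "loc S holomorphic_on - {0}"
    and loc_nonzero: "z \<noteq> 0 \<Longrightarrow> loc S z \<noteq> 0"
    and loc_loc: "loc S (loc S z) = z"
begin

lemma regular_cong: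
  assumes U: "openin (opens S) U" and P: "germ_property P"
    and eq: "\<And>z. z \<in> dom_off_mark S U \<Longrightarrow> f z = g z"
  shows "regular S P U f \<longleftrightarrow> regular S P U g"
proof -
  have "mark S \<in> U \<Longrightarrow> P (\<lambda>x. f (loc S x)) \<longleftrightarrow> P (\<lambda>x. g (loc S x))"
  proof -
    assume "mark S \<in> U"
    have fg: "\<forall>\<^sub>F x in at 0. f (loc S x) = g (loc S x)"
      by (rule eventually_mono[OF near_mark[OF U \<open>mark S \<in> U\<close>]]) (rule eq)
    then have gf: "\<forall>\<^sub>F x in at 0. g (loc S x) = f (loc S x)"
      by eventually_elim simp
    show ?thesis using germ_propertyD[OF P fg] germ_propertyD[OF P gf] by (rule iffI)
  qed
  moreover have "f holomorphic_on dom_off_mark S U \<longleftrightarrow> g holomorphic_on dom_off_mark S U"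
    by (rule holomorphic_cong) (auto intro: eq)
  ultimately show ?thesis by (auto simp: regular_def)
qed

lemma regular_transfer:
  assumes "openin (opens S) U" and "germ_property P" and "regular S P U f"
    and "\<And>z. z \<in> dom_off_mark S U \<Longrightarrow> f z = g z"
  shows "regular S P U g"
  using regular_cong[OF assms(1,2), of f g] assms(3,4) by simp

lemma restrict_mem_O_germ:
  assumes "openin (opens S) U" and "germ_property P"
  shows "restrict f (dom_off_mark S U) \<in> O_germ S P U \<longleftrightarrow> regular S P U f"
  using regular_cong[OF assms, of "restrict f (dom_off_mark S U)" f] by (auto simp: O_germ_def)

lemma regular_subset:
  assumes "V \<subseteq> U" and "regular S P U f"
  shows "regular S P V f"
  using assms dom_off_mark_mono[OF assms(1), of S]
  by (auto simp: regular_def elim: holomorphic_on_subset)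

text \<open>
  Holomorphy is local off the marked point, and the germ condition is witnessed by any member of
  the cover that contains the marked point.
\<close>

lemma regular_local:
  assumes "openin (opens S) U"
    and loc: "\<And>p. p \<in> U \<Longrightarrow> \<exists>V. openin (opens S) V \<and> p \<in> V \<and> V \<subseteq> U \<and> regular S P V f"
  shows "regular S P U f"
  unfolding regular_def
proof (intro conjI impI)
  have "f analytic_on dom_off_mark S U"
    unfolding analytic_on_def
  proof
    fix z assume z: "z \<in> dom_off_mark S U"
    then obtain V where V: "openin (opens S) V" "incl S z \<in> V" "V \<subseteq> U" "regular S P V f"
      using loc[of "incl S z"] by (auto simp: dom_off_mark_def)
    then have "z \<in> dom_off_mark S V" using z by (auto simp: dom_off_mark_def)
    then obtain e where "e > 0" "ball z e \<subseteq> dom_off_mark S V"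
      using open_dom[OF V(1)] open_contains_ball by blast
    then show "\<exists>e>0. f holomorphic_on ball z e"
      using V(4) unfolding regular_def by (meson holomorphic_on_subset)
  qed
  then show "f holomorphic_on dom_off_mark S U" by (rule analytic_imp_holomorphic)
  show "P (\<lambda>x. f (Defs.loc S x))" if "mark S \<in> U"
    using loc[OF that] by (auto simp: regular_def)
qed

text \<open>
  Near the marked point the local coordinate is holomorphic and without zeros off that point, so
  its powers identify the sheaves \<open>O(n m)\<close> for different \<open>n\<close>.
\<close>

lemma regular_shift:
  assumes "openin (opens S) U" and "0 \<notin> dom_off_mark S U"
  shows "regular S (pole_le (n + k)) U (\<lambda>z. loc S z powi (- k) * f z) \<longleftrightarrow> regular S (pole_le n) U f"
proof -
  have *: "regular S (pole_le (m + l)) U (\<lambda>z. loc S z powi (- l) * g z)"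
    if "regular S (pole_le m) U g" for m l g
  proof -
    have "(\<lambda>z. loc S z powi (- l)) holomorphic_on dom_off_mark S U"
    proof (rule holomorphic_on_power_int)
      show "loc S holomorphic_on dom_off_mark S U"
        using loc_holomorphic assms(2) by (auto elim: holomorphic_on_subset)
    qed (use loc_nonzero assms(2) in metis)
    then have "regular S (pole_le l) U (\<lambda>z. loc S z powi (- l))"
      using pole_le_powi by (auto simp: regular_def loc_loc)
    then show ?thesis
      using that by (rule regular_mult) (auto simp: add.commute[of m] intro: pole_le_mult)
  qed
  have "regular S (pole_le n) U f"
    if "regular S (pole_le (n + k)) U (\<lambda>z. loc S z powi (- k) * f z)"
  proof -
    have eq: "loc S z powi (- (- k)) * (loc S z powi (- k) * f z) = f z"
      if "z \<in> dom_off_mark S U" for z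
    proof -
      have "loc S z \<noteq> 0" using that assms(2) loc_nonzero by metis
      then show ?thesis by (simp add: power_int_minus)
    qed
    have "regular S (pole_le n) U (\<lambda>z. loc S z powi (- (- k)) * (loc S z powi (- k) * f z))"
      using *[OF that, of "- k"] by simp
    then show ?thesis by (rule regular_transfer[OF assms(1) germ_property_pole_le]) (rule eq)
  qed
  moreover have "regular S (pole_le (n + k)) U (\<lambda>z. loc S z powi (- k) * f z)"
    if "regular S (pole_le n) U f"
    using that by (rule *)
  ultimately show ?thesis by (rule iffI)
qed

end

section \<open>Sheaves given by a frame\<close>

definition frame_sections ::
  "'p marked_surface \<Rightarrow> nat \<Rightarrow> (complex \<Rightarrow> complex mat) \<Rightarrow>
   (nat \<Rightarrow> (complex \<Rightarrow> complex) \<Rightarrow> bool) \<Rightarrow> 'p set \<Rightarrow> (complex \<Rightarrow> complex vec) set" where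
  "frame_sections S n A P U =
     {\<lambda>z\<in>dom_off_mark S U. A z *\<^sub>v Matrix.vec n (\<lambda>j. f j z) | f. \<forall>j<n. f j \<in> O_germ S (P j) U}"

text \<open>
  The filtration is the one in which column \<open>j\<close> of the frame \<open>A\<close> has order \<open>- a j\<close>.
\<close>

definition framed_bundle ::
  "'p marked_surface \<Rightarrow> nat \<Rightarrow> (complex \<Rightarrow> complex mat) \<Rightarrow> (nat \<Rightarrow> real) \<Rightarrow>
   ('p, complex vec) fsheaf" where
  "framed_bundle S n A a = \<lparr>
     sec = frame_sections S n A (\<lambda>_. mero),
     filt = (\<lambda>\<beta>. frame_sections S n A (\<lambda>j. pole_le \<lfloor>\<beta> + a j\<rfloor>))\<rparr>"

text \<open>
  The left inverse \<open>B\<close> expresses the linear independence of the columns of \<open>A\<close> in a form that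
  computes the coefficients of a section.
\<close>

locale framed = surface S for S :: "'p marked_surface" +
  fixes K n :: nat and A B :: "complex \<Rightarrow> complex mat"
  assumes frame_carrier: "\<And>z. A z \<in> carrier_mat K n"
    and coframe_carrier: "\<And>z. B z \<in> carrier_mat n K"
    and coframe: "\<And>z. z \<in> dom_off_mark S (topspace (opens S)) \<Longrightarrow> B z * A z = 1\<^sub>m n"
begin

lemma coframe_frame:
  assumes "openin (opens S) U" and "z \<in> dom_off_mark S U" and "v \<in> carrier_vec n"
  shows "B z *\<^sub>v (A z *\<^sub>v v) = v"
proof -
  have "z \<in> dom_off_mark S (topspace (opens S))"
    using assms(2) dom_off_mark_mono[OF openin_subset[OF assms(1)], of S] by blast
  have "B z *\<^sub>v (A z *\<^sub>v v) = (B z * A z) *\<^sub>v v"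
    by (rule assoc_mult_mat_vec[symmetric, OF coframe_carrier frame_carrier assms(3)])
  also have "\<dots> = v"
    using coframe[OF \<open>z \<in> dom_off_mark S (topspace (opens S))\<close>] assms(3) by simp
  finally show ?thesis .
qed

text \<open>
  Since the coframe recovers the coefficients, being a section is a condition on each of them
  separately. The sheaf and module axioms below thus reduce to those of the structure sheaves.
\<close>

lemma mem_frame_sections:
  assumes U: "openin (opens S) U" and P: "\<And>j. germ_property (P j)"
  shows "s \<in> frame_sections S n A P U \<longleftrightarrow>
     s \<in> extensional (dom_off_mark S U) \<and>
     (\<forall>z\<in>dom_off_mark S U. s z \<in> carrier_vec K \<and> s z = A z *\<^sub>v (B z *\<^sub>v s z)) \<and>
     (\<forall>j<n. regular S (P j) U (\<lambda>z. vec_index (B z *\<^sub>v s z) j))"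
    (is "_ \<longleftrightarrow> ?ext \<and> ?val \<and> ?reg")
proof
  assume "s \<in> frame_sections S n A P U"
  then obtain f where s: "s = (\<lambda>z\<in>dom_off_mark S U. A z *\<^sub>v Matrix.vec n (\<lambda>j. f j z))"
    and f: "\<forall>j<n. f j \<in> O_germ S (P j) U"
    unfolding frame_sections_def by blast
  have B: "B z *\<^sub>v s z = Matrix.vec n (\<lambda>j. f j z)" if "z \<in> dom_off_mark S U" for z
    using coframe_frame[OF U that] that by (simp add: s)
  have ?reg
  proof (intro allI impI)
    fix j assume "j < n"
    then have "regular S (P j) U (f j)" using f by (auto simp: O_germ_def)
    then show "regular S (P j) U (\<lambda>z. vec_index (B z *\<^sub>v s z) j)"
      using regular_cong[OF U P, of "\<lambda>z. vec_index (B z *\<^sub>v s z) j" "f j" j] B \<open>j < n\<close> by simp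
  qed
  moreover have ?val using B frame_carrier by (auto simp: s intro!: mult_mat_vec_carrier)
  ultimately show "?ext \<and> ?val \<and> ?reg" by (auto simp: s)
next
  assume r: "?ext \<and> ?val \<and> ?reg"
  define f where "f = (\<lambda>j. \<lambda>z\<in>dom_off_mark S U. vec_index (B z *\<^sub>v s z) j)"
  have "s = (\<lambda>z\<in>dom_off_mark S U. A z *\<^sub>v Matrix.vec n (\<lambda>j. f j z))"
  proof (rule extensionalityI[of _ "dom_off_mark S U"])
    fix z assume z: "z \<in> dom_off_mark S U"
    have "Matrix.vec n (\<lambda>j. f j z) = B z *\<^sub>v s z"
      using z coframe_carrier[of z] by (intro eq_vecI) (auto simp: f_def)
    then show "s z = (\<lambda>z\<in>dom_off_mark S U. A z *\<^sub>v Matrix.vec n (\<lambda>j. f j z)) z"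
      using z r by simp
  qed (use r in auto)
  moreover have "\<forall>j<n. f j \<in> O_germ S (P j) U"
    using r restrict_mem_O_germ[OF U P] by (simp add: f_def)
  ultimately show "s \<in> frame_sections S n A P U"
    unfolding frame_sections_def by blast
qed

lemma is_sheaf_frame_sections:
  assumes P: "\<And>j. germ_property (P j)"
  shows "is_sheaf S (frame_sections S n A P)"
  unfolding is_sheaf_def
proof (intro conjI allI impI)
  fix U assume "openin (opens S) U"
  show "frame_sections S n A P U \<subseteq> extensional (dom_off_mark S U)"
    by (auto simp: frame_sections_def)
next
  fix U V s
  assume a: "openin (opens S) U \<and> openin (opens S) V \<and> V \<subseteq> U \<and> s \<in> frame_sections S n A P U"
  then have U: "openin (opens S) U" and V: "openin (opens S) V" and "V \<subseteq> U" by auto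
  have sub: "dom_off_mark S V \<subseteq> dom_off_mark S U" using \<open>V \<subseteq> U\<close> by (rule dom_off_mark_mono)
  have s: "\<forall>z\<in>dom_off_mark S U. s z \<in> carrier_vec K \<and> s z = A z *\<^sub>v (B z *\<^sub>v s z)"
    "\<forall>j<n. regular S (P j) U (\<lambda>z. vec_index (B z *\<^sub>v s z) j)"
    using a mem_frame_sections[where P = P, OF U P, of s] by auto
  have "regular S (P j) V (\<lambda>z. vec_index (B z *\<^sub>v restrict s (dom_off_mark S V) z) j)" if "j < n" for j
    using regular_cong[OF V P, of "\<lambda>z. vec_index (B z *\<^sub>v restrict s (dom_off_mark S V) z) j"
        "\<lambda>z. vec_index (B z *\<^sub>v s z) j" j] regular_subset[OF \<open>V \<subseteq> U\<close>] s(2) that by simp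
  moreover have "\<forall>z\<in>dom_off_mark S V. s z \<in> carrier_vec K \<and> s z = A z *\<^sub>v (B z *\<^sub>v s z)"
    using sub s(1) by blast
  ultimately show "restrict s (dom_off_mark S V) \<in> frame_sections S n A P V"
    unfolding mem_frame_sections[where P = P, OF V P] by simp
next
  fix U s
  assume a: "openin (opens S) U \<and> s \<in> extensional (dom_off_mark S U) \<and>
     (\<forall>p\<in>U. \<exists>V. openin (opens S) V \<and> p \<in> V \<and> V \<subseteq> U \<and>
        restrict s (dom_off_mark S V) \<in> frame_sections S n A P V)"
  have loc: "\<exists>V. openin (opens S) V \<and> p \<in> V \<and> V \<subseteq> U \<and>
      (\<forall>z\<in>dom_off_mark S V. s z \<in> carrier_vec K \<and> s z = A z *\<^sub>v (B z *\<^sub>v s z)) \<and>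
      (\<forall>j<n. regular S (P j) V (\<lambda>z. vec_index (B z *\<^sub>v s z) j))" if p: "p \<in> U" for p
  proof -
    obtain V where V: "openin (opens S) V" "p \<in> V" "V \<subseteq> U"
      "restrict s (dom_off_mark S V) \<in> frame_sections S n A P V"
      using a p by blast
    have 1: "\<forall>z\<in>dom_off_mark S V. s z \<in> carrier_vec K \<and> s z = A z *\<^sub>v (B z *\<^sub>v s z)"
      using V(4) mem_frame_sections[where P = P, OF V(1) P, of "restrict s (dom_off_mark S V)"] by simp
    have "regular S (P j) V (\<lambda>z. vec_index (B z *\<^sub>v s z) j)" if "j < n" for j
      using regular_cong[OF V(1) P, of "\<lambda>z. vec_index (B z *\<^sub>v restrict s (dom_off_mark S V) z) j"
          "\<lambda>z. vec_index (B z *\<^sub>v s z) j" j]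
        V(4) mem_frame_sections[where P = P, OF V(1) P, of "restrict s (dom_off_mark S V)"] that by simp
    with V 1 show ?thesis by blast
  qed
  have "\<forall>z\<in>dom_off_mark S U. s z \<in> carrier_vec K \<and> s z = A z *\<^sub>v (B z *\<^sub>v s z)"
  proof
    fix z assume z: "z \<in> dom_off_mark S U"
    then have "incl S z \<in> U" by (simp add: dom_off_mark_def)
    from loc[OF this] z show "s z \<in> carrier_vec K \<and> s z = A z *\<^sub>v (B z *\<^sub>v s z)"
      by (auto simp: dom_off_mark_def)
  qed
  moreover have "\<forall>j<n. regular S (P j) U (\<lambda>z. vec_index (B z *\<^sub>v s z) j)"
  proof (intro allI impI)
    fix j assume "j < n"
    show "regular S (P j) U (\<lambda>z. vec_index (B z *\<^sub>v s z) j)"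
    proof (rule regular_local)
      show "openin (opens S) U" using a by blast
      show "\<exists>V. openin (opens S) V \<and> p \<in> V \<and> V \<subseteq> U \<and>
          regular S (P j) V (\<lambda>z. vec_index (B z *\<^sub>v s z) j)" if "p \<in> U" for p
        using loc[OF that] \<open>j < n\<close> by metis
    qed
  qed
  moreover have "openin (opens S) U" using a by blast
  ultimately show "s \<in> frame_sections S n A P U"
    using a mem_frame_sections[where P = P, OF _ P, of U s] by simp
qed

lemma is_module_sheaf_frame_sections:
  assumes P: "\<And>j. germ_property (P j)" and zero: "\<And>j. P j (\<lambda>_. 0)"
    and add: "\<And>j h k. P j h \<Longrightarrow> P j k \<Longrightarrow> P j (\<lambda>x. h x + k x)"
    and mult: "\<And>j h k. Q h \<Longrightarrow> P j k \<Longrightarrow> P j (\<lambda>x. h x * k x)"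
  shows "is_module_sheaf S K (O_germ S Q) (frame_sections S n A P)"
  unfolding is_module_sheaf_def
proof (intro conjI allI impI ballI is_sheaf_frame_sections P)
  fix U assume U: "openin (opens S) U"
  note mem = mem_frame_sections[where P = P, OF U P]
  note A = frame_carrier and B = coframe_carrier
  have dimB: "dim_row (B z) = n" for z using B[of z] by simp
  note reg_cong = regular_cong[OF U P]
  show "s z \<in> carrier_vec K" if "s \<in> frame_sections S n A P U" "z \<in> dom_off_mark S U" for s z
    using that mem[of s] by simp
  have B0: "B z *\<^sub>v 0\<^sub>v K = 0\<^sub>v n" and A0: "A z *\<^sub>v 0\<^sub>v n = 0\<^sub>v K" for z
    using A[of z] B[of z] by (auto intro!: eq_vecI)
  have "regular S (P j) U (\<lambda>z. vec_index (B z *\<^sub>v (\<lambda>z\<in>dom_off_mark S U. 0\<^sub>v K) z) j)" if "j < n" for j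
    using reg_cong[of "\<lambda>z. vec_index (B z *\<^sub>v (\<lambda>z\<in>dom_off_mark S U. 0\<^sub>v K) z) j" "\<lambda>_. 0" j]
      regular_zero[of "P j", OF zero] that by (simp add: B0)
  then show "(\<lambda>z\<in>dom_off_mark S U. 0\<^sub>v K) \<in> frame_sections S n A P U"
    by (simp add: mem B0 A0)
  show "(\<lambda>z\<in>dom_off_mark S U. s z + s' z) \<in> frame_sections S n A P U"
    if s: "s \<in> frame_sections S n A P U" and s': "s' \<in> frame_sections S n A P U" for s s'
  proof -
    have sz: "s z \<in> carrier_vec K" "s z = A z *\<^sub>v (B z *\<^sub>v s z)"
      "s' z \<in> carrier_vec K" "s' z = A z *\<^sub>v (B z *\<^sub>v s' z)" if "z \<in> dom_off_mark S U" for z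
      using s s' that mem[of s] mem[of s'] by blast+
    have Bs: "B z *\<^sub>v (s z + s' z) = B z *\<^sub>v s z + B z *\<^sub>v s' z" if "z \<in> dom_off_mark S U" for z
      using sz[OF that] B by (auto intro: mult_add_distrib_mat_vec)
    have "A z *\<^sub>v (B z *\<^sub>v (s z + s' z)) = s z + s' z" if "z \<in> dom_off_mark S U" for z
    proof -
      have "A z *\<^sub>v (B z *\<^sub>v (s z + s' z)) = A z *\<^sub>v (B z *\<^sub>v s z) + A z *\<^sub>v (B z *\<^sub>v s' z)"
        unfolding Bs[OF that]
        by (rule mult_add_distrib_mat_vec[OF A]) (use mult_mat_vec_carrier[OF B] sz[OF that] in simp_all)
      then show ?thesis using sz[OF that] by simp
    qed
    moreover have "regular S (P j) U
        (\<lambda>z. vec_index (B z *\<^sub>v (\<lambda>z\<in>dom_off_mark S U. s z + s' z) z) j)" if j: "j < n" for j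
    proof -
      have "regular S (P j) U (\<lambda>z. vec_index (B z *\<^sub>v s z) j + vec_index (B z *\<^sub>v s' z) j)"
        by (rule regular_add) (use s s' mem[of s] mem[of s'] j add in auto)
      then show ?thesis
        using j B by (subst reg_cong[where g = "\<lambda>z. vec_index (B z *\<^sub>v s z) j + vec_index (B z *\<^sub>v s' z) j"])
          (auto simp: Bs dimB)
    qed
    ultimately show ?thesis using sz unfolding mem by simp
  qed
  show "(\<lambda>z\<in>dom_off_mark S U. f z \<cdot>\<^sub>v s z) \<in> frame_sections S n A P U"
    if f: "f \<in> O_germ S Q U" and s: "s \<in> frame_sections S n A P U" for f s
  proof -
    have sz: "s z \<in> carrier_vec K" "s z = A z *\<^sub>v (B z *\<^sub>v s z)" if "z \<in> dom_off_mark S U" for z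
      using s that mem[of s] by blast+
    have Bs: "B z *\<^sub>v (f z \<cdot>\<^sub>v s z) = f z \<cdot>\<^sub>v (B z *\<^sub>v s z)" if "z \<in> dom_off_mark S U" for z
      by (rule mult_mat_vec[OF B sz(1)[OF that]])
    have "A z *\<^sub>v (B z *\<^sub>v (f z \<cdot>\<^sub>v s z)) = f z \<cdot>\<^sub>v s z" if "z \<in> dom_off_mark S U" for z
    proof -
      have "A z *\<^sub>v (B z *\<^sub>v (f z \<cdot>\<^sub>v s z)) = f z \<cdot>\<^sub>v (A z *\<^sub>v (B z *\<^sub>v s z))"
        unfolding Bs[OF that] by (rule mult_mat_vec[OF A]) (use mult_mat_vec_carrier[OF B] sz[OF that] in simp_all)
      then show ?thesis using sz[OF that] by simp
    qed
    moreover have "regular S (P j) U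
        (\<lambda>z. vec_index (B z *\<^sub>v (\<lambda>z\<in>dom_off_mark S U. f z \<cdot>\<^sub>v s z) z) j)" if j: "j < n" for j
    proof -
      have "regular S (P j) U (\<lambda>z. f z * vec_index (B z *\<^sub>v s z) j)"
        by (rule regular_mult[of S Q U f "P j"]) (use f s mem[of s] j mult in \<open>auto simp: O_germ_def\<close>)
      then show ?thesis
        using j B by (subst reg_cong[where g = "\<lambda>z. f z * vec_index (B z *\<^sub>v s z) j"])
          (auto simp: Bs dimB)
    qed
    ultimately show ?thesis using sz unfolding mem by simp
  qed
qed

lemma frame_injective:
  assumes "openin (opens S) U" and "z \<in> dom_off_mark S U" and "v \<in> carrier_vec n"
    and "A z *\<^sub>v v = 0\<^sub>v K"
  shows "v = 0\<^sub>v n"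
proof -
  have "B z *\<^sub>v 0\<^sub>v K = 0\<^sub>v n" using coframe_carrier[of z] by (auto intro!: eq_vecI)
  then show ?thesis using coframe_frame[OF assms(1-3)] assms(4) by simp
qed

lemma locally_free_mero:
  "locally_free S K n (O_mer S) (frame_sections S n A (\<lambda>_. mero))"
  unfolding locally_free_def
proof (intro conjI ballI)
  show "is_module_sheaf S K (O_mer S) (frame_sections S n A (\<lambda>_. mero))"
    unfolding O_mer_eq
    by (rule is_module_sheaf_frame_sections)
       (auto intro: germ_property_mero meromorphic_on_add meromorphic_on_mult meromorphic_on_const)
  fix p assume "p \<in> topspace (opens S)"
  then show "\<exists>U A'. openin (opens S) U \<and> p \<in> U \<and>
        (\<forall>z\<in>dom_off_mark S U. A' z \<in> carrier_mat K n \<and>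
           (\<forall>v\<in>carrier_vec n. A' z *\<^sub>v v = 0\<^sub>v K \<longrightarrow> v = 0\<^sub>v n)) \<and>
        (\<forall>V. openin (opens S) V \<and> V \<subseteq> U \<longrightarrow> frame_sections S n A (\<lambda>_. mero) V =
           {\<lambda>z\<in>dom_off_mark S V. A' z *\<^sub>v Matrix.vec n (\<lambda>j. f j z) | f. \<forall>j<n. f j \<in> O_mer S V})"
    using frame_injective frame_carrier
    by (intro exI[of _ "topspace (opens S)"] exI[of _ A]) (auto simp: frame_sections_def O_mer_eq)
qed

text \<open>
  Multiplying a column of the frame by a power of the local coordinate shifts the bound on the
  poles of its coefficient. Once all bounds are \<open>0\<close>, the sheaf is visibly free over \<open>O\<close>.
\<close>

lemma frame_sections_twist:
  assumes V: "openin (opens S) V" and "0 \<notin> dom_off_mark S V"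
  shows "frame_sections S n A (\<lambda>j. pole_le (d j + k j)) V =
    frame_sections S n (\<lambda>z. Matrix.mat K n (\<lambda>(i, j). A z $$ (i, j) * loc S z powi (- k j)))
      (\<lambda>j. pole_le (d j)) V"
    (is "_ = frame_sections S n ?A _ V")
proof -
  have tw: "?A z *\<^sub>v Matrix.vec n g = A z *\<^sub>v Matrix.vec n (\<lambda>j. loc S z powi (- k j) * g j)" for z g
    using frame_carrier[of z] by (intro eq_vecI) (auto simp: scalar_prod_def mult.assoc intro!: sum.cong)
  show ?thesis
  proof (intro Set.set_eqI iffI)
    fix s assume "s \<in> frame_sections S n A (\<lambda>j. pole_le (d j + k j)) V"
    then obtain f where s: "s = (\<lambda>z\<in>dom_off_mark S V. A z *\<^sub>v Matrix.vec n (\<lambda>j. f j z))"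
      and f: "\<forall>j<n. f j \<in> O_germ S (pole_le (d j + k j)) V"
      unfolding frame_sections_def by blast
    define g where "g = (\<lambda>j. \<lambda>z\<in>dom_off_mark S V. loc S z powi k j * f j z)"
    have fg: "loc S z powi (- k j) * g j z = f j z" if "z \<in> dom_off_mark S V" for j z
    proof -
      have "loc S z \<noteq> 0" using that assms(2) loc_nonzero by metis
      then show ?thesis using that by (simp add: g_def power_int_minus)
    qed
    have "g j \<in> O_germ S (pole_le (d j)) V" if "j < n" for j
    proof -
      have "regular S (pole_le (d j + k j)) V (f j)" using f that by (auto simp: O_germ_def)
      then have "regular S (pole_le (d j)) V (\<lambda>z. loc S z powi k j * f j z)"
        using regular_shift[OF assms, of "d j + k j" "- k j" "f j"] by simp
      then show ?thesis
        by (simp add: g_def restrict_mem_O_germ[OF V germ_property_pole_le])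
    qed
    moreover have "s = (\<lambda>z\<in>dom_off_mark S V. ?A z *\<^sub>v Matrix.vec n (\<lambda>j. g j z))"
      unfolding s tw by (intro restrict_ext) (simp add: fg)
    ultimately show "s \<in> frame_sections S n ?A (\<lambda>j. pole_le (d j)) V"
      unfolding frame_sections_def by blast
  next
    fix s assume "s \<in> frame_sections S n ?A (\<lambda>j. pole_le (d j)) V"
    then obtain f where s: "s = (\<lambda>z\<in>dom_off_mark S V. ?A z *\<^sub>v Matrix.vec n (\<lambda>j. f j z))"
      and f: "\<forall>j<n. f j \<in> O_germ S (pole_le (d j)) V"
      unfolding frame_sections_def by blast
    define g where "g = (\<lambda>j. \<lambda>z\<in>dom_off_mark S V. loc S z powi (- k j) * f j z)"
    have "g j \<in> O_germ S (pole_le (d j + k j)) V" if "j < n" for j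
      using f that regular_shift[OF assms, of "d j" "k j" "f j"]
      by (simp add: g_def restrict_mem_O_germ[OF V germ_property_pole_le]) (simp add: O_germ_def)
    moreover have "s = (\<lambda>z\<in>dom_off_mark S V. A z *\<^sub>v Matrix.vec n (\<lambda>j. g j z))"
      unfolding s tw by (intro restrict_ext) (simp add: g_def)
    ultimately show "s \<in> frame_sections S n A (\<lambda>j. pole_le (d j + k j)) V"
      unfolding frame_sections_def by blast
  qed
qed

text \<open>
  Off the marked point the bounds on poles are void and \<open>A\<close> is a frame; near it the rescaled
  frame of the previous lemma is one.
\<close>

lemma locally_free_pole_le:
  "locally_free S K n (O_hol S) (frame_sections S n A (\<lambda>j. pole_le (d j)))"
  unfolding locally_free_def
proof (intro conjI ballI)
  show "is_module_sheaf S K (O_hol S) (frame_sections S n A (\<lambda>j. pole_le (d j)))"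
    unfolding O_pole_eq
  proof (rule is_module_sheaf_frame_sections)
    show "germ_property (pole_le (d j))" for j by (rule germ_property_pole_le)
    show "pole_le (d j) (\<lambda>_. 0)" for j by (rule pole_le_zero)
    show "pole_le (d j) (\<lambda>x. h x + k x)" if "pole_le (d j) h" "pole_le (d j) k" for j h k
      using that by (rule pole_le_add)
    show "pole_le (d j) (\<lambda>x. h x * k x)" if "pole_le 0 h" "pole_le (d j) k" for j h k
      using that by (rule pole_le_mult_holomorphic)
  qed
  fix p assume p: "p \<in> topspace (opens S)"
  let ?goal = "\<lambda>U A'. openin (opens S) U \<and> p \<in> U \<and>
        (\<forall>z\<in>dom_off_mark S U. A' z \<in> carrier_mat K n \<and>
           (\<forall>v\<in>carrier_vec n. A' z *\<^sub>v v = 0\<^sub>v K \<longrightarrow> v = 0\<^sub>v n)) \<and>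
        (\<forall>V. openin (opens S) V \<and> V \<subseteq> U \<longrightarrow> frame_sections S n A (\<lambda>j. pole_le (d j)) V =
           {\<lambda>z\<in>dom_off_mark S V. A' z *\<^sub>v Matrix.vec n (\<lambda>j. f j z) | f. \<forall>j<n. f j \<in> O_hol S V})"
  show "\<exists>U A'. ?goal U A'"
  proof (cases "p = mark S")
    case False
    let ?U = "topspace (opens S) - {mark S}"
    have "frame_sections S n A (\<lambda>j. pole_le (d j)) V =
        {\<lambda>z\<in>dom_off_mark S V. A z *\<^sub>v Matrix.vec n (\<lambda>j. f j z) | f. \<forall>j<n. f j \<in> O_hol S V}"
      if "openin (opens S) V \<and> V \<subseteq> ?U" for V
    proof -
      have "f \<in> O_germ S (pole_le m) V \<longleftrightarrow>
          f \<in> extensional (dom_off_mark S V) \<and> f holomorphic_on dom_off_mark S V" for f m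
        using that by (auto simp: O_germ_def regular_def)
      then show ?thesis by (simp add: frame_sections_def O_pole_eq)
    qed
    then have "?goal ?U A"
      using frame_injective[OF open_off_mark] frame_carrier False p open_off_mark by simp
    then show ?thesis by blast
  next
    case True
    obtain U where U: "openin (opens S) U" "mark S \<in> U" "0 \<notin> dom_off_mark S U"
      using mark_nbhd by blast
    define A' where "A' = (\<lambda>z. Matrix.mat K n (\<lambda>(i, j). A z $$ (i, j) * loc S z powi (- d j)))"
    have "v = 0\<^sub>v n" if z: "z \<in> dom_off_mark S U" and v: "v \<in> carrier_vec n" and 0: "A' z *\<^sub>v v = 0\<^sub>v K" for z v
    proof -
      define w where "w = Matrix.vec n (\<lambda>j. loc S z powi (- d j) * vec_index v j)"
      have "A' z *\<^sub>v v = A z *\<^sub>v w"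
        using frame_carrier[of z] v unfolding w_def A'_def
        by (intro eq_vecI) (auto simp: scalar_prod_def mult.assoc intro!: sum.cong)
      then have "w = 0\<^sub>v n" using frame_injective[OF U(1) z, of w] 0 by (simp add: w_def)
      have "loc S z \<noteq> 0" using z U(3) loc_nonzero by metis
      show ?thesis
      proof (rule eq_vecI)
        fix j assume j: "j < dim_vec (0\<^sub>v n :: complex vec)"
        then have "vec_index w j = 0" using \<open>w = 0\<^sub>v n\<close> by simp
        then show "vec_index v j = vec_index (0\<^sub>v n) j"
          using j \<open>loc S z \<noteq> 0\<close> by (simp add: w_def)
      qed (use v in auto)
    qed
    moreover have "frame_sections S n A (\<lambda>j. pole_le (d j)) V =
        {\<lambda>z\<in>dom_off_mark S V. A' z *\<^sub>v Matrix.vec n (\<lambda>j. f j z) | f. \<forall>j<n. f j \<in> O_hol S V}"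
      if "openin (opens S) V \<and> V \<subseteq> U" for V
    proof -
      have "0 \<notin> dom_off_mark S V" using that U(3) dom_off_mark_mono[of V U S] by blast
      then show ?thesis
        using frame_sections_twist[of V "\<lambda>_. 0" d] that
        by (simp add: A'_def) (simp add: frame_sections_def O_pole_eq)
    qed
    moreover have "A' z \<in> carrier_mat K n" for z by (simp add: A'_def)
    ultimately have "?goal U A'" using U(1,2) True by simp
    then show ?thesis by blast
  qed
qed

lemma frame_sections_mono:
  assumes "\<And>j h. P j h \<Longrightarrow> Q j h"
  shows "frame_sections S n A P U \<subseteq> frame_sections S n A Q U"
proof -
  have "O_germ S (P j) U \<subseteq> O_germ S (Q j) U" for j
    using assms by (auto simp: O_germ_def regular_def)
  then show ?thesis unfolding frame_sections_def by blast
qed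

text \<open>
  The filtration jumps where some \<open>\<alpha> + a j\<close> is an integer. It is continuous from the right because
  the floor function is.
\<close>

theorem filtered_bundle_framed_bundle: "filtered_bundle S K n (framed_bundle S n A a)"
  unfolding filtered_bundle_def framed_bundle_def fsheaf.simps
proof (intro conjI allI impI)
  let ?F = "\<lambda>\<alpha>. frame_sections S n A (\<lambda>j. pole_le \<lfloor>\<alpha> + a j\<rfloor>)"
  show "locally_free S K n (O_mer S) (frame_sections S n A (\<lambda>_. mero))"
    by (rule locally_free_mero)
  show "locally_free S K n (O_hol S) (?F \<alpha>)" for \<alpha>
    by (rule locally_free_pole_le)
  show "?F \<alpha> U \<subseteq> frame_sections S n A (\<lambda>_. mero) U" for \<alpha> U
    by (rule frame_sections_mono) (rule pole_le_imp_meromorphic)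
  show "?F \<alpha> U \<subseteq> ?F \<beta> U"
    if "openin (opens S) U \<and> \<alpha> \<le> \<beta>" for \<alpha> \<beta> U
    using that by (intro frame_sections_mono) (auto elim!: pole_le_mono intro!: floor_mono)
  show "?F \<alpha> U = frame_sections S n A (\<lambda>_. mero) U"
    if "openin (opens S) U \<and> mark S \<notin> U" for \<alpha> U
    using that by (auto simp: frame_sections_def O_germ_def regular_def)
  show "?F \<alpha> U =
      (\<Inter>\<beta>\<in>{\<alpha><..}. ?F \<beta> U)"
    if U: "openin (opens S) U" for \<alpha> U
  proof (intro antisym INT_greatest)
    show "?F \<alpha> U \<subseteq> ?F \<beta> U"
      if "\<beta> \<in> {\<alpha><..}" for \<beta>
      using that by (intro frame_sections_mono) (auto elim!: pole_le_mono intro!: floor_mono)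
    show "(\<Inter>\<beta>\<in>{\<alpha><..}. ?F \<beta> U)
        \<subseteq> ?F \<alpha> U"
    proof
      fix s assume s: "s \<in> (\<Inter>\<beta>\<in>{\<alpha><..}. ?F \<beta> U)"
      have mem: "t \<in> frame_sections S n A (\<lambda>j. pole_le (d j)) U \<longleftrightarrow>
          t \<in> extensional (dom_off_mark S U) \<and>
          (\<forall>z\<in>dom_off_mark S U. t z \<in> carrier_vec K \<and> t z = A z *\<^sub>v (B z *\<^sub>v t z)) \<and>
          (\<forall>j<n. regular S (pole_le (d j)) U (\<lambda>z. vec_index (B z *\<^sub>v t z) j))" for t d
        by (rule mem_frame_sections[OF U germ_property_pole_le])
      have "\<alpha> + 1 \<in> {\<alpha><..}" by simp
      then have "s \<in> ?F (\<alpha> + 1) U" using s by blast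
      moreover have "regular S (pole_le \<lfloor>\<alpha> + a j\<rfloor>) U (\<lambda>z. vec_index (B z *\<^sub>v s z) j)" if "j < n" for j
      proof -
        (* the midpoint between alpha and the next jump of the j-th coefficient *)
        define \<beta> where "\<beta> = (\<alpha> + (of_int \<lfloor>\<alpha> + a j\<rfloor> + 1 - a j)) / 2"
        have fl: "of_int \<lfloor>\<alpha> + a j\<rfloor> \<le> \<alpha> + a j" "\<alpha> + a j < of_int \<lfloor>\<alpha> + a j\<rfloor> + 1"
          by linarith+
        have "\<alpha> < \<beta>" using fl by (simp add: \<beta>_def field_simps)
        moreover have "\<lfloor>\<beta> + a j\<rfloor> = \<lfloor>\<alpha> + a j\<rfloor>"
        proof (rule floor_unique)
          show "of_int \<lfloor>\<alpha> + a j\<rfloor> \<le> \<beta> + a j" using fl unfolding \<beta>_def by argo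
          show "\<beta> + a j < of_int \<lfloor>\<alpha> + a j\<rfloor> + 1" using fl unfolding \<beta>_def by argo
        qed
        moreover have "s \<in> ?F \<beta> U"
          using s \<open>\<alpha> < \<beta>\<close> by blast
        then have "regular S (pole_le \<lfloor>\<beta> + a j\<rfloor>) U (\<lambda>z. vec_index (B z *\<^sub>v s z) j)"
          using that unfolding mem by blast
        ultimately show ?thesis by simp
      qed
      ultimately show "s \<in> ?F \<alpha> U"
        unfolding mem by blast
    qed
  qed
  obtain U0 where U0: "openin (opens S) U0" "mark S \<in> U0" "0 \<notin> dom_off_mark S U0"
    using mark_nbhd by blast
  have shift: "?F (\<alpha> - 1) U =
      (\<lambda>s. \<lambda>z\<in>dom_off_mark S U. loc S z \<cdot>\<^sub>v s z) ` ?F \<alpha> U"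
    if "openin (opens S) U \<and> U \<subseteq> U0" for \<alpha> U
  proof -
    define A' where "A' = (\<lambda>z. Matrix.mat K n (\<lambda>(i, j). A z $$ (i, j) * loc S z powi (- (- 1))))"
    have "0 \<notin> dom_off_mark S U" using that U0(3) dom_off_mark_mono[of U U0 S] by blast
    moreover have fl: "\<lfloor>\<alpha> - 1 + a j\<rfloor> = \<lfloor>\<alpha> + a j\<rfloor> + (- 1)" for j by linarith
    ultimately have "?F (\<alpha> - 1) U =
        frame_sections S n A' (\<lambda>j. pole_le \<lfloor>\<alpha> + a j\<rfloor>) U"
      using frame_sections_twist[of U "\<lambda>j. \<lfloor>\<alpha> + a j\<rfloor>" "\<lambda>_. - 1"] that
      by (simp only: A'_def fl simp_thms)
    also have "\<dots> = (\<lambda>s. \<lambda>z\<in>dom_off_mark S U. loc S z \<cdot>\<^sub>v s z) ` ?F \<alpha> U"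
    proof -
      have "A' z *\<^sub>v v = loc S z \<cdot>\<^sub>v (A z *\<^sub>v v)" if "v \<in> carrier_vec n" for z v
        using frame_carrier[of z] that unfolding A'_def
        by (intro eq_vecI) (auto simp: scalar_prod_def sum_distrib_left mult_ac intro!: sum.cong)
      then have A': "(\<lambda>z\<in>dom_off_mark S U. A' z *\<^sub>v Matrix.vec n (\<lambda>j. f j z)) =
          (\<lambda>z\<in>dom_off_mark S U. loc S z \<cdot>\<^sub>v (\<lambda>z\<in>dom_off_mark S U. A z *\<^sub>v Matrix.vec n (\<lambda>j. f j z)) z)" for f
        by (intro restrict_ext) simp
      then show ?thesis unfolding frame_sections_def A' by blast
    qed
    finally show ?thesis .
  qed
  show "\<exists>U0. openin (opens S) U0 \<and> mark S \<in> U0 \<and>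
        (\<forall>\<alpha> U. openin (opens S) U \<and> U \<subseteq> U0 \<longrightarrow>
           ?F (\<alpha> - 1) U =
             (\<lambda>s. \<lambda>z\<in>dom_off_mark S U. loc S z \<cdot>\<^sub>v s z) ` ?F \<alpha> U)"
    by (intro exI[of _ U0] conjI allI impI U0 shift) simp_all
qed

end

section \<open>The projective line and the disc\<close>

lemma CP1_simps [simp]:
  "opens CP1 = Alexandroff_compactification euclidean" "incl CP1 = Some" "mark CP1 = None"
  "loc CP1 = inverse"
  by (simp_all add: CP1_def)

lemma disc_simps [simp]:
  "opens (disc r) = top_of_set (ball 0 r)" "incl (disc r) = id" "mark (disc r) = 0" "loc (disc r) = id"
  by (simp_all add: disc_def)

lemma dom_off_mark_CP1: "dom_off_mark CP1 U = {z. Some z \<in> U}"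
  by (auto simp: dom_off_mark_def)

lemma dom_off_mark_disc: "dom_off_mark (disc r) U = U - {0}"
  by (auto simp: dom_off_mark_def)

lemma openin_CP1:
  "openin (opens CP1) U \<longleftrightarrow>
     (\<exists>V. open V \<and> U = Some ` V) \<or> (\<exists>C. compact C \<and> U = insert None (Some ` (- C)))"
proof -
  have "insert None (range Some) - Some ` C = insert None (Some ` (- C))" for C :: "complex set"
    by auto
  then show ?thesis
    by (auto simp: openin_Alexandroff_compactification compact_imp_closed)
qed

interpretation CP1: surface CP1
proof
  fix U :: "complex option set"
  assume U: "openin (opens CP1) U"
  then show "open (dom_off_mark CP1 U)"
  proof (unfold openin_CP1, elim disjE exE conjE)
    fix V :: "complex set" assume "open V" "U = Some ` V"
    moreover have "{z. Some z \<in> Some ` V} = V" by auto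
    ultimately show ?thesis by (simp add: dom_off_mark_CP1)
  next
    fix C :: "complex set" assume "compact C" "U = insert None (Some ` (- C))"
    moreover have "{z. Some z \<in> insert None (Some ` (- C))} = - C" by auto
    ultimately show ?thesis by (simp add: dom_off_mark_CP1 compact_imp_closed open_Compl)
  qed
  assume "mark CP1 \<in> U"
  then obtain C where C: "compact C" "U = insert None (Some ` (- C))"
    using U unfolding openin_CP1 by auto
  from C(1) have "bounded C" by (rule compact_imp_bounded)
  then obtain M where M: "\<And>z. z \<in> C \<Longrightarrow> norm z \<le> M" unfolding bounded_iff by blast
  have "\<forall>\<^sub>F z in at_infinity. z \<notin> C"
    unfolding eventually_at_infinity
  proof (intro exI[of _ "M + 1"] allI impI)
    fix z :: complex assume "M + 1 \<le> norm z" then show "z \<notin> C" using M[of z] by linarith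
  qed
  then have "\<forall>\<^sub>F x in at 0. inverse x \<notin> C"
    by (rule eventually_compose_filterlim) (rule filterlim_inverse_at_infinity)
  then show "\<forall>\<^sub>F x in at 0. loc CP1 x \<in> dom_off_mark CP1 U"
    by eventually_elim (auto simp: dom_off_mark_CP1 C(2))
next
  show "openin (opens CP1) (topspace (opens CP1) - {mark CP1})"
  proof -
    have "topspace (opens CP1) - {mark CP1} = Some ` UNIV" by auto
    then show ?thesis unfolding openin_CP1 using open_UNIV by blast
  qed
  have "openin (opens CP1) (insert None (Some ` (- {0})))"
    unfolding openin_CP1 using compact_sing by blast
  then show "\<exists>U. openin (opens CP1) U \<and> mark CP1 \<in> U \<and> 0 \<notin> dom_off_mark CP1 U"
    by (intro exI[of _ "insert None (Some ` (- {0}))"]) (auto simp: dom_off_mark_CP1)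
  show "loc CP1 holomorphic_on - {0}" by (auto intro!: holomorphic_intros)
qed auto

lemma disc_surface:
  assumes "r > 0"
  shows "surface (disc r)"
proof
  fix U :: "complex set"
  assume U: "openin (opens (disc r)) U"
  then have "open U" by (simp add: openin_open_eq)
  then show "open (dom_off_mark (disc r) U)" by (simp add: dom_off_mark_disc open_delete)
  assume "mark (disc r) \<in> U"
  then show "\<forall>\<^sub>F x in at 0. loc (disc r) x \<in> dom_off_mark (disc r) U"
    using eventually_at_in_open[OF \<open>open U\<close>, of 0] by (simp add: dom_off_mark_disc)
next
  show "openin (opens (disc r)) (topspace (opens (disc r)) - {mark (disc r)})"
    by (simp add: openin_open_eq open_delete) 
  show "\<exists>U. openin (opens (disc r)) U \<and> mark (disc r) \<in> U \<and> 0 \<notin> dom_off_mark (disc r) U"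
    using assms by (intro exI[of _ "ball 0 r"]) (auto simp: dom_off_mark_disc openin_open_eq)
  show "loc (disc r) holomorphic_on - {0}" by (auto intro!: holomorphic_intros simp: id_def)
qed (use assms in auto)

section \<open>Alternating tensors\<close>

text \<open>
  Every permutation is a product of transpositions, and composing with a transposition on the
  right exchanges two entries of the list.
\<close>

lemma alternating_permute:
  assumes T: "alternating n T" and p: "\<sigma> permutes {..<n}"
  shows "T (map \<sigma> [0..<n]) = of_int (sign \<sigma>) * T [0..<n]"
  using finite_lessThan p
proof (induction rule: permutes_rev_induct)
  case id
  then show ?case by simp
next
  case (swap i j \<sigma>)
  have *: "T (map (\<sigma> \<circ> Transposition.transpose i j) [0..<n]) = - T (map \<sigma> [0..<n])"
    if "i < j" "j < n" for i j
  proof -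
    have "map (\<sigma> \<circ> Transposition.transpose i j) [0..<n] =
        (map \<sigma> [0..<n])[i := map \<sigma> [0..<n] ! j, j := map \<sigma> [0..<n] ! i]"
      by (rule nth_equalityI)
        (use that in \<open>auto simp: nth_list_update Transposition.transpose_def\<close>)
    then show ?thesis
      using T that unfolding alternating_def by (metis length_map length_upt minus_nat.diff_0)
  qed
  have "T (map (\<sigma> \<circ> Transposition.transpose i j) [0..<n]) = - T (map \<sigma> [0..<n])"
  proof (cases "i < j")
    case True
    then show ?thesis using *[of i j] swap by simp
  next
    case False
    then show ?thesis using *[of j i] swap by (simp add: transpose_commute)
  qed
  moreover have "sign (\<sigma> \<circ> Transposition.transpose i j) = - sign \<sigma>"
    using swap.hyps by (subst sign_compose)
      (auto simp: sign_swap_id permutation_swap_id intro: permutation_permutes[THEN iffD2])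
  ultimately show ?case using swap.IH by (simp del: map_map comp_apply)
qed

lemma alternating_repeat:
  fixes T :: "nat list \<Rightarrow> complex"
  assumes T: "alternating n T" and "length J = n" and "\<not> distinct J"
  shows "T J = 0"
proof -
  obtain i j where "i < n" "j < n" "i \<noteq> j" "J ! i = J ! j"
    using assms(2,3) by (auto simp: distinct_conv_nth)
  then obtain i j where ij: "i < j" "j < n" "J ! i = J ! j"
    by (metis nat_neq_iff)
  then have "T (J[i := J ! j, j := J ! i]) = - T J"
    using T assms(2) unfolding alternating_def by blast
  moreover have "J[i := J ! j, j := J ! i] = J"
    using ij(3) by (metis list_update_id)
  ultimately show ?thesis by simp
qed

lemma pure_tensor_unit:
  assumes "length J = n" and "set J \<subseteq> {..<n}" and "\<sigma> permutes {..<n}"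
  shows "pure_tensor n n (\<lambda>j. unit_vec n (\<sigma> j)) J = (if J = map \<sigma> [0..<n] then 1 else 0)"
proof -
  have "pure_tensor n n (\<lambda>j. unit_vec n (\<sigma> j)) J = (\<Prod>j<n. if J ! j = \<sigma> j then 1 else 0)"
  proof -
    have "J ! j < n" if "j < n" for j using assms(1,2) that nth_mem[of j J] by blast
    moreover have "\<sigma> j < n" if "j < n" for j using permutes_in_image[OF assms(3)] that by auto
    ultimately show ?thesis
      using assms(1,2) by (auto simp: pure_tensor_def unit_vec_def intro!: prod.cong)
  qed
  also have "\<dots> = (if \<forall>j<n. J ! j = \<sigma> j then 1 else 0)"
    by (auto simp: prod_zero_iff)
  also have "(\<forall>j<n. J ! j = \<sigma> j) \<longleftrightarrow> J = map \<sigma> [0..<n]"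
    using assms(1) by (auto simp: list_eq_iff_nth_eq)
  finally show ?thesis .
qed

text \<open>
  Exchanging two entries of \<open>J\<close> amounts to reindexing the sum over all permutations by a
  transposition, which reverses all signs.
\<close>

lemma alternating_wedge: "alternating n (wedge K n v)"
  unfolding alternating_def
proof (intro allI impI)
  fix J :: "nat list" and i j :: nat
  assume a: "length J = n \<and> i < j \<and> j < n"
  define \<tau> where "\<tau> = Transposition.transpose i j"
  define J' where "J' = J[i := J ! j, j := J ! i]"
  have \<tau>: "\<tau> permutes {..<n}" unfolding \<tau>_def using a by (intro permutes_swap_id) auto
  have J'_nth: "J' ! k = J ! \<tau> k" if "k < n" for k
    using a that by (auto simp: J'_def \<tau>_def Transposition.transpose_def nth_list_update)
  have "set J' = set J"
    unfolding J'_def using a by (intro set_swap) auto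
  have pt: "pure_tensor K n w J' = pure_tensor K n (w \<circ> \<tau>) J" for w
  proof (cases "set J \<subseteq> {..<K}")
    case True
    have "(\<Prod>k<n. vec_index (w k) (J' ! k)) = (\<Prod>k<n. vec_index (w k) (J ! \<tau> k))"
      by (intro prod.cong) (auto simp: J'_nth)
    also have "\<dots> = (\<Prod>k<n. vec_index (w (\<tau> k)) (J ! \<tau> (\<tau> k)))"
      by (rule prod.permute[OF \<tau>, unfolded o_def])
    also have "\<dots> = (\<Prod>k<n. vec_index (w (\<tau> k)) (J ! k))"
      by (simp add: \<tau>_def)
    finally show ?thesis using True a \<open>set J' = set J\<close> by (simp add: pure_tensor_def J'_def)
  qed (use \<open>set J' = set J\<close> in \<open>simp add: pure_tensor_def\<close>)
  have "wedge K n v J' =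
      (\<Sum>\<sigma> | \<sigma> permutes {..<n}. of_int (sign \<sigma>) * pure_tensor K n (\<lambda>k. v ((\<sigma> \<circ> \<tau>) k)) J)"
    unfolding wedge_def pt by (simp add: o_def)
  also have "\<dots> = (\<Sum>\<sigma> | \<sigma> permutes {..<n}. - (of_int (sign (\<sigma> \<circ> \<tau>)) * pure_tensor K n (\<lambda>k. v ((\<sigma> \<circ> \<tau>) k)) J))"
  proof (intro sum.cong refl)
    fix \<sigma> assume "\<sigma> \<in> {\<sigma>. \<sigma> permutes {..<n}}"
    then have "sign (\<sigma> \<circ> \<tau>) = - sign \<sigma>"
      using a unfolding \<tau>_def by (subst sign_compose)
        (auto simp: sign_swap_id permutation_swap_id intro: permutation_permutes[THEN iffD2])
    then show "of_int (sign \<sigma>) * pure_tensor K n (\<lambda>k. v ((\<sigma> \<circ> \<tau>) k)) J =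
        - (of_int (sign (\<sigma> \<circ> \<tau>)) * pure_tensor K n (\<lambda>k. v ((\<sigma> \<circ> \<tau>) k)) J)" by simp
  qed
  also have "\<dots> = - wedge K n v J"
    unfolding wedge_def sum_negf
    by (subst sum_permutations_compose_right[OF \<tau>, symmetric]) simp
  finally show "wedge K n v (J[i := J ! j, j := J ! i]) = - wedge K n v J" by (simp add: J'_def)
qed

lemma wedge_unit_upt: "wedge n n (unit_vec n) [0..<n] = 1"
proof -
  have "wedge n n (unit_vec n) [0..<n] =
      (\<Sum>\<sigma> | \<sigma> permutes {..<n}. if \<sigma> = id then 1 else 0)"
    unfolding wedge_def
  proof (intro sum.cong refl)
    fix \<sigma> assume "\<sigma> \<in> {\<sigma>. \<sigma> permutes {..<n}}"
    then have \<sigma>: "\<sigma> permutes {..<n}" by simp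
    have "[0..<n] = map \<sigma> [0..<n] \<longleftrightarrow> \<sigma> = id"
    proof
      assume "[0..<n] = map \<sigma> [0..<n]"
      then have "\<sigma> k = k" if "k < n" for k
        using that by (metis add_0 diff_zero length_upt nth_map nth_upt)
      moreover have "\<sigma> k = k" if "\<not> k < n" for k using \<sigma> that by (simp add: permutes_def)
      ultimately show "\<sigma> = id" by (intro ext) (metis id_apply)
    qed simp
    then show "of_int (sign \<sigma>) * pure_tensor n n (\<lambda>j. unit_vec n (\<sigma> j)) [0..<n] =
        (if \<sigma> = id then 1 else 0)"
      using pure_tensor_unit[of "[0..<n]" n \<sigma>] \<sigma> by (simp add: sign_id lessThan_atLeast0)
  qed
  also have "\<dots> = 1" by (simp add: finite_permutations permutes_id)
  finally show ?thesis .
qed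

text \<open>
  The top exterior power is one-dimensional: an alternating tensor vanishes on lists with a
  repetition, and on permutations of \<open>[0..<n]\<close> it is determined up to sign by one value.
\<close>

theorem alternating_eq_wedge:
  assumes T: "alternating n T"
    and supp: "\<And>J. \<not> (length J = n \<and> set J \<subseteq> {..<n}) \<Longrightarrow> T J = 0"
  shows "T J = T [0..<n] * wedge n n (unit_vec n) J"
proof (cases "length J = n \<and> set J \<subseteq> {..<n}")
  case False
  then have "wedge n n (unit_vec n) J = 0" by (simp only: wedge_def pure_tensor_def if_False mult_zero_right sum.neutral_const)
  then show ?thesis using supp[OF False] by (simp only: mult_zero_right)
next
  case J: True
  show ?thesis
  proof (cases "distinct J")
    case False
    then show ?thesis
      using alternating_repeat[OF T] alternating_repeat[OF alternating_wedge] J by simp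
  next
    case True
    (* a list without repetitions, read as a permutation that fixes all other numbers *)
    define \<sigma> where "\<sigma> k = (if k < n then J ! k else k)" for k
    have "inj_on \<sigma> {..<n}"
      using True J by (auto simp: inj_on_def \<sigma>_def nth_eq_iff_index_eq)
    moreover have "\<sigma> ` {..<n} \<subseteq> {..<n}" using J by (auto simp: \<sigma>_def dest!: nth_mem)
    ultimately have "bij_betw \<sigma> {..<n} {..<n}"
      by (simp add: bij_betw_def endo_inj_surj)
    then have "\<sigma> permutes {..<n}" by (rule bij_imp_permutes) (simp add: \<sigma>_def)
    moreover have "map \<sigma> [0..<n] = J" using J by (intro nth_equalityI) (auto simp: \<sigma>_def)
    ultimately show ?thesis
      using alternating_permute[OF T, of \<sigma>] alternating_permute[OF alternating_wedge, of \<sigma> n n "unit_vec n"]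
        wedge_unit_upt[of n] by simp
  qed
qed

section \<open>Direct sums of lines as filtered \<open>SL(K)\<close>-bundles\<close>

lemma regular_const: "regular S (pole_le 0) U (\<lambda>_. c)"
  by (auto simp: regular_def intro: pole_le_analytic)

text \<open>
  The condition \<open>R F\<close> on a partial product may depend on the set \<open>F\<close> of factors, so that pole
  orders can be added up.
\<close>

lemma regular_prod:
  assumes "finite I" and "\<And>i. i \<in> I \<Longrightarrow> regular S (P i) U (f i)"
    and one: "R {} (\<lambda>_. 1)"
    and step: "\<And>F i h k. i \<notin> F \<Longrightarrow> finite F \<Longrightarrow> P i h \<Longrightarrow> R F k \<Longrightarrow> R (insert i F) (\<lambda>x. h x * k x)"
  shows "regular S (R I) U (\<lambda>z. \<Prod>i\<in>I. f i z)"
  using assms(1,2)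
proof (induction I)
  case empty
  then show ?case by (simp add: regular_def one)
next
  case (insert i F)
  have "regular S (R (insert i F)) U (\<lambda>z. f i z * (\<Prod>i\<in>F. f i z))"
    by (rule regular_mult[of S "P i" U "f i" "R F"]) (use insert step in auto)
  then show ?case using insert.hyps by simp
qed

lemma regular_pole_le_imp_mero: "regular S (pole_le n) U f \<Longrightarrow> regular S mero U f"
  using pole_le_imp_meromorphic by (auto simp: regular_def)

lemma coordinate_sections:
  "{s \<in> dom_off_mark S U \<rightarrow>\<^sub>E carrier_vec n.
      \<forall>i<n. (\<lambda>z\<in>dom_off_mark S U. vec_index (s z) i) \<in> O_germ S (P i) U}
   = frame_sections S n (\<lambda>_. 1\<^sub>m n) P U" (is "?C = _")
proof (intro Set.set_eqI iffI)
  fix s assume s: "s \<in> ?C"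
  define f where "f i = (\<lambda>z\<in>dom_off_mark S U. vec_index (s z) i)" for i
  have "s = (\<lambda>z\<in>dom_off_mark S U. 1\<^sub>m n *\<^sub>v Matrix.vec n (\<lambda>j. f j z))"
  proof (rule extensionalityI[of _ "dom_off_mark S U"])
    fix z assume z: "z \<in> dom_off_mark S U"
    then have "s z \<in> carrier_vec n" using s by auto
    then have "Matrix.vec n (\<lambda>j. f j z) = s z" using z by (intro eq_vecI) (auto simp: f_def)
    then show "s z = (\<lambda>z\<in>dom_off_mark S U. 1\<^sub>m n *\<^sub>v Matrix.vec n (\<lambda>j. f j z)) z"
      using z \<open>s z \<in> carrier_vec n\<close> by simp
  qed (use s in \<open>auto simp: PiE_def\<close>)
  moreover have "\<forall>j<n. f j \<in> O_germ S (P j) U" using s by (simp add: f_def)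
  ultimately show "s \<in> frame_sections S n (\<lambda>_. 1\<^sub>m n) P U" unfolding frame_sections_def by blast
next
  fix s assume "s \<in> frame_sections S n (\<lambda>_. 1\<^sub>m n) P U"
  then obtain f where s: "s = (\<lambda>z\<in>dom_off_mark S U. 1\<^sub>m n *\<^sub>v Matrix.vec n (\<lambda>j. f j z))"
    and f: "\<forall>j<n. f j \<in> O_germ S (P j) U"
    unfolding frame_sections_def by blast
  have "(\<lambda>z\<in>dom_off_mark S U. vec_index (s z) i) = f i" if "i < n" for i
  proof (rule extensionalityI[of _ "dom_off_mark S U"])
    show "f i \<in> extensional (dom_off_mark S U)" using f that by (auto simp: O_germ_def)
  qed (use that in \<open>auto simp: s\<close>)
  then show "s \<in> ?C" using f by (auto simp: s)
qed

abbreviation line_sum :: "nat \<Rightarrow> (nat \<Rightarrow> real) \<Rightarrow> (complex option, complex vec) fsheaf" where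
  "line_sum K a \<equiv> direct_sum CP1 K (\<lambda>i. O_line (a i))"

lemma line_sum_eq_framed_bundle: "line_sum K a = framed_bundle CP1 K (\<lambda>_. 1\<^sub>m K) a"
  unfolding direct_sum_def O_line_def framed_bundle_def
  by (simp add: O_mer_eq O_pole_eq coordinate_sections)

lemma filtered_bundle_line_sum: "filtered_bundle CP1 K K (line_sum K a)"
proof -
  interpret framed CP1 K K "\<lambda>_. 1\<^sub>m K" "\<lambda>_. 1\<^sub>m K" by unfold_locales auto
  show ?thesis unfolding line_sum_eq_framed_bundle by (rule filtered_bundle_framed_bundle)
qed

lemma mem_sec_line_sum:
  assumes "openin (opens CP1) U"
  shows "s \<in> sec (line_sum K a) U \<longleftrightarrow> s \<in> dom_off_mark CP1 U \<rightarrow>\<^sub>E carrier_vec K \<and>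
    (\<forall>i<K. regular CP1 mero U (\<lambda>z. vec_index (s z) i))"
  using CP1.restrict_mem_O_germ[OF assms germ_property_mero]
  by (simp add: direct_sum_def O_line_def O_mer_eq)

lemma mem_filt_line_sum:
  assumes "openin (opens CP1) U"
  shows "s \<in> filt (line_sum K a) \<beta> U \<longleftrightarrow> s \<in> dom_off_mark CP1 U \<rightarrow>\<^sub>E carrier_vec K \<and>
    (\<forall>i<K. regular CP1 (pole_le \<lfloor>\<beta> + a i\<rfloor>) U (\<lambda>z. vec_index (s z) i))"
  using CP1.restrict_mem_O_germ[OF assms germ_property_pole_le]
  by (simp add: direct_sum_def O_line_def O_pole_eq)

lemma filt_line_sum_imp_sec:
  assumes "openin (opens CP1) W" and "t \<in> filt (line_sum K a) \<beta> W"
  shows "t \<in> sec (line_sum K a) W"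
  using assms(2) unfolding mem_filt_line_sum[OF assms(1)] mem_sec_line_sum[OF assms(1)]
  by (blast intro: regular_pole_le_imp_mero)

lemma pure_tensor_smult:
  assumes "\<And>j. j < n \<Longrightarrow> v j \<in> carrier_vec K"
  shows "pure_tensor K n (\<lambda>j. c j \<cdot>\<^sub>v v j) J = (\<Prod>j<n. c j) * pure_tensor K n v J"
proof (cases "length J = n \<and> set J \<subseteq> {..<K}")
  case True
  have "J ! j < dim_vec (v j)" if "j < n" for j
  proof -
    have "J ! j \<in> {..<K}" using True that nth_mem[of j J] by blast
    then show ?thesis using assms[OF that] by simp
  qed
  then show ?thesis using True by (simp add: pure_tensor_def prod.distrib)
qed (auto simp: pure_tensor_def)

lemma sec_tensor_support:
  assumes "\<tau> \<in> sec (tensor_power CP1 K n E) V" and "z \<in> dom_off_mark CP1 V"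
    and "\<not> (length J = n \<and> set J \<subseteq> {..<K})"
  shows "\<tau> z J = 0"
proof -
  have "Some z \<in> V" using assms(2) by (simp add: dom_off_mark_CP1)
  then obtain W m s where "Some z \<in> W"
    "\<forall>z\<in>dom_off_mark CP1 W. \<tau> z = (\<lambda>J. \<Sum>k<(m::nat). pure_tensor K n (\<lambda>j. s k j z) J)"
    using assms(1) unfolding tensor_power_def fsheaf.simps by blast
  then have "\<tau> z J = (\<Sum>k<m. pure_tensor K n (\<lambda>j. s k j z) J)"
    by (simp add: dom_off_mark_CP1)
  also have "\<dots> = 0" using assms(3) by (simp only: pure_tensor_def if_False sum.neutral_const)
  finally show ?thesis .
qed

lemma sec_tensor_regular:
  assumes V: "openin (opens CP1) V" and \<tau>: "\<tau> \<in> sec (tensor_power CP1 K K (line_sum K a)) V"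
  shows "regular CP1 mero V (\<lambda>z. \<tau> z [0..<K])"
proof (rule CP1.regular_local[OF V])
  fix p assume "p \<in> V"
  then obtain W m s where W: "openin (opens CP1) W" "p \<in> W" "W \<subseteq> V"
    and s: "\<forall>k<m. \<forall>j<K. s k j \<in> sec (line_sum K a) W"
    and eq: "\<forall>z\<in>dom_off_mark CP1 W. \<tau> z = (\<lambda>J. \<Sum>k<(m::nat). pure_tensor K K (\<lambda>j. s k j z) J)"
    using \<tau> unfolding tensor_power_def fsheaf.simps by blast
  have "regular CP1 mero W (\<lambda>z. \<Prod>j<K. vec_index (s k j z) j)" if "k < m" for k
    by (rule regular_prod[where P = "\<lambda>_. mero" and R = "\<lambda>_. mero"])
      (use s that mem_sec_line_sum[OF W(1)] in \<open>auto intro: meromorphic_on_mult meromorphic_on_const\<close>)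
  then have "regular CP1 mero W (\<lambda>z. \<Sum>k<m. \<Prod>j<K. vec_index (s k j z) j)"
    by (intro regular_sum) (auto intro: meromorphic_on_add meromorphic_on_const)
  moreover have "(\<Sum>k<m. \<Prod>j<K. vec_index (s k j z) j) = \<tau> z [0..<K]" if "z \<in> dom_off_mark CP1 W" for z
    using eq that by (auto simp: pure_tensor_def intro!: sum.cong)
  ultimately have "regular CP1 mero W (\<lambda>z. \<tau> z [0..<K])"
    by (rule CP1.regular_transfer[OF W(1) germ_property_mero])
  with W show "\<exists>W. openin (opens CP1) W \<and> p \<in> W \<and> W \<subseteq> V \<and> regular CP1 mero W (\<lambda>z. \<tau> z [0..<K])"
    by blast
qed

lemma sum_floor_le: "(\<Sum>i\<in>I. \<lfloor>f i\<rfloor>) \<le> \<lfloor>\<Sum>i\<in>I. f i :: real\<rfloor>"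
  by (simp add: le_floor_iff sum_mono)

text \<open>
  The coefficient of \<open>e\<^sub>1 \<otimes> \<dots> \<otimes> e\<^sub>K\<close> in a tensor of order at most \<open>\<alpha>\<close>: the floors of the
  summands of \<open>\<alpha>\<close> add up to at most \<open>\<lfloor>\<alpha>\<rfloor>\<close>, because the weights cancel. This bounds the order of
  the volume form from below.
\<close>

lemma filt_tensor_regular:
  assumes V: "openin (opens CP1) V" and a: "(\<Sum>i<K. a i) = 0"
    and \<tau>: "\<tau> \<in> filt (tensor_power CP1 K K (line_sum K a)) \<alpha> V"
  shows "regular CP1 (pole_le \<lfloor>\<alpha>\<rfloor>) V (\<lambda>z. \<tau> z [0..<K])"
proof (rule CP1.regular_local[OF V])
  fix p assume "p \<in> V"
  then obtain W m s \<beta> where W: "openin (opens CP1) W" "p \<in> W" "W \<subseteq> V"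
    and s: "\<forall>k<m. (\<Sum>j<K. \<beta> k j) = \<alpha> \<and> (\<forall>j<K. s k j \<in> filt (line_sum K a) (\<beta> k j) W)"
    and eq: "\<forall>z\<in>dom_off_mark CP1 W. \<tau> z = (\<lambda>J. \<Sum>k<(m::nat). pure_tensor K K (\<lambda>j. s k j z) J)"
    using \<tau> unfolding tensor_power_def fsheaf.simps by blast
  have "regular CP1 (pole_le \<lfloor>\<alpha>\<rfloor>) W (\<lambda>z. \<Prod>j<K. vec_index (s k j z) j)" if k: "k < m" for k
  proof -
    have "regular CP1 (pole_le (\<Sum>j<K. \<lfloor>\<beta> k j + a j\<rfloor>)) W (\<lambda>z. \<Prod>j<K. vec_index (s k j z) j)"
    proof (rule regular_prod[where P = "\<lambda>j. pole_le \<lfloor>\<beta> k j + a j\<rfloor>"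
          and R = "\<lambda>F. pole_le (\<Sum>j\<in>F. \<lfloor>\<beta> k j + a j\<rfloor>)"])
      show "regular CP1 (pole_le \<lfloor>\<beta> k j + a j\<rfloor>) W (\<lambda>z. vec_index (s k j z) j)" if "j \<in> {..<K}" for j
        using s k that mem_filt_line_sum[OF W(1)] by simp
    qed (auto intro: pole_le_analytic pole_le_mult)
    moreover have "(\<Sum>j<K. \<lfloor>\<beta> k j + a j\<rfloor>) \<le> \<lfloor>\<alpha>\<rfloor>"
      using sum_floor_le[of "\<lambda>j. \<beta> k j + a j" "{..<K}"] s k a by (simp add: sum.distrib)
    ultimately show ?thesis by (simp add: regular_mono[OF _ pole_le_mono])
  qed
  then have "regular CP1 (pole_le \<lfloor>\<alpha>\<rfloor>) W (\<lambda>z. \<Sum>k<m. \<Prod>j<K. vec_index (s k j z) j)"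
    by (intro regular_sum) (auto intro: pole_le_add pole_le_zero)
  moreover have "(\<Sum>k<m. \<Prod>j<K. vec_index (s k j z) j) = \<tau> z [0..<K]" if "z \<in> dom_off_mark CP1 W" for z
    using eq that by (auto simp: pure_tensor_def intro!: sum.cong)
  ultimately have "regular CP1 (pole_le \<lfloor>\<alpha>\<rfloor>) W (\<lambda>z. \<tau> z [0..<K])"
    by (rule CP1.regular_transfer[OF W(1) germ_property_pole_le])
  with W show "\<exists>W. openin (opens CP1) W \<and> p \<in> W \<and> W \<subseteq> V \<and>
      regular CP1 (pole_le \<lfloor>\<alpha>\<rfloor>) W (\<lambda>z. \<tau> z [0..<K])"
    by blast
qed

text \<open>
  In each summand of the volume form the factors \<open>e\<^sub>i\<close> of order \<open>- a i\<close> all occur once, and these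
  orders add up to \<open>0\<close>. The function \<open>f\<close> is there so that the lemma yields all sections of the
  exterior power off \<open>\<infinity>\<close> as well.
\<close>

lemma multiple_of_volume_mem_filt:
  assumes K: "K > 0" and a: "(\<Sum>i<K. a i) = 0" and V: "openin (opens CP1) V"
    and f: "regular CP1 (pole_le 0) V f"
  shows "(\<lambda>z\<in>dom_off_mark CP1 V. \<lambda>J. f z * wedge K K (unit_vec K) J)
    \<in> filt (exterior_power CP1 K K (line_sum K a)) 0 V" (is "?\<tau> \<in> _")
proof -
  let ?Perm = "{\<sigma>. \<sigma> permutes {..<K}}"
  obtain e where e: "bij_betw e {..<card ?Perm} ?Perm"
    using ex_bij_betw_nat_finite[OF finite_permutations[OF finite_lessThan]]
    by (metis atLeast0LessThan)
  let ?m = "card ?Perm"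
  have perm: "e k permutes {..<K}" if "k < ?m" for k
    using bij_betwE[OF e] that by auto
  (* the coefficient f * sign of a summand is absorbed in its first factor *)
  define c where "c k j z = (if j = 0 then f z * of_int (sign (e k)) else 1)" for k j :: nat and z
  define s where "s k j = (\<lambda>z\<in>dom_off_mark CP1 V. c k j z \<cdot>\<^sub>v unit_vec K (e k j))" for k j
  define \<beta> where "\<beta> k j = - a (e k j)" for k j
  have c_reg: "regular CP1 (pole_le 0) V (c k j)" for k j
  proof (cases "j = 0")
    case True
    then have "c k j = (\<lambda>z. f z * of_int (sign (e k)))" by (simp add: c_def fun_eq_iff)
    then show ?thesis
      using regular_mult[OF f regular_const, of "pole_le 0"] pole_le_mult_holomorphic by simp
  next
    case False
    then have "c k j = (\<lambda>_. 1)" by (simp add: c_def fun_eq_iff)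
    then show ?thesis by (simp add: regular_const)
  qed
  have s_filt: "s k j \<in> filt (line_sum K a) (\<beta> k j) V" if "k < ?m" "j < K" for k j
    unfolding mem_filt_line_sum[OF V]
  proof (intro conjI allI impI)
    show "s k j \<in> dom_off_mark CP1 V \<rightarrow>\<^sub>E carrier_vec K" by (auto simp: s_def)
    fix i assume i: "i < K"
    have "regular CP1 (pole_le \<lfloor>\<beta> k j + a i\<rfloor>) V (\<lambda>z. if i = e k j then c k j z else 0)"
    proof (cases "i = e k j")
      case True
      then show ?thesis using c_reg[of k j] by (simp add: \<beta>_def)
    next
      case False
      then show ?thesis by (simp add: regular_zero pole_le_zero)
    qed
    moreover have "(if i = e k j then c k j z else 0) = vec_index (s k j z) i"
      if "z \<in> dom_off_mark CP1 V" for z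
      using that i permutes_in_image[OF perm[OF \<open>k < ?m\<close>], of j] \<open>j < K\<close>
      by (auto simp: s_def unit_vec_def)
    ultimately show "regular CP1 (pole_le \<lfloor>\<beta> k j + a i\<rfloor>) V (\<lambda>z. vec_index (s k j z) i)"
      by (rule CP1.regular_transfer[OF V germ_property_pole_le])
  qed
  have \<beta>_sum: "(\<Sum>j<K. \<beta> k j) = 0" if "k < ?m" for k
    using sum.permute[OF perm[OF that], of a] a by (simp add: \<beta>_def sum_negf o_def)
  have expand: "?\<tau> z = (\<lambda>J. \<Sum>k<?m. pure_tensor K K (\<lambda>j. s k j z) J)"
    if z: "z \<in> dom_off_mark CP1 V" for z
  proof
    fix J
    have "pure_tensor K K (\<lambda>j. s k j z) J =
        f z * (of_int (sign (e k)) * pure_tensor K K (\<lambda>j. unit_vec K (e k j)) J)" for k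
    proof -
      have "pure_tensor K K (\<lambda>j. s k j z) J =
          (\<Prod>j<K. c k j z) * pure_tensor K K (\<lambda>j. unit_vec K (e k j)) J"
        using z by (simp add: s_def pure_tensor_smult)
      moreover have "(\<Prod>j<K. c k j z) = f z * of_int (sign (e k))"
        using K by (simp add: c_def prod.delta)
      ultimately show ?thesis by (simp add: mult.assoc)
    qed
    then have "(\<Sum>k<?m. pure_tensor K K (\<lambda>j. s k j z) J) =
        f z * (\<Sum>k<?m. of_int (sign (e k)) * pure_tensor K K (\<lambda>j. unit_vec K (e k j)) J)"
      by (simp add: sum_distrib_left)
    also have "\<dots> = f z * wedge K K (unit_vec K) J"
      unfolding wedge_def
      by (subst sum.reindex_bij_betw[OF e, symmetric]) (rule refl)
    finally show "?\<tau> z J = (\<Sum>k<?m. pure_tensor K K (\<lambda>j. s k j z) J)" using z by simp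
  qed
  have "?\<tau> \<in> filt (tensor_power CP1 K K (line_sum K a)) 0 V"
    unfolding tensor_power_def fsheaf.simps
  proof (intro CollectI conjI ballI)
    fix p assume "p \<in> V"
    then show "\<exists>V' m s \<beta>. openin (opens CP1) V' \<and> p \<in> V' \<and> V' \<subseteq> V \<and>
         (\<forall>k<m. (\<Sum>j<K. \<beta> k j) = 0 \<and> (\<forall>j<K. s k j \<in> filt (line_sum K a) (\<beta> k j) V')) \<and>
         (\<forall>z\<in>dom_off_mark CP1 V'. ?\<tau> z = (\<lambda>J. \<Sum>k<(m::nat). pure_tensor K K (\<lambda>j. s k j z) J))"
      using V \<beta>_sum s_filt expand
      by (intro exI[of _ V] exI[of _ ?m] exI[of _ s] exI[of _ \<beta>]) simp
  qed simp
  moreover have "alternating K (?\<tau> z)" if "z \<in> dom_off_mark CP1 V" for z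
    using alternating_wedge[of K K "unit_vec K"] that by (simp add: alternating_def)
  ultimately show ?thesis by (simp add: exterior_power_def)
qed

lemma filt_exterior_subset_sec:
  assumes "\<tau> \<in> filt (exterior_power CP1 K n (line_sum K a)) \<alpha> V"
  shows "\<tau> \<in> sec (exterior_power CP1 K n (line_sum K a)) V"
proof -
  have "\<tau> \<in> sec (tensor_power CP1 K n (line_sum K a)) V"
    unfolding tensor_power_def fsheaf.simps
  proof (intro CollectI conjI ballI)
    show "\<tau> \<in> extensional (dom_off_mark CP1 V)"
      using assms by (simp add: exterior_power_def tensor_power_def)
    fix p assume "p \<in> V"
    then obtain W m s \<beta> where W: "openin (opens CP1) W" "p \<in> W" "W \<subseteq> V"
      and s: "\<forall>k<m. (\<Sum>j<n. \<beta> k j) = \<alpha> \<and> (\<forall>j<n. s k j \<in> filt (line_sum K a) (\<beta> k j) W)"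
      and eq: "\<forall>z\<in>dom_off_mark CP1 W. \<tau> z = (\<lambda>J. \<Sum>k<(m::nat). pure_tensor K n (\<lambda>j. s k j z) J)"
      using assms unfolding exterior_power_def tensor_power_def fsheaf.simps by blast
    have "s k j \<in> sec (line_sum K a) W" if "k < m" "j < n" for k j
      using s that by (intro filt_line_sum_imp_sec[OF W(1), where \<beta> = "\<beta> k j"]) simp
    then show "\<exists>W m s. openin (opens CP1) W \<and> p \<in> W \<and> W \<subseteq> V \<and>
         (\<forall>k<m. \<forall>j<n. s k j \<in> sec (line_sum K a) W) \<and>
         (\<forall>z\<in>dom_off_mark CP1 W. \<tau> z = (\<lambda>J. \<Sum>k<(m::nat). pure_tensor K n (\<lambda>j. s k j z) J))"
      using W eq by (intro exI[of _ W] exI[of _ m] exI[of _ s]) simp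
  qed
  then show ?thesis using assms by (simp add: exterior_power_def)
qed

lemma Inf_ereal_eq_zero:
  assumes "0 \<in> A" and "\<And>\<alpha>. \<alpha> \<in> A \<Longrightarrow> 0 \<le> \<alpha>"
  shows "Inf (ereal ` A) = 0"
proof (rule antisym)
  show "Inf (ereal ` A) \<le> 0"
    using assms(1) by (intro Inf_lower) (auto simp: zero_ereal_def)
  show "0 \<le> Inf (ereal ` A)"
    by (rule Inf_greatest) (use assms(2) in auto)
qed

text \<open>
  If the volume form had negative order, its coefficient \<open>1\<close> would vanish at \<open>\<infinity>\<close>.
\<close>

theorem sl_bundle_line_sum:
  assumes K: "K > 0" and a: "(\<Sum>i<K. a i) = 0"
  shows "sl_bundle K (line_sum K a) (\<lambda>z. wedge K K (unit_vec K))" (is "sl_bundle K ?E ?\<omega>")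
  unfolding sl_bundle_def
proof (intro conjI allI impI filtered_bundle_line_sum)
  have top: "dom_off_mark CP1 (topspace (opens CP1)) = UNIV" by (auto simp: dom_off_mark_CP1)
  have \<omega>: "restrict ?\<omega> (dom_off_mark CP1 V) \<in> filt (exterior_power CP1 K K ?E) 0 V"
    if "openin (opens CP1) V" for V
    using multiple_of_volume_mem_filt[OF K a that regular_const[where c = 1]] by (simp add: eta_contract_eq)
  show "?\<omega> \<in> sec (exterior_power CP1 K K ?E) (topspace (opens CP1))"
    using filt_exterior_subset_sec[OF \<omega>[OF openin_topspace]] unfolding top restrict_UNIV .
  show "bij_betw (\<lambda>f. \<lambda>z\<in>dom_off_mark CP1 V. (\<lambda>J. f z * ?\<omega> z J))
          (O_hol CP1 V) (sec (exterior_power CP1 K K ?E) V)"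
    if "openin (opens CP1) V \<and> mark CP1 \<notin> V" for V
  proof (rule bij_betwI[where g = "\<lambda>\<tau>. \<lambda>z\<in>dom_off_mark CP1 V. \<tau> z [0..<K]"])
    have V: "openin (opens CP1) V" and "mark CP1 \<notin> V" using that by auto
    show "(\<lambda>f. \<lambda>z\<in>dom_off_mark CP1 V. (\<lambda>J. f z * ?\<omega> z J)) \<in> O_hol CP1 V \<rightarrow> sec (exterior_power CP1 K K ?E) V"
      by (auto simp: O_pole_eq O_germ_def
          intro: filt_exterior_subset_sec[OF multiple_of_volume_mem_filt[OF K a V]])
    show "(\<lambda>\<tau>. \<lambda>z\<in>dom_off_mark CP1 V. \<tau> z [0..<K]) \<in> sec (exterior_power CP1 K K ?E) V \<rightarrow> O_hol CP1 V"
    proof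
      fix \<tau> assume "\<tau> \<in> sec (exterior_power CP1 K K ?E) V"
      then have "regular CP1 mero V (\<lambda>z. \<tau> z [0..<K])"
        by (intro sec_tensor_regular[OF V, where a = a]) (simp add: exterior_power_def)
      then have "regular CP1 (pole_le 0) V (\<lambda>z. \<tau> z [0..<K])"
        using \<open>mark CP1 \<notin> V\<close> by (simp add: regular_def)
      then show "(\<lambda>z\<in>dom_off_mark CP1 V. \<tau> z [0..<K]) \<in> O_hol CP1 V"
        by (simp add: O_pole_eq CP1.restrict_mem_O_germ[OF V germ_property_pole_le])
    qed
    show "(\<lambda>z\<in>dom_off_mark CP1 V. (\<lambda>z\<in>dom_off_mark CP1 V. (\<lambda>J. f z * ?\<omega> z J)) z [0..<K]) = f"
      if "f \<in> O_hol CP1 V" for f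
    proof (rule extensionalityI[of _ "dom_off_mark CP1 V"])
      show "f \<in> extensional (dom_off_mark CP1 V)" using that by (simp add: O_pole_eq O_germ_def)
    qed (auto simp: wedge_unit_upt)
    show "(\<lambda>z\<in>dom_off_mark CP1 V. (\<lambda>J. (\<lambda>z\<in>dom_off_mark CP1 V. \<tau> z [0..<K]) z * ?\<omega> z J)) = \<tau>"
      if "\<tau> \<in> sec (exterior_power CP1 K K ?E) V" for \<tau>
    proof (rule extensionalityI[of _ "dom_off_mark CP1 V"])
      show "\<tau> \<in> extensional (dom_off_mark CP1 V)"
        using that by (simp add: exterior_power_def tensor_power_def)
      fix z assume z: "z \<in> dom_off_mark CP1 V"
      have eq: "\<tau> z J = \<tau> z [0..<K] * ?\<omega> z J" for J
      proof (rule alternating_eq_wedge)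
        have "\<tau> \<in> sec (tensor_power CP1 K K ?E) V" using that by (simp add: exterior_power_def)
        then show "\<tau> z J = 0" if "\<not> (length J = K \<and> set J \<subseteq> {..<K})" for J
          using z that by (rule sec_tensor_support)
      qed (use that z in \<open>simp add: exterior_power_def\<close>)
      show "(\<lambda>z\<in>dom_off_mark CP1 V. (\<lambda>J. (\<lambda>z\<in>dom_off_mark CP1 V. \<tau> z [0..<K]) z * ?\<omega> z J)) z = \<tau> z"
      proof
        fix J
        show "(\<lambda>z\<in>dom_off_mark CP1 V. (\<lambda>J. (\<lambda>z\<in>dom_off_mark CP1 V. \<tau> z [0..<K]) z * ?\<omega> z J)) z J = \<tau> z J"
          using eq[of J] z by simp
      qed
    qed simp
  qed
  let ?A = "{\<alpha>. \<exists>V. openin (opens CP1) V \<and> mark CP1 \<in> V \<and>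
     restrict ?\<omega> (dom_off_mark CP1 V) \<in> filt (exterior_power CP1 K K ?E) \<alpha> V}"
  have "0 \<in> ?A"
  proof (rule CollectI, rule exI, rule conjI[OF _ conjI])
    show "openin (opens CP1) (topspace (opens CP1))" by (rule openin_topspace)
    show "mark CP1 \<in> topspace (opens CP1)" by (rule CP1.mark_in)
    show "restrict ?\<omega> (dom_off_mark CP1 (topspace (opens CP1)))
        \<in> filt (exterior_power CP1 K K ?E) 0 (topspace (opens CP1))"
      by (rule \<omega>[OF openin_topspace])
  qed
  moreover have "0 \<le> \<alpha>" if "\<alpha> \<in> ?A" for \<alpha>
  proof (rule ccontr)
    assume "\<not> 0 \<le> \<alpha>"
    from \<open>\<alpha> \<in> ?A\<close>[THEN CollectD]
    obtain V where V: "openin (opens CP1) V" "mark CP1 \<in> V"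
      and "restrict ?\<omega> (dom_off_mark CP1 V) \<in> filt (exterior_power CP1 K K ?E) \<alpha> V"
      by (elim exE conjE) (rule that)
    then have \<tau>: "restrict ?\<omega> (dom_off_mark CP1 V) \<in> filt (tensor_power CP1 K K ?E) \<alpha> V"
      by (simp add: exterior_power_def)
    have "regular CP1 (pole_le \<lfloor>\<alpha>\<rfloor>) V (\<lambda>z. restrict ?\<omega> (dom_off_mark CP1 V) z [0..<K])"
      by (rule filt_tensor_regular[OF V(1) a \<tau>])
    then have "regular CP1 (pole_le \<lfloor>\<alpha>\<rfloor>) V (\<lambda>_. 1)"
      by (rule CP1.regular_transfer[OF V(1) germ_property_pole_le]) (simp add: wedge_unit_upt)
    then have "pole_le \<lfloor>\<alpha>\<rfloor> (\<lambda>_. 1)" using V(2) by (simp add: regular_def)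
    then show False using not_pole_le_one[of "\<lfloor>\<alpha>\<rfloor>"] \<open>\<not> 0 \<le> \<alpha>\<close> by simp
  qed
  ultimately show "order_at_mark CP1 (exterior_power CP1 K K ?E) ?\<omega> = 0"
    unfolding order_at_mark_def by (rule Inf_ereal_eq_zero)
qed

section \<open>Pullback to the ramified disc\<close>

lemma regular_scale:
  assumes "regular S P U f" and "\<And>h. P h \<Longrightarrow> P (\<lambda>x. c * h x)"
  shows "regular S P U (\<lambda>z. c * f z)"
  using assms by (auto simp: regular_def intro!: holomorphic_intros)

lemma pole_le_scale: "pole_le n h \<Longrightarrow> pole_le n (\<lambda>x. c * h x)"
  by (rule pole_le_mult_holomorphic) (auto intro: pole_le_analytic)

lemma mero_scale: "mero h \<Longrightarrow> mero (\<lambda>x. c * h x)"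
  by (intro meromorphic_on_mult meromorphic_on_const)

lemma cover_eq: "cover K u = inverse (u ^ (2 * K))"
  using power_int_minus[of u "2 * int K"] power_int_of_nat[of u "2 * K"] by (simp add: cover_def)

text \<open>
  In the local coordinates \<open>x = 1/z\<close> and \<open>u\<close> the covering is the holomorphic map \<open>x = u\<^sup>2\<^sup>K\<close>, so
  germs at \<open>\<infinity>\<close> pull back to germs at \<open>0\<close>.
\<close>

lemma regular_pullback_cover:
  assumes K: "K > 0" and W: "cover_point K ` W \<subseteq> V" and \<sigma>: "regular CP1 P V \<sigma>"
    and P: "\<And>h. P h \<Longrightarrow> Q (\<lambda>u. h (u ^ (2 * K)))"
  shows "regular (disc r) Q W (\<lambda>u. \<sigma> (cover K u))"
  unfolding regular_def
proof (intro conjI impI)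
  have "(\<sigma> \<circ> cover K) holomorphic_on dom_off_mark (disc r) W"
  proof (rule holomorphic_on_compose_gen[where t = "dom_off_mark CP1 V"])
    show "cover K holomorphic_on dom_off_mark (disc r) W"
      unfolding cover_eq[abs_def] by (intro holomorphic_intros) (auto simp: dom_off_mark_disc)
    show "\<sigma> holomorphic_on dom_off_mark CP1 V" using \<sigma> by (simp add: regular_def)
    show "cover K ` dom_off_mark (disc r) W \<subseteq> dom_off_mark CP1 V"
    proof clarify
      fix u assume "u \<in> dom_off_mark (disc r) W"
      then have "cover_point K u \<in> V" "u \<noteq> 0" using W by (auto simp: dom_off_mark_disc)
      then show "cover K u \<in> dom_off_mark CP1 V"
        by (simp add: cover_point_def dom_off_mark_CP1)
    qed
  qed
  then show "(\<lambda>u. \<sigma> (cover K u)) holomorphic_on dom_off_mark (disc r) W" by (simp add: o_def)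
  assume "mark (disc r) \<in> W"
  then have "cover_point K 0 \<in> V" using W by auto
  then have "P (\<lambda>x. \<sigma> (inverse x))" using \<sigma> by (simp add: cover_point_def regular_def)
  then show "Q (\<lambda>x. \<sigma> (cover K (loc (disc r) x)))" using P by (simp add: cover_eq)
qed

lemma mero_root_pullback: "mero h \<Longrightarrow> k > 0 \<Longrightarrow> mero (\<lambda>u. h (u ^ k))"
  by (rule meromorphic_on_compose[where A = "{0}"]) (auto intro: analytic_intros simp: zero_power)

lemma unit_section_mem_filt:
  assumes "openin (opens CP1) V"
  shows "(\<lambda>z\<in>dom_off_mark CP1 V. unit_vec K k) \<in> filt (line_sum K a) (- a k) V"
  unfolding mem_filt_line_sum[OF assms]
proof (intro conjI allI impI)
  fix i assume "i < K"
  have "regular CP1 (pole_le \<lfloor>- a k + a i\<rfloor>) V (\<lambda>_. if i = k then 1 else 0)"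
    using regular_const[of CP1 V 1] by (simp add: regular_zero pole_le_zero)
  then show "regular CP1 (pole_le \<lfloor>- a k + a i\<rfloor>) V
      (\<lambda>z. vec_index ((\<lambda>z\<in>dom_off_mark CP1 V. unit_vec K k) z) i)"
    by (rule CP1.regular_transfer[OF assms germ_property_pole_le])
      (use \<open>i < K\<close> in \<open>simp add: unit_vec_def\<close>)
qed simp

lemma sum_times_unit_vec:
  "i < K \<Longrightarrow> (\<Sum>k<K. f k * vec_index (unit_vec K k) i) = (f i :: complex)"
  by (simp add: unit_vec_def if_distrib sum.delta cong: if_cong)

lemma unit_section_expansion:
  fixes s :: "complex \<Rightarrow> complex vec"
  assumes "s \<in> dom_off_mark (disc r) W \<rightarrow>\<^sub>E carrier_vec K" and u: "u \<in> dom_off_mark (disc r) W"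
  shows "s u = Matrix.vec K (\<lambda>i. \<Sum>k<K. (\<lambda>u\<in>dom_off_mark (disc r) W. vec_index (s u) k) u *
    vec_index ((\<lambda>z\<in>dom_off_mark CP1 (topspace (opens CP1)). unit_vec K k) (cover K u)) i)"
proof -
  have su: "s u \<in> carrier_vec K" using assms by auto
  have "s u = Matrix.vec K (\<lambda>i. \<Sum>k<K. vec_index (s u) k * vec_index (unit_vec K k) i)" (is "_ = ?v")
  proof (rule eq_vecI)
    show "vec_index (s u) i = vec_index ?v i" if "i < dim_vec ?v" for i
      using that sum_times_unit_vec[of i K "vec_index (s u)"] by (simp del: index_unit_vec)
  qed (use su in simp)
  then show ?thesis using u by (simp add: dom_off_mark_CP1)
qed

text \<open>
  A combination of pulled back sections is meromorphic in each coordinate. Conversely the global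
  sections \<open>e\<^sub>k\<close> alone already span.
\<close>

lemma mem_sec_cover_pullback:
  assumes r: "r > 0" and K: "K > 0" and W: "openin (opens (disc r)) W"
  shows "s \<in> sec (cover_pullback r K (line_sum K a)) W \<longleftrightarrow>
    s \<in> dom_off_mark (disc r) W \<rightarrow>\<^sub>E carrier_vec K \<and>
    (\<forall>i<K. regular (disc r) mero W (\<lambda>u. vec_index (s u) i))"
    (is "_ \<longleftrightarrow> ?val \<and> ?reg")
proof -
  interpret D: surface "disc r" by (rule disc_surface[OF r])
  show ?thesis
  proof
    assume s: "s \<in> sec (cover_pullback r K (line_sum K a)) W"
    have ?reg
    proof (intro allI impI)
      fix i assume i: "i < K"
      show "regular (disc r) mero W (\<lambda>u. vec_index (s u) i)"
      proof (rule D.regular_local[OF W])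
        fix p assume "p \<in> W"
        then obtain W' V m h \<sigma> where W': "openin (opens (disc r)) W'" "p \<in> W'" "W' \<subseteq> W"
          and V: "openin (opens CP1) V" "cover_point K ` W' \<subseteq> V"
          and h\<sigma>: "\<forall>k<m. h k \<in> O_mer (disc r) W' \<and> \<sigma> k \<in> sec (line_sum K a) V"
          and eq: "\<forall>u\<in>dom_off_mark (disc r) W'.
            s u = Matrix.vec K (\<lambda>i. \<Sum>k<(m::nat). h k u * vec_index (\<sigma> k (cover K u)) i)"
          using s unfolding cover_pullback_def fsheaf.simps by blast
        have "regular (disc r) mero W' (\<lambda>u. h k u * vec_index (\<sigma> k (cover K u)) i)" if k: "k < m" for k
        proof (rule regular_mult[where P = mero and Q = mero])
          show "regular (disc r) mero W' (h k)" using h\<sigma> k by (simp add: O_mer_eq O_germ_def)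
          have "regular CP1 mero V (\<lambda>z. vec_index (\<sigma> k z) i)"
            using h\<sigma> k i mem_sec_line_sum[OF V(1)] by blast
          then show "regular (disc r) mero W' (\<lambda>u. vec_index (\<sigma> k (cover K u)) i)"
            by (rule regular_pullback_cover[OF K V(2)]) (use K mero_root_pullback in simp)
        qed (rule meromorphic_on_mult)
        then have "regular (disc r) mero W' (\<lambda>u. \<Sum>k<m. h k u * vec_index (\<sigma> k (cover K u)) i)"
          by (intro regular_sum) (auto intro: meromorphic_on_add meromorphic_on_const)
        then have "regular (disc r) mero W' (\<lambda>u. vec_index (s u) i)"
          by (rule D.regular_transfer[OF W'(1) germ_property_mero]) (use eq i in simp)
        with W' show "\<exists>V. openin (opens (disc r)) V \<and> p \<in> V \<and> V \<subseteq> W \<and>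
            regular (disc r) mero V (\<lambda>u. vec_index (s u) i)" by blast
      qed
    qed
    moreover have ?val using s by (simp add: cover_pullback_def)
    ultimately show "?val \<and> ?reg" by blast
  next
    assume s: "?val \<and> ?reg"
    define h where "h k = (\<lambda>u\<in>dom_off_mark (disc r) W. vec_index (s u) k)" for k
    define \<sigma> :: "nat \<Rightarrow> complex \<Rightarrow> complex vec" where "\<sigma> k = (\<lambda>z\<in>dom_off_mark CP1 (topspace (opens CP1)). unit_vec K k)" for k
    have h: "h k \<in> O_mer (disc r) W" if "k < K" for k
      using s that by (simp add: h_def O_mer_eq D.restrict_mem_O_germ[OF W germ_property_mero])
    have \<sigma>: "\<sigma> k \<in> sec (line_sum K a) (topspace (opens CP1))" for k
      unfolding \<sigma>_def
      by (rule filt_line_sum_imp_sec[OF openin_topspace unit_section_mem_filt[OF openin_topspace]])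
    have eq: "s u = Matrix.vec K (\<lambda>i. \<Sum>k<K. h k u * vec_index (\<sigma> k (cover K u)) i)"
      if u: "u \<in> dom_off_mark (disc r) W" for u
      unfolding h_def \<sigma>_def using s u by (intro unit_section_expansion) simp_all
    have V: "cover_point K ` W \<subseteq> topspace (opens CP1)" by (auto simp: cover_point_def)
    show "s \<in> sec (cover_pullback r K (line_sum K a)) W"
      unfolding cover_pullback_def fsheaf.simps
    proof (intro CollectI conjI ballI)
      fix p assume "p \<in> W"
      show "\<exists>W' V m h \<sigma>. openin (opens (disc r)) W' \<and> p \<in> W' \<and> W' \<subseteq> W \<and>
         openin (opens CP1) V \<and> cover_point K ` W' \<subseteq> V \<and>
         (\<forall>k<m. h k \<in> O_mer (disc r) W' \<and> \<sigma> k \<in> sec (line_sum K a) V) \<and>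
         (\<forall>u\<in>dom_off_mark (disc r) W'.
            s u = Matrix.vec K (\<lambda>i. \<Sum>k<(m::nat). h k u * vec_index (\<sigma> k (cover K u)) i))"
        by (rule exI[of _ W], rule exI[of _ "topspace (opens CP1)"], rule exI[of _ K],
            rule exI[of _ h], rule exI[of _ \<sigma>])
          (use W V h \<sigma> eq \<open>p \<in> W\<close> openin_topspace[of "opens CP1"] in blast)
    qed (use s in blast)
  qed
qed

text \<open>
  Pulled back, \<open>e\<^sub>i\<close> has the integral order \<open>- m i\<close>, so the filtration of the pullback consists of
  honest pole order conditions. Rounding causes no loss in either direction: \<open>2K \<lfloor>c + a i\<rfloor>\<close> is at
  most \<open>2K c + m i\<close>, and the sections \<open>e\<^sub>k\<close> attain equality.
\<close>

lemma mem_filt_cover_pullback: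
  assumes r: "r > 0" and K: "K > 0" and W: "openin (opens (disc r)) W"
    and m: "\<And>i. i < K \<Longrightarrow> 2 * real K * a i = of_int (m i)"
  shows "s \<in> filt (cover_pullback r K (line_sum K a)) \<beta> W \<longleftrightarrow>
    s \<in> dom_off_mark (disc r) W \<rightarrow>\<^sub>E carrier_vec K \<and>
    (\<forall>i<K. regular (disc r) (pole_le (\<lfloor>\<beta>\<rfloor> + m i)) W (\<lambda>u. vec_index (s u) i))"
    (is "_ \<longleftrightarrow> ?val \<and> ?reg")
proof -
  interpret D: surface "disc r" by (rule disc_surface[OF r])
  show ?thesis
  proof
    assume s: "s \<in> filt (cover_pullback r K (line_sum K a)) \<beta> W"
    have ?reg
    proof (intro allI impI)
      fix i assume i: "i < K"
      let ?P = "pole_le (\<lfloor>\<beta>\<rfloor> + m i)"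
      show "regular (disc r) ?P W (\<lambda>u. vec_index (s u) i)"
      proof (rule D.regular_local[OF W])
        fix p assume "p \<in> W"
        then obtain W' V M h \<sigma> n c where W': "openin (opens (disc r)) W'" "p \<in> W'" "W' \<subseteq> W"
          and V: "openin (opens CP1) V" "cover_point K ` W' \<subseteq> V"
          and h\<sigma>: "\<forall>k<M. h k \<in> O_pole (disc r) (n k) W' \<and> \<sigma> k \<in> filt (line_sum K a) (c k) V \<and>
            real_of_int (n k) + 2 * real K * c k \<le> \<beta>"
          and eq: "\<forall>u\<in>dom_off_mark (disc r) W'.
            s u = Matrix.vec K (\<lambda>i. \<Sum>k<(M::nat). h k u * vec_index (\<sigma> k (cover K u)) i)"
          using s unfolding cover_pullback_def fsheaf.simps by blast
        have "regular (disc r) ?P W' (\<lambda>u. h k u * vec_index (\<sigma> k (cover K u)) i)" if k: "k < M" for k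
        proof -
          let ?l = "\<lfloor>c k + a i\<rfloor>"
          have "regular (disc r) (pole_le (n k + int (2 * K) * ?l)) W'
              (\<lambda>u. h k u * vec_index (\<sigma> k (cover K u)) i)"
          proof (rule regular_mult[where P = "pole_le (n k)" and Q = "pole_le (int (2 * K) * ?l)"])
            show "regular (disc r) (pole_le (n k)) W' (h k)"
              using h\<sigma> k by (simp add: O_pole_eq O_germ_def)
            have "regular CP1 (pole_le ?l) V (\<lambda>z. vec_index (\<sigma> k z) i)"
              using h\<sigma> k i mem_filt_line_sum[OF V(1)] by blast
            then show "regular (disc r) (pole_le (int (2 * K) * ?l)) W' (\<lambda>u. vec_index (\<sigma> k (cover K u)) i)"
            proof (rule regular_pullback_cover[OF K V(2)])
              fix g assume "pole_le ?l g"
              then show "pole_le (int (2 * K) * ?l) (\<lambda>u. g (u ^ (2 * K)))"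
                using pole_le_compose_root[of ?l g 1 "2 * K"] K by simp
            qed
          qed (rule pole_le_mult)
          moreover have "n k + int (2 * K) * ?l \<le> \<lfloor>\<beta>\<rfloor> + m i"
          proof -
            have "real_of_int (int (2 * K) * ?l) \<le> 2 * real K * (c k + a i)"
              using mult_left_mono[of "of_int ?l" "c k + a i" "2 * real K"] by simp
            also have "\<dots> = 2 * real K * c k + of_int (m i)"
              using m[OF i] by (simp add: distrib_left)
            finally have "real_of_int (n k + int (2 * K) * ?l - m i) \<le> \<beta>"
              using h\<sigma> k by fastforce
            then have "n k + int (2 * K) * ?l - m i \<le> \<lfloor>\<beta>\<rfloor>" by (simp only: le_floor_iff)
            then show ?thesis by linarith
          qed
          ultimately show ?thesis using pole_le_mono by (auto simp: regular_def)
        qed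
        then have "regular (disc r) ?P W' (\<lambda>u. \<Sum>k<M. h k u * vec_index (\<sigma> k (cover K u)) i)"
          by (intro regular_sum) (auto intro: pole_le_add pole_le_zero)
        then have "regular (disc r) ?P W' (\<lambda>u. vec_index (s u) i)"
          by (rule D.regular_transfer[OF W'(1) germ_property_pole_le]) (use eq i in simp)
        with W' show "\<exists>V. openin (opens (disc r)) V \<and> p \<in> V \<and> V \<subseteq> W \<and>
            regular (disc r) ?P V (\<lambda>u. vec_index (s u) i)" by blast
      qed
    qed
    moreover have ?val using s by (simp add: cover_pullback_def)
    ultimately show "?val \<and> ?reg" by blast
  next
    assume s: "?val \<and> ?reg"
    define h where "h k = (\<lambda>u\<in>dom_off_mark (disc r) W. vec_index (s u) k)" for k
    define \<sigma> :: "nat \<Rightarrow> complex \<Rightarrow> complex vec" where "\<sigma> k = (\<lambda>z\<in>dom_off_mark CP1 (topspace (opens CP1)). unit_vec K k)" for k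
    define n where "n k = \<lfloor>\<beta>\<rfloor> + m k" for k
    define c where "c k = - a k" for k
    have h: "h k \<in> O_pole (disc r) (n k) W" if "k < K" for k
      using s that by (simp add: h_def n_def O_pole_eq D.restrict_mem_O_germ[OF W germ_property_pole_le])
    have \<sigma>: "\<sigma> k \<in> filt (line_sum K a) (c k) (topspace (opens CP1))" for k
      unfolding \<sigma>_def c_def by (rule unit_section_mem_filt[OF openin_topspace])
    have le: "real_of_int (n k) + 2 * real K * c k \<le> \<beta>" if "k < K" for k
      using m[OF that] by (simp add: n_def c_def)
    have eq: "s u = Matrix.vec K (\<lambda>i. \<Sum>k<K. h k u * vec_index (\<sigma> k (cover K u)) i)"
      if u: "u \<in> dom_off_mark (disc r) W" for u
      unfolding h_def \<sigma>_def using s u by (intro unit_section_expansion) simp_all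
    have V: "cover_point K ` W \<subseteq> topspace (opens CP1)" by (auto simp: cover_point_def)
    show "s \<in> filt (cover_pullback r K (line_sum K a)) \<beta> W"
      unfolding cover_pullback_def fsheaf.simps
    proof (intro CollectI conjI ballI)
      fix p assume "p \<in> W"
      show "\<exists>W' V m h \<sigma> n a'. openin (opens (disc r)) W' \<and> p \<in> W' \<and> W' \<subseteq> W \<and>
         openin (opens CP1) V \<and> cover_point K ` W' \<subseteq> V \<and>
         (\<forall>k<m. h k \<in> O_pole (disc r) (n k) W' \<and> \<sigma> k \<in> filt (line_sum K a) (a' k) V \<and>
            real_of_int (n k) + 2 * real K * a' k \<le> \<beta>) \<and>
         (\<forall>u\<in>dom_off_mark (disc r) W'.
            s u = Matrix.vec K (\<lambda>i. \<Sum>k<(m::nat). h k u * vec_index (\<sigma> k (cover K u)) i))"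
        by (rule exI[of _ W], rule exI[of _ "topspace (opens CP1)"], rule exI[of _ K],
            rule exI[of _ h], rule exI[of _ \<sigma>], rule exI[of _ n], rule exI[of _ c])
          (use W V h \<sigma> le eq \<open>p \<in> W\<close> openin_topspace[of "opens CP1"] in blast)
    qed (use s in blast)
  qed
qed

section \<open>Roots of unity\<close>

definition zeta :: "nat \<Rightarrow> nat \<Rightarrow> complex" where
  "zeta K l = exp (2 * of_real pi * \<i> * of_nat l / of_nat K)"

lemma zeta_nonzero [simp]: "zeta K l \<noteq> 0"
  by (simp add: zeta_def)

lemma zeta_power: "zeta K l ^ i = zeta K (l * i)"
  by (simp add: zeta_def exp_of_nat_mult[symmetric] field_simps)

lemma zeta_eq_iff: "K > 0 \<Longrightarrow> zeta K i = zeta K j \<longleftrightarrow> i mod K = j mod K"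
  unfolding zeta_def by (rule complex_root_unity_eq) simp

lemma zeta_power_order: "K > 0 \<Longrightarrow> zeta K l ^ K = 1"
  using zeta_eq_iff[of K "l * K" 0] by (simp add: zeta_power) (simp add: zeta_def)

lemma sum_powers_root_of_unity:
  fixes w :: complex
  assumes "w ^ K = 1"
  shows "(\<Sum>i<K. w ^ i) = (if w = 1 then of_nat K else 0)"
proof (cases "w = 1")
  case False
  then show ?thesis using geometric_sum[OF False, of K] assms by simp
qed simp

text \<open>
  This relation and the next are the orthogonality of the rows and of the columns of the discrete
  Fourier transform; eigenlines are numbered from \<open>1\<close> to \<open>K\<close>, coordinates from \<open>0\<close> to \<open>K - 1\<close>.
\<close>

lemma sum_zeta_index:
  assumes "K > 0" and "l \<in> {1..K}" and "l' \<in> {1..K}"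
  shows "(\<Sum>i<K. zeta K l' ^ i / zeta K l ^ i) = (if l = l' then of_nat K else 0)"
proof -
  have "(zeta K l' / zeta K l) ^ K = 1"
    using assms(1) by (simp add: power_divide zeta_power_order)
  moreover have "zeta K l' / zeta K l = 1 \<longleftrightarrow> l = l'"
  proof -
    have "l mod K = l' mod K \<longleftrightarrow> l = l'"
      using assms by (cases "l = K"; cases "l' = K") auto
    then show ?thesis using zeta_eq_iff[OF assms(1), of l' l] by (auto simp: divide_eq_1_iff)
  qed
  ultimately show ?thesis
    using sum_powers_root_of_unity[of "zeta K l' / zeta K l" K] by (simp add: power_divide)
qed

lemma sum_zeta_exponent:
  assumes "K > 0" and "i < K" and "i' < K"
  shows "(\<Sum>l\<in>{1..K}. zeta K l ^ i / zeta K l ^ i') = (if i = i' then of_nat K else 0)"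
proof -
  define w where "w = zeta K i / zeta K i'"
  have w: "zeta K l ^ i / zeta K l ^ i' = w ^ l" for l
    by (simp add: w_def zeta_power power_divide mult.commute)
  have "w ^ K = 1" using assms(1) by (simp add: w_def power_divide zeta_power_order)
  have "w = 1 \<longleftrightarrow> i = i'"
    using zeta_eq_iff[OF assms(1), of i i'] assms by (auto simp: w_def divide_eq_1_iff)
  have "(\<Sum>l\<in>{1..K}. w ^ l) = (\<Sum>l<K. w * w ^ l)"
    by (simp add: sum.atLeast1_atMost_eq)
  also have "\<dots> = w * (\<Sum>l<K. w ^ l)" by (simp add: sum_distrib_left)
  also have "\<dots> = (if i = i' then of_nat K else 0)"
    using sum_powers_root_of_unity[OF \<open>w ^ K = 1\<close>] \<open>w = 1 \<longleftrightarrow> i = i'\<close> by auto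
  finally show ?thesis by (simp add: w)
qed

section \<open>Cyclic Higgs fields\<close>

text \<open>
  Diagonal gauge transformations, rotations of the basis and the cyclic fields themselves have this
  shape, so that all matrix identities below reduce to composing index maps.
\<close>

definition monomial_mat :: "nat \<Rightarrow> (nat \<Rightarrow> nat) \<Rightarrow> (nat \<Rightarrow> complex) \<Rightarrow> complex mat" where
  "monomial_mat K p c = Matrix.mat K K (\<lambda>(i, j). if j = p i then c i else 0)"

lemma monomial_mat_carrier [simp]: "monomial_mat K p c \<in> carrier_mat K K"
  by (simp add: monomial_mat_def)

lemma monomial_mat_dim [simp]:
  "dim_row (monomial_mat K p c) = K" "dim_col (monomial_mat K p c) = K"
  by (simp_all add: monomial_mat_def)

lemma monomial_mat_cong:
  assumes "\<And>i. i < K \<Longrightarrow> p i = q i" and "\<And>i. i < K \<Longrightarrow> c i = e i"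
  shows "monomial_mat K p c = monomial_mat K q e"
  by (rule eq_matI) (auto simp: monomial_mat_def assms)

lemma monomial_mat_mult_vec:
  assumes "i < K" and "p i < K" and "v \<in> carrier_vec K"
  shows "vec_index (monomial_mat K p c *\<^sub>v v) i = c i * vec_index v (p i)"
proof -
  have "vec_index (monomial_mat K p c *\<^sub>v v) i = (\<Sum>j<K. (if j = p i then c i else 0) * vec_index v j)"
    using assms unfolding monomial_mat_def by (simp add: scalar_prod_def lessThan_atLeast0)
  also have "\<dots> = (\<Sum>j<K. if j = p i then c i * vec_index v j else 0)"
    by (intro sum.cong) auto
  finally show ?thesis using assms(2) by simp
qed

lemma monomial_mat_mult:
  assumes p: "\<And>i. i < K \<Longrightarrow> p i < K"
  shows "monomial_mat K p c * monomial_mat K q e = monomial_mat K (\<lambda>i. q (p i)) (\<lambda>i. c i * e (p i))"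
proof (rule eq_matI)
  fix i j
  assume "i < dim_row (monomial_mat K (\<lambda>i. q (p i)) (\<lambda>i. c i * e (p i)))"
    and "j < dim_col (monomial_mat K (\<lambda>i. q (p i)) (\<lambda>i. c i * e (p i)))"
  then have ij: "i < K" "j < K" by simp_all
  have "(monomial_mat K p c * monomial_mat K q e) $$ (i, j) =
      (\<Sum>k<K. (if k = p i then c i else 0) * (if j = q k then e k else 0))"
    using ij unfolding monomial_mat_def by (simp add: scalar_prod_def lessThan_atLeast0)
  also have "\<dots> = (\<Sum>k<K. if k = p i then c i * (if j = q k then e k else 0) else 0)"
    by (intro sum.cong) auto
  also have "\<dots> = c i * (if j = q (p i) then e (p i) else 0)" using p[OF ij(1)] by simp
  finally show "(monomial_mat K p c * monomial_mat K q e) $$ (i, j) =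
      monomial_mat K (\<lambda>i. q (p i)) (\<lambda>i. c i * e (p i)) $$ (i, j)"
    using ij by (simp add: monomial_mat_def)
qed simp_all

lemma monomial_mat_one: "monomial_mat K (\<lambda>i. i) (\<lambda>_. 1) = 1\<^sub>m K"
  by (rule eq_matI) (auto simp: monomial_mat_def)

text \<open>
  The conjugate of the field of the partition by the constant matrix \<open>diag(d)\<close>. Working with all
  \<open>d\<close> at once covers the translates of the field under the multiplicative group.
\<close>

definition twisted_field :: "nat \<Rightarrow> nat list \<Rightarrow> (nat \<Rightarrow> complex) \<Rightarrow> complex \<Rightarrow> complex mat" where
  "twisted_field K b d z =
     monomial_mat K (\<lambda>i. Suc i mod K) (\<lambda>i. d i / d (Suc i mod K) * z ^ (b ! i))"

lemma twisted_field_mult_vec: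
  assumes "i < K" and "v \<in> carrier_vec K"
  shows "vec_index (twisted_field K b d z *\<^sub>v v) i =
    d i / d (Suc i mod K) * z ^ (b ! i) * vec_index v (Suc i mod K)"
  unfolding twisted_field_def by (rule monomial_mat_mult_vec) (use assms in simp_all)

lemma higgs_field_twisted_field:
  assumes "K \<ge> 2"
  shows "higgs_field K (line_sum K a) (twisted_field K b d)"
  unfolding higgs_field_def
proof (intro conjI allI impI)
  show "twisted_field K b d z \<in> carrier_mat K K" for z by (simp add: twisted_field_def)
  have "i \<noteq> Suc i mod K" if "i < K" for i
    using that assms by (cases "Suc i = K") auto
  then show "(\<Sum>i<K. twisted_field K b d z $$ (i, i)) = 0" for z
    by (simp add: twisted_field_def monomial_mat_def)
  fix U assume U: "openin (opens CP1) U"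
  show "apply_fibrewise CP1 (twisted_field K b d) U ` sec (line_sum K a) U \<subseteq> sec (line_sum K a) U"
  proof (clarify)
    fix s assume s: "s \<in> sec (line_sum K a) U"
    show "apply_fibrewise CP1 (twisted_field K b d) U s \<in> sec (line_sum K a) U"
      unfolding mem_sec_line_sum[OF U]
    proof (intro conjI allI impI)
      show "apply_fibrewise CP1 (twisted_field K b d) U s \<in> dom_off_mark CP1 U \<rightarrow>\<^sub>E carrier_vec K"
        by (simp add: apply_fibrewise_def restrict_PiE_iff twisted_field_def carrier_vecI)
      fix i assume i: "i < K"
      let ?j = "Suc i mod K"
      have "?j < K" using i by simp
      then have sj: "regular CP1 mero U (\<lambda>z. vec_index (s z) ?j)"
        using s mem_sec_line_sum[OF U] by blast
      have "regular CP1 mero U (\<lambda>z. d i / d ?j * z ^ (b ! i))"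
        by (auto simp: regular_def intro!: holomorphic_intros meromorphic_intros)
      from this sj have "regular CP1 mero U (\<lambda>z. d i / d ?j * z ^ (b ! i) * vec_index (s z) ?j)"
        by (rule regular_mult) (rule meromorphic_on_mult)
      then show "regular CP1 mero U (\<lambda>z. vec_index (apply_fibrewise CP1 (twisted_field K b d) U s z) i)"
      proof (rule CP1.regular_transfer[OF U germ_property_mero])
        fix z assume z: "z \<in> dom_off_mark CP1 U"
        then have "s z \<in> carrier_vec K" using s mem_sec_line_sum[OF U] by blast
        then show "d i / d ?j * z ^ (b ! i) * vec_index (s z) ?j =
            vec_index (apply_fibrewise CP1 (twisted_field K b d) U s z) i"
          using z i by (simp add: apply_fibrewise_def twisted_field_mult_vec)
      qed
    qed
  qed
qed

section \<open>Eigenlines over the disc\<close>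

text \<open>
  With respect to \<open>u\<^sup>-\<^sup>m\<^sup>(\<^sup>i\<^sup>) e\<^sub>i\<close>, a frame of order \<open>0\<close> when \<open>m i = 2K \<alpha>\<^sub>i\<close>, these are up to \<open>d\<close> the
  eigenvectors of the cyclic permutation matrix.
\<close>

definition eigenvector ::
  "nat \<Rightarrow> (nat \<Rightarrow> complex) \<Rightarrow> (nat \<Rightarrow> int) \<Rightarrow> nat \<Rightarrow> complex \<Rightarrow> complex vec" where
  "eigenvector K d m l u = Matrix.vec K (\<lambda>i. d i * zeta K l ^ i * u powi (- m i))"

text \<open>
  The dual basis, from the inverse Fourier transform.
\<close>

definition eigencovector ::
  "nat \<Rightarrow> (nat \<Rightarrow> complex) \<Rightarrow> (nat \<Rightarrow> int) \<Rightarrow> nat \<Rightarrow> complex \<Rightarrow> complex vec" where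
  "eigencovector K d m l u =
     Matrix.vec K (\<lambda>i. u powi m i / (of_nat K * d i * zeta K l ^ i))"

definition eigenline ::
  "real \<Rightarrow> nat \<Rightarrow> (nat \<Rightarrow> complex) \<Rightarrow> (nat \<Rightarrow> int) \<Rightarrow> nat \<Rightarrow> (complex, complex vec) fsheaf" where
  "eigenline r K d m l = framed_bundle (disc r) 1
     (\<lambda>u. Matrix.mat K 1 (\<lambda>(i, _). vec_index (eigenvector K d m l u) i)) (\<lambda>_. 0)"

lemma eigenvector_carrier [simp]: "eigenvector K d m l u \<in> carrier_vec K"
  by (simp add: eigenvector_def)

lemma eigen_dual:
  assumes "K > 0" and "\<And>i. i < K \<Longrightarrow> d i \<noteq> 0" and "u \<noteq> 0" and "l \<in> {1..K}" and "l' \<in> {1..K}"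
  shows "(\<Sum>i<K. vec_index (eigencovector K d m l u) i * vec_index (eigenvector K d m l' u) i)
    = (if l = l' then 1 else 0)"
proof -
  have "(\<Sum>i<K. vec_index (eigencovector K d m l u) i * vec_index (eigenvector K d m l' u) i)
      = (\<Sum>i<K. (zeta K l' ^ i / zeta K l ^ i) / of_nat K)"
  proof (intro sum.cong refl)
    fix i assume "i \<in> {..<K}"
    then show "vec_index (eigencovector K d m l u) i * vec_index (eigenvector K d m l' u) i =
        (zeta K l' ^ i / zeta K l ^ i) / of_nat K"
      using assms(2)[of i] assms(3)
      by (simp add: eigenvector_def eigencovector_def power_int_minus divide_simps)
  qed
  also have "\<dots> = (\<Sum>i<K. zeta K l' ^ i / zeta K l ^ i) / of_nat K"
    by (simp add: sum_divide_distrib)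
  finally show ?thesis using sum_zeta_index[OF assms(1,4,5)] assms(1) by simp
qed

lemma eigen_resolution:
  assumes "K > 0" and "\<And>i. i < K \<Longrightarrow> d i \<noteq> 0" and "u \<noteq> 0" and "i < K" and "i' < K"
  shows "(\<Sum>l\<in>{1..K}. vec_index (eigenvector K d m l u) i * vec_index (eigencovector K d m l u) i')
    = (if i = i' then 1 else 0)"
proof -
  define c where "c = d i * u powi (- m i) * u powi m i' / (of_nat K * d i')"
  have "(\<Sum>l\<in>{1..K}. vec_index (eigenvector K d m l u) i * vec_index (eigencovector K d m l u) i')
      = (\<Sum>l\<in>{1..K}. c * (zeta K l ^ i / zeta K l ^ i'))"
    using assms(4,5) by (intro sum.cong refl) (simp add: eigenvector_def eigencovector_def c_def)
  also have "\<dots> = c * (if i = i' then of_nat K else 0)"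
    unfolding sum_distrib_left[symmetric] sum_zeta_exponent[OF assms(1,4,5)] ..
  also have "\<dots> = (if i = i' then 1 else 0)"
    using assms by (auto simp: c_def power_int_minus)
  finally show ?thesis .
qed

lemma frame_sections_eigenvector:
  "frame_sections (disc r) 1 (\<lambda>u. Matrix.mat K 1 (\<lambda>(i, _). vec_index (eigenvector K d m l u) i)) (\<lambda>_. P) W
   = (\<lambda>h. \<lambda>u\<in>dom_off_mark (disc r) W. h u \<cdot>\<^sub>v eigenvector K d m l u) ` O_germ (disc r) P W"
proof -
  have *: "Matrix.mat K 1 (\<lambda>(i, _). vec_index (eigenvector K d m l u) i) *\<^sub>v Matrix.vec 1 (\<lambda>j. f j u)
      = f 0 u \<cdot>\<^sub>v eigenvector K d m l u" for f :: "nat \<Rightarrow> complex \<Rightarrow> complex" and u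
    by (rule eq_vecI) (auto simp: scalar_prod_def eigenvector_def)
  have "{\<lambda>u\<in>dom_off_mark (disc r) W. f 0 u \<cdot>\<^sub>v eigenvector K d m l u | f. \<forall>j<1::nat. f j \<in> O_germ (disc r) P W}
      = (\<lambda>h. \<lambda>u\<in>dom_off_mark (disc r) W. h u \<cdot>\<^sub>v eigenvector K d m l u) ` O_germ (disc r) P W"
  proof (intro Set.set_eqI iffI)
    fix s assume "s \<in> (\<lambda>h. \<lambda>u\<in>dom_off_mark (disc r) W. h u \<cdot>\<^sub>v eigenvector K d m l u) ` O_germ (disc r) P W"
    then obtain h where "h \<in> O_germ (disc r) P W" "s = (\<lambda>u\<in>dom_off_mark (disc r) W. h u \<cdot>\<^sub>v eigenvector K d m l u)"
      by blast
    then show "s \<in> {\<lambda>u\<in>dom_off_mark (disc r) W. f 0 u \<cdot>\<^sub>v eigenvector K d m l u | f. \<forall>j<1::nat. f j \<in> O_germ (disc r) P W}"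
      by (intro CollectI exI[of _ "\<lambda>_. h"]) simp
  qed auto
  then show ?thesis unfolding frame_sections_def * .
qed

lemma sec_eigenline:
  "sec (eigenline r K d m l) W =
    (\<lambda>h. \<lambda>u\<in>dom_off_mark (disc r) W. h u \<cdot>\<^sub>v eigenvector K d m l u) ` O_germ (disc r) mero W"
  by (simp only: eigenline_def framed_bundle_def fsheaf.simps frame_sections_eigenvector)

lemma filt_eigenline:
  "filt (eigenline r K d m l) \<beta> W =
    (\<lambda>h. \<lambda>u\<in>dom_off_mark (disc r) W. h u \<cdot>\<^sub>v eigenvector K d m l u) ` O_germ (disc r) (pole_le \<lfloor>\<beta>\<rfloor>) W"
  by (simp only: eigenline_def framed_bundle_def fsheaf.simps frame_sections_eigenvector add_0_right)

text \<open>
  An eigenvector has order \<open>0\<close>, so the ordinary line bundle underlying the eigenline is the one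
  that it generates over \<open>O\<close>.
\<close>

lemma standard_filtered_line_eigenline:
  assumes r: "r > 0" and K: "K > 0" and d: "\<And>i. i < K \<Longrightarrow> d i \<noteq> 0" and l: "l \<in> {1..K}"
  shows "standard_filtered_line r K (eigenline r K d m l)"
proof -
  interpret D: surface "disc r" by (rule disc_surface[OF r])
  interpret framed "disc r" K 1 "\<lambda>u. Matrix.mat K 1 (\<lambda>(i, _). vec_index (eigenvector K d m l u) i)"
    "\<lambda>u. Matrix.mat 1 K (\<lambda>(_, i). vec_index (eigencovector K d m l u) i)"
  proof
    fix u assume "u \<in> dom_off_mark (disc r) (topspace (opens (disc r)))"
    then have "u \<noteq> 0" by (simp add: dom_off_mark_disc)
    show "Matrix.mat 1 K (\<lambda>(_, i). vec_index (eigencovector K d m l u) i) *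
        Matrix.mat K 1 (\<lambda>(i, _). vec_index (eigenvector K d m l u) i) = 1\<^sub>m 1"
      using eigen_dual[where m = m, OF K d \<open>u \<noteq> 0\<close> l l]
      by (intro eq_matI) (auto simp: scalar_prod_def lessThan_atLeast0)
  qed auto
  have fb: "filtered_bundle (disc r) K 1 (eigenline r K d m l)"
    unfolding eigenline_def by (rule filtered_bundle_framed_bundle)
  let ?w = "eigenvector K d m l"
  show ?thesis
    unfolding standard_filtered_line_def
  proof (intro conjI fb exI[of _ "filt (eigenline r K d m l) 0"] allI impI)
    show "locally_free (disc r) K 1 (O_hol (disc r)) (filt (eigenline r K d m l) 0)"
      using fb unfolding filtered_bundle_def by (elim conjE) (rule spec)
    fix \<beta> :: real and W assume W: "openin (opens (disc r)) W"
    have ne: "0 \<notin> dom_off_mark (disc r) W" by (simp add: dom_off_mark_disc)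
    have shift: "regular (disc r) (pole_le 0) W (\<lambda>u. u powi \<lfloor>\<beta>\<rfloor> * h u) \<longleftrightarrow>
        regular (disc r) (pole_le \<lfloor>\<beta>\<rfloor>) W h" for h
      using D.regular_shift[OF W ne, of "\<lfloor>\<beta>\<rfloor>" "- \<lfloor>\<beta>\<rfloor>" h] by simp
    show "filt (eigenline r K d m l) \<beta> W = {s \<in> sec (eigenline r K d m l) W.
        (\<lambda>u\<in>dom_off_mark (disc r) W. u powi \<lfloor>\<beta>\<rfloor> \<cdot>\<^sub>v s u) \<in> filt (eigenline r K d m l) 0 W}"
    proof (intro Set.set_eqI iffI)
      fix s assume "s \<in> filt (eigenline r K d m l) \<beta> W"
      then obtain h where s: "s = (\<lambda>u\<in>dom_off_mark (disc r) W. h u \<cdot>\<^sub>v ?w u)"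
        and h: "h \<in> O_germ (disc r) (pole_le \<lfloor>\<beta>\<rfloor>) W"
        unfolding filt_eigenline by blast
      have "h \<in> O_germ (disc r) mero W"
        using h regular_pole_le_imp_mero by (auto simp: O_germ_def)
      then have "s \<in> sec (eigenline r K d m l) W" unfolding sec_eigenline s by (rule imageI)
      moreover have "(\<lambda>u\<in>dom_off_mark (disc r) W. u powi \<lfloor>\<beta>\<rfloor> * h u) \<in> O_germ (disc r) (pole_le 0) W"
        unfolding D.restrict_mem_O_germ[OF W germ_property_pole_le] shift
        using h by (simp add: O_germ_def)
      moreover have "(\<lambda>u\<in>dom_off_mark (disc r) W. u powi \<lfloor>\<beta>\<rfloor> \<cdot>\<^sub>v s u) =
          (\<lambda>u\<in>dom_off_mark (disc r) W. (\<lambda>u\<in>dom_off_mark (disc r) W. u powi \<lfloor>\<beta>\<rfloor> * h u) u \<cdot>\<^sub>v ?w u)"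
        by (rule restrict_ext) (simp add: s smult_smult_assoc)
      ultimately show "s \<in> {s \<in> sec (eigenline r K d m l) W.
          (\<lambda>u\<in>dom_off_mark (disc r) W. u powi \<lfloor>\<beta>\<rfloor> \<cdot>\<^sub>v s u) \<in> filt (eigenline r K d m l) 0 W}"
        unfolding filt_eigenline floor_zero by blast
    next
      fix s assume "s \<in> {s \<in> sec (eigenline r K d m l) W.
          (\<lambda>u\<in>dom_off_mark (disc r) W. u powi \<lfloor>\<beta>\<rfloor> \<cdot>\<^sub>v s u) \<in> filt (eigenline r K d m l) 0 W}"
      then obtain h g where s: "s = (\<lambda>u\<in>dom_off_mark (disc r) W. h u \<cdot>\<^sub>v ?w u)"
        and h: "h \<in> O_germ (disc r) mero W"
        and g: "g \<in> O_germ (disc r) (pole_le 0) W"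
        and eq: "(\<lambda>u\<in>dom_off_mark (disc r) W. u powi \<lfloor>\<beta>\<rfloor> \<cdot>\<^sub>v s u) =
          (\<lambda>u\<in>dom_off_mark (disc r) W. g u \<cdot>\<^sub>v ?w u)"
        unfolding sec_eigenline filt_eigenline floor_zero by blast
      have gh: "g u = u powi \<lfloor>\<beta>\<rfloor> * h u" if u: "u \<in> dom_off_mark (disc r) W" for u
      proof -
        have "u powi \<lfloor>\<beta>\<rfloor> \<cdot>\<^sub>v (h u \<cdot>\<^sub>v ?w u) = g u \<cdot>\<^sub>v ?w u"
          using fun_cong[OF eq, of u] u by (simp add: s)
        (* the coordinate 0 of the eigenvector has no zero off u = 0, so it determines the coefficient *)
        then have "vec_index (u powi \<lfloor>\<beta>\<rfloor> \<cdot>\<^sub>v (h u \<cdot>\<^sub>v ?w u)) 0 = vec_index (g u \<cdot>\<^sub>v ?w u) 0" by simp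
        moreover have "vec_index (?w u) 0 \<noteq> 0" "dim_vec (?w u) = K"
          using u K d[of 0] by (auto simp: eigenvector_def dom_off_mark_disc)
        ultimately show ?thesis using K by simp
      qed
      have "regular (disc r) (pole_le 0) W (\<lambda>u. u powi \<lfloor>\<beta>\<rfloor> * h u)"
        by (rule D.regular_transfer[OF W germ_property_pole_le, of _ g]) (use g gh in \<open>auto simp: O_germ_def\<close>)
      then have "h \<in> O_germ (disc r) (pole_le \<lfloor>\<beta>\<rfloor>) W"
        using h by (simp add: shift O_germ_def)
      then show "s \<in> filt (eigenline r K d m l) \<beta> W" unfolding filt_eigenline s by (rule imageI)
    qed
  qed
qed

text \<open>
  The base change between the \<open>e\<^sub>i\<close> and the eigenvectors consists of constants times the powers
  \<open>u\<^sup>-\<^sup>m\<^sup>(\<^sup>i\<^sup>)\<close>. Any pair of conditions \<open>Q\<close> on coefficients and \<open>P i\<close> on coordinates that these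
  powers exchange is therefore respected in both directions; it is used for meromorphy and for bounds on
  poles.
\<close>

lemma decomposition_into_eigenlines:
  assumes r: "r > 0" and K: "K > 0" and d: "\<And>i. i < K \<Longrightarrow> d i \<noteq> 0"
    and W: "openin (opens (disc r)) W"
    and germ: "germ_property Q" "\<And>i. germ_property (P i)"
    and zero: "Q (\<lambda>_. 0)" "\<And>i. P i (\<lambda>_. 0)"
    and add: "\<And>h k. Q h \<Longrightarrow> Q k \<Longrightarrow> Q (\<lambda>x. h x + k x)" "\<And>i h k. P i h \<Longrightarrow> P i k \<Longrightarrow> P i (\<lambda>x. h x + k x)"
    and up: "\<And>i h c. i < K \<Longrightarrow> Q h \<Longrightarrow> P i (\<lambda>u. h u * (c * u powi (- m i)))"
    and down: "\<And>i h c. i < K \<Longrightarrow> P i h \<Longrightarrow> Q (\<lambda>u. u powi m i / c * h u)"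
  shows "bij_betw (\<lambda>\<sigma>. \<lambda>z\<in>dom_off_mark (disc r) W. Matrix.vec K (\<lambda>i. \<Sum>l\<in>{1..K}. vec_index (\<sigma> l z) i))
     (\<Pi>\<^sub>E l\<in>{1..K}. (\<lambda>h. \<lambda>u\<in>dom_off_mark (disc r) W. h u \<cdot>\<^sub>v eigenvector K d m l u) ` O_germ (disc r) Q W)
     {s \<in> dom_off_mark (disc r) W \<rightarrow>\<^sub>E carrier_vec K.
        \<forall>i<K. regular (disc r) (P i) W (\<lambda>u. vec_index (s u) i)}"
    (is "bij_betw ?add ?Lines ?F")
proof -
  interpret D: surface "disc r" by (rule disc_surface[OF r])
  let ?D = "dom_off_mark (disc r) W"
  let ?w = "eigenvector K d m" and ?v = "eigencovector K d m"
  define coef where "coef s l u = (\<Sum>i<K. vec_index (?v l u) i * vec_index (s u) i)"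
    for s :: "complex \<Rightarrow> complex vec" and l u
  define comp where "comp s = (\<lambda>l\<in>{1..K}. \<lambda>u\<in>?D. coef s l u \<cdot>\<^sub>v ?w l u)" for s
  have ne: "u \<noteq> 0" if "u \<in> ?D" for u using that by (simp add: dom_off_mark_disc)
  have powi_hol: "(\<lambda>u. u powi n) holomorphic_on ?D" for n
    by (intro holomorphic_intros) (simp add: dom_off_mark_disc)
  have form: "\<exists>h. \<forall>l\<in>{1..K}. regular (disc r) Q W (h l) \<and> (\<forall>u\<in>?D. \<sigma> l u = h l u \<cdot>\<^sub>v ?w l u) \<and>
      \<sigma> l \<in> extensional ?D"
    if "\<sigma> \<in> ?Lines" for \<sigma>
  proof -
    have "\<exists>h. regular (disc r) Q W h \<and> (\<forall>u\<in>?D. \<sigma> l u = h u \<cdot>\<^sub>v ?w l u) \<and> \<sigma> l \<in> extensional ?D"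
      if "l \<in> {1..K}" for l
    proof -
      have "\<sigma> l \<in> (\<lambda>h. \<lambda>u\<in>?D. h u \<cdot>\<^sub>v ?w l u) ` O_germ (disc r) Q W"
        using \<open>\<sigma> \<in> ?Lines\<close> that by (rule PiE_mem)
      then obtain h where "h \<in> O_germ (disc r) Q W" "\<sigma> l = (\<lambda>u\<in>?D. h u \<cdot>\<^sub>v ?w l u)" by blast
      then show ?thesis by (intro exI[of _ h]) (simp add: O_germ_def)
    qed
    then show ?thesis by metis
  qed
  show ?thesis
  proof (rule bij_betwI[where g = comp])
    show "?add \<in> ?Lines \<rightarrow> ?F"
    proof
      fix \<sigma> assume "\<sigma> \<in> ?Lines"
      from form[OF this] obtain h where
        H: "\<forall>l\<in>{1..K}. regular (disc r) Q W (h l) \<and> (\<forall>u\<in>?D. \<sigma> l u = h l u \<cdot>\<^sub>v ?w l u) \<and>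
          \<sigma> l \<in> extensional ?D" ..
      have h: "regular (disc r) Q W (h l)" if "l \<in> {1..K}" for l
        using bspec[OF H that] by (rule conjunct1)
      have \<sigma>: "\<sigma> l u = h l u \<cdot>\<^sub>v ?w l u" if "l \<in> {1..K}" "u \<in> ?D" for l u
        using bspec[OF H that(1)] that(2) by simp
      have "regular (disc r) (P i) W (\<lambda>u. vec_index (?add \<sigma> u) i)" if i: "i < K" for i
      proof -
        have "regular (disc r) (P i) W (\<lambda>u. \<Sum>l\<in>{1..K}. h l u * (d i * zeta K l ^ i * u powi (- m i)))"
        proof (rule regular_sum[OF _ add(2) zero(2)])
          fix l assume "l \<in> {1..K}"
          then have "regular (disc r) Q W (h l)" by (rule h)
          then show "regular (disc r) (P i) W (\<lambda>u. h l u * (d i * zeta K l ^ i * u powi (- m i)))"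
            using up[OF i, of "h l" "d i * zeta K l ^ i"] powi_hol
            by (auto simp: regular_def intro!: holomorphic_on_mult)
        qed
        then show ?thesis
          by (rule D.regular_transfer[OF W germ(2)])
            (use i \<sigma> in \<open>auto simp: eigenvector_def intro!: sum.cong\<close>)
      qed
      then show "?add \<sigma> \<in> ?F" by auto
    qed
    show "comp \<in> ?F \<rightarrow> ?Lines"
    proof
      fix s assume s: "s \<in> ?F"
      have "regular (disc r) Q W (coef s l)" for l
        unfolding coef_def
      proof (rule regular_sum[OF _ add(1) zero(1)])
        fix i assume "i \<in> {..<K}"
        then have i: "i < K" and "regular (disc r) (P i) W (\<lambda>u. vec_index (s u) i)" using s by auto
        then have "regular (disc r) Q W (\<lambda>u. u powi m i / (of_nat K * d i * zeta K l ^ i) * vec_index (s u) i)"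
          using down[OF i, of "\<lambda>u. vec_index (s u) i" "of_nat K * d i * zeta K l ^ i"] powi_hol d[OF i] K
          by (auto simp: regular_def intro!: holomorphic_on_mult holomorphic_on_divide)
        then show "regular (disc r) Q W (\<lambda>u. vec_index (?v l u) i * vec_index (s u) i)"
          using i by (simp add: eigencovector_def)
      qed
      then have "restrict (coef s l) ?D \<in> O_germ (disc r) Q W" for l
        by (simp add: D.restrict_mem_O_germ[OF W germ(1)])
      moreover have "(\<lambda>u\<in>?D. coef s l u \<cdot>\<^sub>v ?w l u) = (\<lambda>u\<in>?D. restrict (coef s l) ?D u \<cdot>\<^sub>v ?w l u)" for l
        by (rule restrict_ext) simp
      ultimately have "(\<lambda>u\<in>?D. coef s l u \<cdot>\<^sub>v ?w l u) \<in>
          (\<lambda>h. \<lambda>u\<in>?D. h u \<cdot>\<^sub>v ?w l u) ` O_germ (disc r) Q W" for l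
        by (intro image_eqI[of _ _ "restrict (coef s l) ?D"]) simp_all
      then show "comp s \<in> ?Lines" unfolding comp_def by (simp add: restrict_PiE_iff)
    qed
    show "comp (?add \<sigma>) = \<sigma>" if "\<sigma> \<in> ?Lines" for \<sigma>
    proof -
      from form[OF that] obtain h where
        H: "\<forall>l\<in>{1..K}. regular (disc r) Q W (h l) \<and> (\<forall>u\<in>?D. \<sigma> l u = h l u \<cdot>\<^sub>v ?w l u) \<and>
          \<sigma> l \<in> extensional ?D" ..
      have \<sigma>: "\<sigma> l u = h l u \<cdot>\<^sub>v ?w l u" if "l \<in> {1..K}" "u \<in> ?D" for l u
        using bspec[OF H that(1)] that(2) by simp
      have ext: "\<sigma> l \<in> extensional ?D" if "l \<in> {1..K}" for l
        using bspec[OF H that] by simp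
      have coef: "coef (?add \<sigma>) l u = h l u" if l: "l \<in> {1..K}" and u: "u \<in> ?D" for l u
      proof -
        have "coef (?add \<sigma>) l u =
            (\<Sum>i<K. vec_index (?v l u) i * (\<Sum>l'\<in>{1..K}. h l' u * vec_index (?w l' u) i))"
          using u \<sigma> by (simp add: coef_def eigenvector_def)
        also have "\<dots> = (\<Sum>i<K. \<Sum>l'\<in>{1..K}. h l' u * (vec_index (?v l u) i * vec_index (?w l' u) i))"
          by (simp add: sum_distrib_left mult_ac)
        also have "\<dots> = (\<Sum>l'\<in>{1..K}. h l' u * (\<Sum>i<K. vec_index (?v l u) i * vec_index (?w l' u) i))"
          by (subst sum.swap) (simp add: sum_distrib_left)
        also have "\<dots> = (\<Sum>l'\<in>{1..K}. h l' u * (if l = l' then 1 else 0))"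
          using eigen_dual[where m = m, OF K d ne[OF u] l] by (intro sum.cong) auto
        also have "\<dots> = h l u" using l by (simp add: if_distrib sum.delta cong: if_cong)
        finally show ?thesis .
      qed
      show ?thesis
      proof (rule extensionalityI[of _ "{1..K}"])
        fix l assume l: "l \<in> {1..K}"
        show "comp (?add \<sigma>) l = \<sigma> l"
        proof (rule extensionalityI[of _ ?D])
          show "comp (?add \<sigma>) l u = \<sigma> l u" if "u \<in> ?D" for u
            using that l \<sigma> coef by (simp add: comp_def)
        qed (use l ext in \<open>auto simp: comp_def\<close>)
      qed (use that in \<open>auto simp: comp_def PiE_def\<close>)
    qed
    show "?add (comp s) = s" if s: "s \<in> ?F" for s
    proof (rule extensionalityI[of _ ?D])
      fix u assume u: "u \<in> ?D"
      have c: "s u \<in> carrier_vec K" using s u by auto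
      show "?add (comp s) u = s u"
      proof (rule eq_vecI)
        fix i assume "i < dim_vec (s u)"
        then have i: "i < K" using c by simp
        have "vec_index (?add (comp s) u) i =
            (\<Sum>l\<in>{1..K}. (\<Sum>i'<K. vec_index (?v l u) i' * vec_index (s u) i') * vec_index (?w l u) i)"
          using u i by (simp add: comp_def coef_def eigenvector_def)
        also have "\<dots> = (\<Sum>l\<in>{1..K}. \<Sum>i'<K. vec_index (s u) i' * (vec_index (?w l u) i * vec_index (?v l u) i'))"
          unfolding sum_distrib_right by (intro sum.cong refl) (simp add: mult_ac)
        also have "\<dots> = (\<Sum>i'<K. vec_index (s u) i' * (\<Sum>l\<in>{1..K}. vec_index (?w l u) i * vec_index (?v l u) i'))"
          by (subst sum.swap) (simp add: sum_distrib_left)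
        also have "\<dots> = (\<Sum>i'<K. vec_index (s u) i' * (if i = i' then 1 else 0))"
          using eigen_resolution[where m = m, OF K d ne[OF u] i] by (intro sum.cong) auto
        also have "\<dots> = vec_index (s u) i" using i by (simp add: if_distrib sum.delta cong: if_cong)
        finally show "vec_index (?add (comp s) u) i = vec_index (s u) i" .
      qed (use u c in simp)
    qed (use s in \<open>auto simp: PiE_def\<close>)
  qed
qed

section \<open>Normal form of the field at infinity\<close>

lemma deriv_powi: "u \<noteq> 0 \<Longrightarrow> deriv (\<lambda>u. c * u powi n) u = c * (of_int n * u powi (n - 1))"
  for u c :: complex
  by (rule DERIV_imp_deriv) (auto intro!: derivative_eq_intros)

lemma deriv_cover:
  "u \<noteq> 0 \<Longrightarrow> deriv (cover K) u = - (2 * of_nat K) * u powi (- 2 * int K - 1)"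
  using deriv_powi[of u 1 "- 2 * int K"] by (simp add: cover_def[abs_def])

lemma deriv_sing_part:
  assumes "K > 0" and "u \<noteq> 0"
  shows "deriv (sing_part K N l) u = - (2 * of_nat K) * zeta K l * u powi (- 2 * int (N + K) - 1)"
proof -
  let ?q = "complex_of_real (real K / real (K + N))" and ?n = "- 2 * int (N + K)"
  have "?q * of_int ?n = complex_of_real (real K / real (K + N) * (- 2 * real (N + K)))" by simp
  also have "real K / real (K + N) * (- 2 * real (N + K)) = - (2 * real K)"
    using assms(1) by (simp add: field_simps)
  finally have q: "?q * of_int ?n = - (2 * of_nat K)" by simp
  have "sing_part K N l = (\<lambda>u. ?q * zeta K l * u powi ?n)"
    by (simp add: fun_eq_iff sing_part_def zeta_def)
  then have "deriv (sing_part K N l) u = ?q * zeta K l * (of_int ?n * u powi (?n - 1))"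
    using deriv_powi[OF assms(2), of "?q * zeta K l" ?n] by (simp only:)
  also have "\<dots> = (?q * of_int ?n) * zeta K l * u powi (?n - 1)" by (simp only: mult_ac)
  finally show ?thesis unfolding q .
qed

text \<open>
  The hypothesis on \<open>m\<close> is the relation between partition and weights multiplied by \<open>2K\<close>. It makes
  the exponent of \<open>u\<close> in each coordinate of the image differ by the same amount \<open>- 2K - 2N - 1\<close> from that
  in the eigenvector.
\<close>

lemma twisted_field_eigenvector:
  assumes K: "K > 0" and d: "\<And>i. i < K \<Longrightarrow> d i \<noteq> 0" and u: "u \<noteq> 0"
    and m: "\<And>i. i < K \<Longrightarrow> m i - m (Suc i mod K) = 2 * int K * int (b ! i) - 2 * int N"
  shows "pullback_form (cover K) (twisted_field K b d) u *\<^sub>v eigenvector K d m l u =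
    deriv (sing_part K N l) u \<cdot>\<^sub>v eigenvector K d m l u"
proof (rule eq_vecI)
  show "dim_vec (pullback_form (cover K) (twisted_field K b d) u *\<^sub>v eigenvector K d m l u) =
      dim_vec (deriv (sing_part K N l) u \<cdot>\<^sub>v eigenvector K d m l u)"
    by (simp add: pullback_form_def twisted_field_def eigenvector_def)
  fix i assume "i < dim_vec (deriv (sing_part K N l) u \<cdot>\<^sub>v eigenvector K d m l u)"
  then have i: "i < K" by (simp add: eigenvector_def)
  define j where "j = Suc i mod K"
  have j: "j < K" using i by (simp add: j_def)
  have zj: "zeta K l ^ j = zeta K l * zeta K l ^ i"
  proof -
    have "zeta K l ^ j = zeta K l ^ Suc i"
      unfolding zeta_power using zeta_eq_iff[OF K] by (simp add: j_def mod_mult_right_eq)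
    then show ?thesis by simp
  qed
  have powi: "u powi (- 2 * int K - 1) * (cover K u ^ (b ! i) * u powi (- m j)) =
      u powi (- 2 * int (N + K) - 1) * u powi (- m i)"
  proof -
    have "cover K u ^ (b ! i) = u powi (- 2 * int K * int (b ! i))"
      using power_int_mult[of u "- 2 * int K" "int (b ! i)"] by (simp add: cover_def)
    moreover have "(- 2 * int K - 1) + (- 2 * int K * int (b ! i) + - m j) =
        (- 2 * int (N + K) - 1) + - m i"
      using m[OF i] by (simp add: j_def)
    ultimately show ?thesis
      using power_int_add[of u] u by metis
  qed
  have c: "twisted_field K b d (cover K u) \<in> carrier_mat K K" by (simp add: twisted_field_def)
  have "vec_index (pullback_form (cover K) (twisted_field K b d) u *\<^sub>v eigenvector K d m l u) i =
      deriv (cover K) u * vec_index (twisted_field K b d (cover K u) *\<^sub>v eigenvector K d m l u) i"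
    unfolding pullback_form_def using c i
    by (simp add: smult_scalar_prod_distrib[of _ K])
  also have "\<dots> = deriv (cover K) u * (d i / d j * cover K u ^ (b ! i) * (d j * zeta K l ^ j * u powi (- m j)))"
    using twisted_field_mult_vec[OF i eigenvector_carrier] j by (simp add: j_def eigenvector_def)
  also have "\<dots> = - (2 * of_nat K) * zeta K l * (d i * zeta K l ^ i) *
      (u powi (- 2 * int K - 1) * (cover K u ^ (b ! i) * u powi (- m j)))"
    using d[OF j] by (simp add: deriv_cover[OF u] zj)
  also have "\<dots> = vec_index (deriv (sing_part K N l) u \<cdot>\<^sub>v eigenvector K d m l u) i"
    unfolding powi using i by (simp add: deriv_sing_part[OF K u] eigenvector_def mult_ac)
  finally show "vec_index (pullback_form (cover K) (twisted_field K b d) u *\<^sub>v eigenvector K d m l u) i =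
      vec_index (deriv (sing_part K N l) u \<cdot>\<^sub>v eigenvector K d m l u) i" .
qed

text \<open>
  On each eigenline the field equals the derivative of the singular part, so the difference that
  has to be bounded is the zero section.
\<close>

theorem good_at_infinity_twisted_field:
  assumes K: "K > 0" and d: "\<And>i. i < K \<Longrightarrow> d i \<noteq> 0"
    and a: "\<And>i. i < K \<Longrightarrow> 2 * real K * a i = of_int (m i)"
    and m: "\<And>i. i < K \<Longrightarrow> m i - m (Suc i mod K) = 2 * int K * int (b ! i) - 2 * int N"
  shows "good_at_infinity K N (line_sum K a) (twisted_field K b d)"
  unfolding good_at_infinity_def
proof (intro exI[of _ "1::real"] exI[of _ "eigenline 1 K d m"] conjI ballI allI impI)
  show one: "(0::real) < 1" by simp
  then interpret D: surface "disc 1" by (rule disc_surface)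
  show "standard_filtered_line 1 K (eigenline 1 K d m l)" if "l \<in> {1..K}" for l
    using that by (intro standard_filtered_line_eigenline K d) simp_all
  show "decomposes_into (disc 1) K (cover_pullback 1 K (line_sum K a)) {1..K} (eigenline 1 K d m)"
    unfolding decomposes_into_def Let_def
  proof (intro allI impI conjI)
    fix W assume W: "openin (opens (disc 1)) W"
    let ?add = "\<lambda>\<sigma>. \<lambda>z\<in>dom_off_mark (disc 1) W. Matrix.vec K (\<lambda>i. \<Sum>l\<in>{1..K}. vec_index (\<sigma> l z) i)"
    let ?lines = "\<lambda>Q. \<Pi>\<^sub>E l\<in>{1..K}.
      (\<lambda>h. \<lambda>u\<in>dom_off_mark (disc 1) W. h u \<cdot>\<^sub>v eigenvector K d m l u) ` O_germ (disc 1) Q W"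
    let ?sums = "\<lambda>P. {s \<in> dom_off_mark (disc 1) W \<rightarrow>\<^sub>E carrier_vec K.
      \<forall>i<K. regular (disc 1) (P i) W (\<lambda>u. vec_index (s u) i)}"
    have "sec (cover_pullback 1 K (line_sum K a)) W = ?sums (\<lambda>_. mero)"
      using mem_sec_cover_pullback[OF one K W] by (intro Set.set_eqI) simp
    moreover have "bij_betw ?add
        (?lines mero)
        (?sums (\<lambda>_. mero))"
      by (rule decomposition_into_eigenlines[OF one K d W])
        (assumption | rule germ_property_mero meromorphic_intros)+
    ultimately show "bij_betw ?add (\<Pi>\<^sub>E l\<in>{1..K}. sec (eigenline 1 K d m l) W)
        (sec (cover_pullback 1 K (line_sum K a)) W)"
      by (simp only: sec_eigenline)
    fix \<beta> :: real
    have "filt (cover_pullback 1 K (line_sum K a)) \<beta> W = ?sums (\<lambda>i. pole_le (\<lfloor>\<beta>\<rfloor> + m i))"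
      using mem_filt_cover_pullback[where a = a and m = m, OF one K W a] by (intro Set.set_eqI) simp
    moreover have "bij_betw ?add
        (?lines (pole_le \<lfloor>\<beta>\<rfloor>))
        (?sums (\<lambda>i. pole_le (\<lfloor>\<beta>\<rfloor> + m i)))"
    proof (rule decomposition_into_eigenlines[OF one K d W])
      show "pole_le (\<lfloor>\<beta>\<rfloor> + m i) (\<lambda>u. h u * (c * u powi (- m i)))"
        if "pole_le \<lfloor>\<beta>\<rfloor> h" for i h c
        using that by (rule pole_le_mult) (rule pole_le_scale, rule pole_le_powi)
      show "pole_le \<lfloor>\<beta>\<rfloor> (\<lambda>u. u powi m i / c * h u)" if "pole_le (\<lfloor>\<beta>\<rfloor> + m i) h" for i h c
      proof -
        have "pole_le (- m i) (\<lambda>u. inverse c * u powi m i)"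
          using pole_le_scale[OF pole_le_powi[of "- m i"]] by simp
        from pole_le_mult[OF this that] show ?thesis by (simp add: divide_inverse mult_ac)
      qed
    qed (simp_all add: germ_property_pole_le pole_le_zero pole_le_add)
    ultimately show "bij_betw ?add (\<Pi>\<^sub>E l\<in>{1..K}. filt (eigenline 1 K d m l) \<beta> W)
        (filt (cover_pullback 1 K (line_sum K a)) \<beta> W)"
      by (simp only: filt_eigenline)
  qed
  fix l W assume l: "l \<in> {1..K}" and W: "openin (opens (disc 1)) W"
  let ?D = "dom_off_mark (disc 1) W"
  let ?w = "eigenvector K d m l"
  let ?\<Phi> = "pullback_form (cover K) (twisted_field K b d)"
  have \<Phi>: "?\<Phi> u *\<^sub>v (c \<cdot>\<^sub>v ?w u) = (deriv (sing_part K N l) u * c) \<cdot>\<^sub>v ?w u" if "u \<in> ?D" for u c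
  proof -
    have "u \<noteq> 0" using that by (simp add: dom_off_mark_disc)
    have "?\<Phi> u \<in> carrier_mat K K" by (simp add: pullback_form_def twisted_field_def)
    then have "?\<Phi> u *\<^sub>v (c \<cdot>\<^sub>v ?w u) = c \<cdot>\<^sub>v (?\<Phi> u *\<^sub>v ?w u)" by (rule mult_mat_vec) simp
    also have "?\<Phi> u *\<^sub>v ?w u = deriv (sing_part K N l) u \<cdot>\<^sub>v ?w u"
      using K d \<open>u \<noteq> 0\<close> m by (rule twisted_field_eigenvector)
    finally show ?thesis by (simp add: smult_smult_assoc mult.commute)
  qed
  show "apply_fibrewise (disc 1) ?\<Phi> W ` sec (eigenline 1 K d m l) W \<subseteq> sec (eigenline 1 K d m l) W"
  proof clarify
    fix s assume "s \<in> sec (eigenline 1 K d m l) W"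
    then obtain h where s: "s = (\<lambda>u\<in>?D. h u \<cdot>\<^sub>v ?w u)" and h: "h \<in> O_germ (disc 1) mero W"
      unfolding sec_eigenline by blast
    define g where "g = (\<lambda>u\<in>?D. deriv (sing_part K N l) u * h u)"
    have "regular (disc 1) mero W
        (\<lambda>u. (- (2 * of_nat K) * zeta K l * u powi (- 2 * int (N + K) - 1)) * h u)"
    proof (rule regular_mult[where P = mero and Q = mero])
      show "regular (disc 1) mero W (\<lambda>u. - (2 * of_nat K) * zeta K l * u powi (- 2 * int (N + K) - 1))"
        unfolding regular_def
      proof
        show "(\<lambda>u. - (2 * of_nat K) * zeta K l * u powi (- 2 * int (N + K) - 1)) holomorphic_on ?D"
          by (intro holomorphic_intros) (simp add: dom_off_mark_disc)
        show "mark (disc 1) \<in> W \<longrightarrow> mero (\<lambda>x. - (2 * of_nat K) * zeta K l * loc (disc 1) x powi (- 2 * int (N + K) - 1))"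
          by (auto intro!: meromorphic_intros)
      qed
      show "regular (disc 1) mero W h" using h by (simp add: O_germ_def)
    qed (rule meromorphic_on_mult)
    then have "regular (disc 1) mero W (\<lambda>u. deriv (sing_part K N l) u * h u)"
      by (rule D.regular_transfer[OF W germ_property_mero])
        (simp add: deriv_sing_part[OF K] dom_off_mark_disc)
    then have "g \<in> O_germ (disc 1) mero W"
      by (simp add: g_def D.restrict_mem_O_germ[OF W germ_property_mero])
    moreover have "apply_fibrewise (disc 1) ?\<Phi> W s = (\<lambda>u\<in>?D. g u \<cdot>\<^sub>v ?w u)"
      unfolding apply_fibrewise_def by (rule restrict_ext) (simp add: s g_def \<Phi>)
    ultimately show "apply_fibrewise (disc 1) ?\<Phi> W s \<in> sec (eigenline 1 K d m l) W"
      unfolding sec_eigenline by blast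
  qed
  fix \<alpha> :: real and s assume "s \<in> filt (eigenline 1 K d m l) \<alpha> W"
  then obtain h where s: "s = (\<lambda>u\<in>?D. h u \<cdot>\<^sub>v ?w u)"
    unfolding filt_eigenline by blast
  have "(\<lambda>u\<in>?D. ?\<Phi> u *\<^sub>v s u - deriv (sing_part K N l) u \<cdot>\<^sub>v s u) = (\<lambda>u\<in>?D. (\<lambda>u\<in>?D. 0) u \<cdot>\<^sub>v ?w u)"
    by (rule restrict_ext) (auto simp: s \<Phi> smult_smult_assoc intro!: eq_vecI)
  moreover have "(\<lambda>u\<in>?D. 0) \<in> O_germ (disc 1) (pole_le \<lfloor>\<alpha> + 1\<rfloor>) W"
    by (simp add: D.restrict_mem_O_germ[OF W germ_property_pole_le] regular_zero pole_le_zero)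
  ultimately show "(\<lambda>u\<in>?D. ?\<Phi> u *\<^sub>v s u - deriv (sing_part K N l) u \<cdot>\<^sub>v s u)
      \<in> filt (eigenline 1 K d m l) (\<alpha> + 1) W"
    unfolding filt_eigenline by (rule image_eqI)
qed

section \<open>Weights\<close>

text \<open>
  Partial sums of the increments prescribed for the weights; a solution of the difference
  equation is a constant minus the height.
\<close>

definition height :: "nat \<Rightarrow> nat \<Rightarrow> nat list \<Rightarrow> nat \<Rightarrow> real" where
  "height K N b i = (\<Sum>j<i. real (b ! j) - real N / real K)"

text \<open>
  The mean of the heights, which is the constant for which the weights add up to \<open>0\<close>.
\<close>

definition base_weight :: "nat \<Rightarrow> nat \<Rightarrow> nat list \<Rightarrow> real" where
  "base_weight K N b = (\<Sum>i<K. height K N b i) / real K"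

lemma sum_list_eq_sum_nth: "length xs = K \<Longrightarrow> sum_list xs = (\<Sum>i<K. xs ! i)"
  by (simp add: sum_list_sum_nth lessThan_atLeast0)

lemma height_full:
  assumes "K > 0" and "ordered_partition K N b"
  shows "height K N b K = 0"
proof -
  have "(\<Sum>j<K. real (b ! j)) = real N"
    using assms(2) sum_list_eq_sum_nth[of b K] by (simp add: ordered_partition_def flip: of_nat_sum)
  then show ?thesis using assms(1) by (simp add: height_def sum_subtractf)
qed

text \<open>
  The equation for the last index closes up because the increments add up to \<open>N - K (N/K) = 0\<close>.
\<close>

lemma is_weights_iff:
  assumes K: "K > 0" and b: "ordered_partition K N b"
  shows "is_weights K N b a \<longleftrightarrow> a = map (\<lambda>i. base_weight K N b - height K N b i) [0..<K]"
proof
  assume a: "is_weights K N b a"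
  then have len: "length a = K" and sum: "(\<Sum>i<K. a ! i) = 0"
    using sum_list_eq_sum_nth[of a K] by (auto simp: is_weights_def)
  have step: "a ! i = a ! 0 - height K N b i" if "i < K" for i
    using that
  proof (induction i)
    case 0
    then show ?case by (simp add: height_def)
  next
    case (Suc i)
    have "i < K" "Suc i mod K = Suc i" using Suc.prems by simp_all
    moreover have "\<forall>i<K. real (b ! i) - real N / real K = a ! i - a ! (Suc i mod K)"
      using a by (simp add: is_weights_def)
    ultimately have "real (b ! i) - real N / real K = a ! i - a ! Suc i" by metis
    moreover have "a ! i = a ! 0 - height K N b i" by (rule Suc.IH) (rule \<open>i < K\<close>)
    moreover have "height K N b (Suc i) = height K N b i + (real (b ! i) - real N / real K)"
      by (simp add: height_def)
    ultimately show ?case by linarith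
  qed
  have "(\<Sum>i<K. a ! i) = (\<Sum>i<K. a ! 0 - height K N b i)"
    by (intro sum.cong refl) (rule step, simp)
  then have "0 = (\<Sum>i<K. a ! 0 - height K N b i)" using sum by simp
  also have "\<dots> = real K * a ! 0 - (\<Sum>i<K. height K N b i)" by (simp add: sum_subtractf)
  finally have a0: "a ! 0 = base_weight K N b" using K by (simp add: base_weight_def field_simps)
  show "a = map (\<lambda>i. base_weight K N b - height K N b i) [0..<K]"
  proof (rule nth_equalityI)
    fix i assume "i < length a"
    then have "i < K" using len by simp
    then show "a ! i = map (\<lambda>i. base_weight K N b - height K N b i) [0..<K] ! i"
      using step[OF \<open>i < K\<close>] a0 by simp
  qed (use len in simp)
next
  assume a: "a = map (\<lambda>i. base_weight K N b - height K N b i) [0..<K]"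
  have "real (b ! i) - real N / real K = a ! i - a ! (Suc i mod K)" if i: "i < K" for i
  proof -
    have "height K N b (Suc i mod K) = height K N b (Suc i)"
    proof (cases "Suc i = K")
      case True
      then show ?thesis using height_full[OF K b] by (simp add: height_def)
    qed (use i in simp)
    moreover have "Suc i mod K < K" using K by simp
    ultimately show ?thesis using i by (simp add: a) (simp add: height_def)
  qed
  moreover have "sum_list a = 0"
  proof -
    have "sum_list a = (\<Sum>i<K. base_weight K N b - height K N b i)"
      by (simp add: a sum_list_eq_sum_nth[of _ K])
    then show ?thesis using K by (simp add: sum_subtractf base_weight_def)
  qed
  ultimately show "is_weights K N b a" by (simp add: is_weights_def a)
qed

lemma ex1_weights:
  assumes "K > 0" and "ordered_partition K N b"
  shows "\<exists>!a. is_weights K N b a"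
  using is_weights_iff[OF assms] by simp

lemma is_weights_weights:
  assumes "K > 0" and "ordered_partition K N b"
  shows "is_weights K N b (weights K N b)"
  unfolding weights_def using ex1_weights[OF assms] by (rule theI')

lemma sum_weights:
  assumes "K > 0" and "ordered_partition K N b"
  shows "(\<Sum>i<K. weights K N b ! i) = 0"
  using is_weights_weights[OF assms] sum_list_eq_sum_nth[of "weights K N b" K]
  by (simp add: is_weights_def)

lemma weights_step:
  assumes "K > 0" and "ordered_partition K N b" and "i < K"
  shows "weights K N b ! i - weights K N b ! (Suc i mod K) = real (b ! i) - real N / real K"
  using is_weights_weights[OF assms(1,2)] assms(3) by (simp add: is_weights_def)

text \<open>
  Heights lie in \<open>(1/K)\<int>\<close>, but their mean involves \<open>(0 + \<dots> + (K - 1)) / K = (K - 1)/2\<close>. This is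
  why the covering has degree \<open>2K\<close> and not \<open>K\<close>.
\<close>

lemma weights_half_integral:
  assumes K: "K > 0" and b: "ordered_partition K N b" and i: "i < K"
  shows "2 * real K * (weights K N b ! i) \<in> \<int>"
proof -
  have h: "height K N b i = real (\<Sum>j<i. b ! j) - real i * (real N / real K)" for i
    by (simp add: height_def sum_subtractf)
  have gauss: "(\<Sum>i<K. real i) = real K * (real K - 1) / 2"
    by (induction K) (simp_all add: field_simps)
  have "2 * real K * base_weight K N b = 2 * (\<Sum>i<K. height K N b i)"
    using K by (simp add: base_weight_def)
  also have "(\<Sum>i<K. height K N b i) =
      (\<Sum>i<K. real (\<Sum>j<i. b ! j)) - (\<Sum>i<K. real i) * (real N / real K)"
    unfolding h sum_subtractf sum_distrib_right ..
  also have "2 * \<dots> = real (2 * (\<Sum>i<K. \<Sum>j<i. b ! j)) - real N * (real K - 1)"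
    using K by (simp add: gauss field_simps)
  also have "\<dots> \<in> \<int>" by (intro Ints_diff Ints_mult Ints_of_nat Ints_1)
  finally have "2 * real K * base_weight K N b \<in> \<int>" .
  moreover have "2 * real K * height K N b i = real (2 * K * (\<Sum>j<i. b ! j)) - real (2 * i * N)"
    using K by (simp add: h field_simps)
  then have "2 * real K * height K N b i \<in> \<int>" by (simp del: of_nat_mult of_nat_sum)
  moreover have "weights K N b ! i = base_weight K N b - height K N b i"
    using is_weights_weights[OF K b] i unfolding is_weights_iff[OF K b] by simp
  ultimately show ?thesis by (simp add: right_diff_distrib)
qed

definition twisted_higgs :: "nat \<Rightarrow> nat \<Rightarrow> nat list \<Rightarrow> (nat \<Rightarrow> complex) \<Rightarrow> sl_higgs" where
  "twisted_higgs K N b d = \<lparr>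
     Bun = partition_bundle K N b,
     Vol = (\<lambda>z. wedge K K (\<lambda>i. canonical_section K i z)),
     Hig = twisted_field K b d\<rparr>"

theorem twisted_higgs_mem_objs:
  assumes K: "K \<ge> 2" and b: "ordered_partition K N b" and d: "\<And>i. i < K \<Longrightarrow> d i \<noteq> 0"
  shows "twisted_higgs K N b d \<in> objs K N"
proof -
  have K0: "K > 0" using K by simp
  let ?a = "\<lambda>i. weights K N b ! i"
  define m where "m i = \<lfloor>2 * real K * ?a i\<rfloor>" for i
  have m: "2 * real K * ?a i = of_int (m i)" if "i < K" for i
    using weights_half_integral[OF K0 b that] by (simp add: m_def)
  have cyc: "m i - m (Suc i mod K) = 2 * int K * int (b ! i) - 2 * int N" if i: "i < K" for i
  proof -
    have "real_of_int (m i - m (Suc i mod K)) = 2 * real K * (?a i - ?a (Suc i mod K))"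
      using m[OF i] m[of "Suc i mod K"] K0 by (simp add: right_diff_distrib)
    also have "\<dots> = real_of_int (2 * int K * int (b ! i) - 2 * int N)"
      using weights_step[OF K0 b i] K0 by (simp add: field_simps)
    finally show ?thesis by (simp only: of_int_eq_iff)
  qed
  have "sl_bundle K (line_sum K ?a) (\<lambda>z. wedge K K (unit_vec K))"
    using K0 sum_weights[OF K0 b] by (rule sl_bundle_line_sum)
  moreover have "higgs_field K (line_sum K ?a) (twisted_field K b d)"
    using K by (rule higgs_field_twisted_field)
  moreover have "good_at_infinity K N (line_sum K ?a) (twisted_field K b d)"
    by (rule good_at_infinity_twisted_field[OF K0 d m cyc])
  ultimately show ?thesis
    by (simp add: objs_def sl_higgs_bundle_def twisted_higgs_def partition_bundle_def canonical_section_def)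
qed

section \<open>Isomorphisms of Higgs bundles\<close>

lemma filtered_isoI:
  assumes "\<And>z. g z \<in> carrier_mat K K" and "\<And>z. invertible_mat (g z)"
    and "\<And>U. openin (opens CP1) U \<Longrightarrow> apply_fibrewise CP1 g U ` sec E U = sec E' U"
    and "\<And>U \<alpha>. openin (opens CP1) U \<Longrightarrow> apply_fibrewise CP1 g U ` filt E \<alpha> U = filt E' \<alpha> U"
  shows "filtered_iso CP1 K E E' g"
  using assms by (simp add: filtered_iso_def)

lemma filtered_isoD:
  assumes "filtered_iso CP1 K E E' g"
  shows "g z \<in> carrier_mat K K" and "invertible_mat (g z)"
    and "openin (opens CP1) U \<Longrightarrow> apply_fibrewise CP1 g U ` sec E U = sec E' U"
    and "openin (opens CP1) U \<Longrightarrow> apply_fibrewise CP1 g U ` filt E \<alpha> U = filt E' \<alpha> U"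
  using assms by (simp_all add: filtered_iso_def dom_off_mark_CP1)

lemma invertible_matI:
  assumes "A \<in> carrier_mat n n" and "B \<in> carrier_mat n n" and "A * B = 1\<^sub>m n" and "B * A = 1\<^sub>m n"
  shows "invertible_mat A"
  using assms by (auto simp: invertible_mat_def inverts_mat_def)

lemma invertible_matE:
  assumes "invertible_mat A" and A: "A \<in> carrier_mat n n"
  obtains B where "B \<in> carrier_mat n n" "A * B = 1\<^sub>m n" "B * A = 1\<^sub>m n"
proof -
  obtain B where B: "A * B = 1\<^sub>m n" "B * A = 1\<^sub>m (dim_row B)"
    using assms by (auto simp: invertible_mat_def inverts_mat_def)
  have "dim_col B = n" using arg_cong[OF B(1), of dim_col] by simp
  moreover have "dim_row B = n" using arg_cong[OF B(2), of dim_col] A by simp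
  ultimately show ?thesis using that[of B] B by auto
qed

lemma invertible_mat_mult:
  assumes A: "A \<in> carrier_mat n n" "invertible_mat A" and B: "B \<in> carrier_mat n n" "invertible_mat B"
  shows "invertible_mat (A * B)"
proof -
  obtain A' where A': "A' \<in> carrier_mat n n" "A * A' = 1\<^sub>m n" "A' * A = 1\<^sub>m n"
    using invertible_matE[OF A(2,1)] by blast
  obtain B' where B': "B' \<in> carrier_mat n n" "B * B' = 1\<^sub>m n" "B' * B = 1\<^sub>m n"
    using invertible_matE[OF B(2,1)] by blast
  have "A * B * (B' * A') = A * (B * B') * A'"
    using A(1) B(1) A'(1) B'(1) by (simp add: assoc_mult_mat[of _ n n _ n _ n])
  then have 1: "A * B * (B' * A') = 1\<^sub>m n" using A A' B' by simp
  have "B' * A' * (A * B) = B' * (A' * A) * B"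
    using A(1) B(1) A'(1) B'(1) by (simp add: assoc_mult_mat[of _ n n _ n _ n])
  then have "B' * A' * (A * B) = 1\<^sub>m n" using B A' B' by simp
  with 1 show ?thesis
    using A(1) B(1) A'(1) B'(1) by (intro invertible_matI[of _ n "B' * A'"]) auto
qed

text \<open>
  Composing morphisms uses associativity of the matrix product, hence the dimensions of the
  vectors involved.
\<close>

definition vector_valued :: "nat \<Rightarrow> (complex option, complex vec) fsheaf \<Rightarrow> bool" where
  "vector_valued K E \<longleftrightarrow> (\<forall>U. openin (opens CP1) U \<longrightarrow>
     (\<forall>s\<in>sec E U. \<forall>z\<in>dom_off_mark CP1 U. s z \<in> carrier_vec K) \<and>
     (\<forall>\<alpha>. \<forall>s\<in>filt E \<alpha> U. \<forall>z\<in>dom_off_mark CP1 U. s z \<in> carrier_vec K))"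

lemma filtered_bundle_vector_valued:
  assumes "filtered_bundle CP1 K n E"
  shows "vector_valued K E"
proof -
  have "is_module_sheaf CP1 K (O_mer CP1) (sec E)" "is_module_sheaf CP1 K (O_hol CP1) (filt E \<alpha>)" for \<alpha>
    using assms unfolding filtered_bundle_def locally_free_def by auto
  then show ?thesis unfolding is_module_sheaf_def vector_valued_def by metis
qed

lemma filtered_iso_trans:
  assumes g: "filtered_iso CP1 K E E' g" and h: "filtered_iso CP1 K E' E'' h"
    and E: "vector_valued K E"
  shows "filtered_iso CP1 K E E'' (\<lambda>z. h z * g z)"
proof (rule filtered_isoI)
  note g' = filtered_isoD[OF g] and h' = filtered_isoD[OF h]
  show "h z * g z \<in> carrier_mat K K" for z by (rule mult_carrier_mat[OF h'(1) g'(1)])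
  show "invertible_mat (h z * g z)" for z using g'(1,2) h'(1,2) by (intro invertible_mat_mult)
  fix U assume U: "openin (opens CP1) U"
  have comp: "apply_fibrewise CP1 (\<lambda>z. h z * g z) U s = apply_fibrewise CP1 h U (apply_fibrewise CP1 g U s)"
    if "\<forall>z\<in>dom_off_mark CP1 U. s z \<in> carrier_vec K" for s
    unfolding apply_fibrewise_def
    by (rule restrict_ext) (use that g'(1) h'(1) in \<open>simp add: assoc_mult_mat_vec[of _ K K _ K]\<close>)
  have "apply_fibrewise CP1 (\<lambda>z. h z * g z) U ` sec E U =
      apply_fibrewise CP1 h U ` apply_fibrewise CP1 g U ` sec E U"
    unfolding image_image using E U comp by (intro image_cong refl) (simp add: vector_valued_def)
  then show "apply_fibrewise CP1 (\<lambda>z. h z * g z) U ` sec E U = sec E'' U"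
    by (simp only: g'(3)[OF U] h'(3)[OF U])
  fix \<alpha>
  have "apply_fibrewise CP1 (\<lambda>z. h z * g z) U ` filt E \<alpha> U =
      apply_fibrewise CP1 h U ` apply_fibrewise CP1 g U ` filt E \<alpha> U"
    unfolding image_image using E U comp by (intro image_cong refl) (simp add: vector_valued_def)
  then show "apply_fibrewise CP1 (\<lambda>z. h z * g z) U ` filt E \<alpha> U = filt E'' \<alpha> U"
    by (simp only: g'(4)[OF U] h'(4)[OF U])
qed

lemma objs_vector_valued: "X \<in> objs K N \<Longrightarrow> vector_valued K (Bun X)"
  by (intro filtered_bundle_vector_valued[of K K]) (simp add: objs_def sl_higgs_bundle_def sl_bundle_def)

lemma objs_higgs_carrier: "X \<in> objs K N \<Longrightarrow> Hig X z \<in> carrier_mat K K"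
  by (simp add: objs_def sl_higgs_bundle_def higgs_field_def)

lemma higgs_iso_trans:
  assumes X: "X \<in> objs K N" and Y: "Y \<in> objs K N" and Z: "Z \<in> objs K N"
    and "higgs_iso K X Y" and "higgs_iso K Y Z"
  shows "higgs_iso K X Z"
proof -
  obtain g where g: "filtered_iso CP1 K (Bun X) (Bun Y) g" "\<And>z. g z * Hig X z = Hig Y z * g z"
    using assms(4) unfolding higgs_iso_def by blast
  obtain h where h: "filtered_iso CP1 K (Bun Y) (Bun Z) h" "\<And>z. h z * Hig Y z = Hig Z z * h z"
    using assms(5) unfolding higgs_iso_def by blast
  have "h z * g z * Hig X z = Hig Z z * (h z * g z)" for z
  proof -
    note c = filtered_isoD(1)[OF g(1), of z] filtered_isoD(1)[OF h(1), of z]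
      objs_higgs_carrier[OF X, of z] objs_higgs_carrier[OF Y, of z] objs_higgs_carrier[OF Z, of z]
    have "h z * g z * Hig X z = h z * (g z * Hig X z)" by (rule assoc_mult_mat[OF c(2,1,3)])
    also have "\<dots> = h z * Hig Y z * g z"
      unfolding g(2) by (rule assoc_mult_mat[symmetric, OF c(2,4,1)])
    also have "\<dots> = Hig Z z * (h z * g z)"
      unfolding h(2) by (rule assoc_mult_mat[OF c(5,2,1)])
    finally show ?thesis .
  qed
  then show ?thesis
    using filtered_iso_trans[OF g(1) h(1) objs_vector_valued[OF X]] unfolding higgs_iso_def by blast
qed

section \<open>Pullback under scalings of the projective line\<close>

lemma rho_scale: "\<exists>c. c \<noteq> 0 \<and> rho K N t = (\<lambda>z. c * z) \<and> rho K N (- t) = (\<lambda>z. inverse c * z)"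
  by (rule exI[of _ "exp (- (of_nat K * t / of_nat (K + N)))"])
    (auto simp: rho_def[abs_def] exp_minus[symmetric])

lemma rho_rho: "rho K N (- t) (rho K N t z) = z" "rho K N t (rho K N (- t) z) = z"
  using rho_scale[of K N t] by auto

lemma dom_map_option:
  "dom_off_mark CP1 (map_option (rho K N t) ` U) = rho K N t ` dom_off_mark CP1 U"
proof (intro Set.set_eqI iffI)
  fix w assume "w \<in> dom_off_mark CP1 (map_option (rho K N t) ` U)"
  then obtain p where "p \<in> U" "Some w = map_option (rho K N t) p" by (auto simp: dom_off_mark_CP1)
  then show "w \<in> rho K N t ` dom_off_mark CP1 U" by (cases p) (auto simp: dom_off_mark_CP1)
next
  fix w assume "w \<in> rho K N t ` dom_off_mark CP1 U"
  then obtain z where "Some z \<in> U" "w = rho K N t z" by (auto simp: dom_off_mark_CP1)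
  then have "map_option (rho K N t) (Some z) \<in> map_option (rho K N t) ` U" by blast
  then show "w \<in> dom_off_mark CP1 (map_option (rho K N t) ` U)"
    using \<open>w = rho K N t z\<close> by (simp add: dom_off_mark_CP1)
qed

lemma map_option_rho_inverse: "map_option (rho K N (- t)) ` map_option (rho K N t) ` U = U"
proof -
  have "map_option (rho K N (- t)) (map_option (rho K N t) p) = p" for p
    by (cases p) (simp_all add: rho_rho)
  then show ?thesis by (simp add: image_image)
qed

text \<open>
  A scaling is a homeomorphism of the plane, so it preserves open sets and complements of compact
  sets.
\<close>

lemma openin_map_option_rho:
  assumes "openin (opens CP1) U"
  shows "openin (opens CP1) (map_option (rho K N t) ` U)"
proof -
  obtain c where c: "rho K N t = (\<lambda>z. c * z)" "rho K N (- t) = (\<lambda>z. inverse c * z)"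
    using rho_scale by blast
  have cont: "continuous_on A (rho K N t)" "continuous_on A (rho K N (- t))" for A
    unfolding c by (intro continuous_intros)+
  from assms show ?thesis
  proof (unfold openin_CP1, elim disjE exE conjE)
    fix V :: "complex set" assume "open V" "U = Some ` V"
    have "rho K N t ` V = rho K N (- t) -` V"
    proof (intro Set.set_eqI iffI)
      fix w assume "w \<in> rho K N (- t) -` V"
      then show "w \<in> rho K N t ` V" using rho_rho(2)[of K N t w] by (metis imageI vimageD)
    qed (auto simp: rho_rho)
    then have "open (rho K N t ` V)"
      using \<open>open V\<close> cont(2)[of UNIV] by (simp add: open_vimage)
    moreover have "map_option (rho K N t) ` U = Some ` rho K N t ` V"
      by (simp add: \<open>U = Some ` V\<close> image_image)
    ultimately show "(\<exists>V. open V \<and> map_option (rho K N t) ` U = Some ` V) \<or>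
        (\<exists>C. compact C \<and> map_option (rho K N t) ` U = insert None (Some ` (- C)))" by blast
  next
    fix C :: "complex set" assume "compact C" "U = insert None (Some ` (- C))"
    have "bij (rho K N t)"
      by (rule bij_betw_byWitness[where f' = "rho K N (- t)"]) (simp_all add: rho_rho)
    then have "rho K N t ` (- C) = - (rho K N t ` C)" by (rule bij_image_Compl_eq)
    then have "map_option (rho K N t) ` U = insert None (Some ` (- (rho K N t ` C)))"
      by (simp add: \<open>U = _\<close> image_image) (metis image_image)
    moreover have "compact (rho K N t ` C)"
      using cont(1) \<open>compact C\<close> by (rule compact_continuous_image)
    ultimately show "(\<exists>V. open V \<and> map_option (rho K N t) ` U = Some ` V) \<or>
        (\<exists>C. compact C \<and> map_option (rho K N t) ` U = insert None (Some ` (- C)))" by blast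
  qed
qed

text \<open>
  Pulling back sections commutes with applying morphisms fibrewise.
\<close>

lemma filtered_iso_pullback:
  assumes g: "filtered_iso CP1 K E E' g"
  shows "filtered_iso CP1 K (pullback_bundle (rho K N t) E) (pullback_bundle (rho K N t) E')
    (\<lambda>z. g (rho K N t z))"
proof (rule filtered_isoI)
  note g' = filtered_isoD[OF g]
  show "g (rho K N t z) \<in> carrier_mat K K" "invertible_mat (g (rho K N t z))" for z using g'(1,2) by auto
  fix U assume "openin (opens CP1) U"
  then have rU: "openin (opens CP1) (map_option (rho K N t) ` U)" by (rule openin_map_option_rho)
  let ?pull = "\<lambda>s. \<lambda>z\<in>dom_off_mark CP1 U. s (rho K N t z)"
  have comm: "apply_fibrewise CP1 (\<lambda>z. g (rho K N t z)) U (?pull s) =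
      ?pull (apply_fibrewise CP1 g (map_option (rho K N t) ` U) s)" for s :: "complex \<Rightarrow> complex vec"
    unfolding apply_fibrewise_def dom_map_option by (rule restrict_ext) simp
  have "apply_fibrewise CP1 (\<lambda>z. g (rho K N t z)) U ` ?pull ` F =
      ?pull ` apply_fibrewise CP1 g (map_option (rho K N t) ` U) ` F" for F :: "(complex \<Rightarrow> complex vec) set"
    unfolding image_image comm ..
  then show "apply_fibrewise CP1 (\<lambda>z. g (rho K N t z)) U ` sec (pullback_bundle (rho K N t) E) U =
      sec (pullback_bundle (rho K N t) E') U"
    and "apply_fibrewise CP1 (\<lambda>z. g (rho K N t z)) U ` filt (pullback_bundle (rho K N t) E) \<alpha> U =
      filt (pullback_bundle (rho K N t) E') \<alpha> U" for \<alpha>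
    by (simp_all only: pullback_bundle_def fsheaf.simps g'(3)[OF rU] g'(4)[OF rU])
qed

lemma higgs_iso_act_obj:
  assumes X: "X \<in> objs K N" and Y: "Y \<in> objs K N" and "higgs_iso K X Y"
  shows "higgs_iso K (act_obj K N t X) (act_obj K N t Y)"
proof -
  obtain g where g: "filtered_iso CP1 K (Bun X) (Bun Y) g" "\<And>z. g z * Hig X z = Hig Y z * g z"
    using assms(3) unfolding higgs_iso_def by blast
  have "g (rho K N t z) * Hig (act_obj K N t X) z = Hig (act_obj K N t Y) z * g (rho K N t z)" for z
  proof -
    let ?r = "rho K N t z"
    note c = filtered_isoD(1)[OF g(1), of ?r] objs_higgs_carrier[OF X, of ?r] objs_higgs_carrier[OF Y, of ?r]
    have "g ?r * (exp t \<cdot>\<^sub>m (deriv (rho K N t) z \<cdot>\<^sub>m Hig X ?r)) =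
        exp t \<cdot>\<^sub>m (deriv (rho K N t) z \<cdot>\<^sub>m (g ?r * Hig X ?r))"
      using c by (simp add: mult_smult_distrib[of _ K K _ K])
    also have "\<dots> = exp t \<cdot>\<^sub>m (deriv (rho K N t) z \<cdot>\<^sub>m Hig Y ?r) * g ?r"
      unfolding g(2) using c by (simp add: mult_smult_assoc_mat[of _ K K _ K])
    finally show ?thesis by (simp add: act_obj_def pullback_form_def)
  qed
  then show ?thesis
    unfolding higgs_iso_def
    by (intro exI[of _ "\<lambda>z. g (rho K N t z)"]) (simp add: act_obj_def filtered_iso_pullback[OF g(1)])
qed

section \<open>Invariance of sums of lines under scaling\<close>

text \<open>
  In the coordinate \<open>x = 1/z\<close> the map \<open>z \<mapsto> c z\<close> is \<open>x \<mapsto> x/c\<close>, so it preserves every germ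
  condition that is invariant under scaling \<open>x\<close>.
\<close>

lemma O_germ_rescale:
  assumes P: "\<And>h c. c \<noteq> 0 \<Longrightarrow> P h \<Longrightarrow> P (\<lambda>x. h (c * x))"
    and f: "f \<in> O_germ CP1 P (map_option (rho K N t) ` U)"
  shows "(\<lambda>z\<in>dom_off_mark CP1 U. f (rho K N t z)) \<in> O_germ CP1 P U"
proof -
  obtain c where c: "c \<noteq> 0" "rho K N t = (\<lambda>z. c * z)" using rho_scale by blast
  have inj: "rho K N t z \<in> rho K N t ` A \<longleftrightarrow> z \<in> A" for z A
    using c by (auto simp: inj_on_def)
  (* both sides are undefined off the domain *)
  have eq: "(\<lambda>z\<in>dom_off_mark CP1 U. f (rho K N t z)) = (\<lambda>z. f (rho K N t z))"
  proof
    fix z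
    show "(\<lambda>z\<in>dom_off_mark CP1 U. f (rho K N t z)) z = f (rho K N t z)"
    proof (cases "z \<in> dom_off_mark CP1 U")
      case False
      then have "rho K N t z \<notin> dom_off_mark CP1 (map_option (rho K N t) ` U)"
        by (simp add: dom_map_option inj)
      then show ?thesis using f False by (simp add: O_germ_def extensional_def)
    qed simp
  qed
  have "(f \<circ> rho K N t) holomorphic_on dom_off_mark CP1 U"
  proof (rule holomorphic_on_compose)
    show "rho K N t holomorphic_on dom_off_mark CP1 U" unfolding c by (intro holomorphic_intros)
    show "f holomorphic_on rho K N t ` dom_off_mark CP1 U"
      using f by (simp add: O_germ_def regular_def dom_map_option)
  qed
  moreover have "P (\<lambda>x. f (rho K N t (inverse x)))" if "None \<in> U"
  proof -
    have "map_option (rho K N t) None \<in> map_option (rho K N t) ` U" using that by (rule imageI)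
    then have "P (\<lambda>x. f (inverse x))" using f by (simp add: O_germ_def regular_def)
    from P[OF _ this, of "inverse c"] show ?thesis
      using c by (simp add: inverse_mult_distrib)
  qed
  ultimately have "regular CP1 P U (\<lambda>z. f (rho K N t z))" by (simp add: regular_def o_def)
  then show ?thesis using eq by (simp add: O_germ_def) (metis restrict_extensional)
qed

lemma mero_rescale: "c \<noteq> 0 \<Longrightarrow> mero h \<Longrightarrow> mero (\<lambda>x. h (c * x))"
  by (rule meromorphic_on_compose[where A = "{0}"]) (auto intro: analytic_intros)

lemma pole_le_rescale: "c \<noteq> 0 \<Longrightarrow> pole_le n h \<Longrightarrow> pole_le n (\<lambda>x. h (c * x))"
  using pole_le_compose_root[of n h c 1] by simp

text \<open>
  The isomorphism of \<open>\<rho>\<^sub>t\<^sup>*O(\<alpha>)\<close> with \<open>O(\<alpha>)\<close> that matches the canonical sections is here an equality: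
  sections are functions, and pole orders at \<open>\<infinity>\<close> do not change under scaling.
\<close>

lemma pullback_line_sum: "pullback_bundle (rho K N t) (line_sum n a) = line_sum n a"
proof -
  define F where "F P U = {s \<in> dom_off_mark CP1 U \<rightarrow>\<^sub>E carrier_vec n.
      \<forall>i<n. (\<lambda>z\<in>dom_off_mark CP1 U. vec_index (s z) i) \<in> O_germ CP1 (P i) U}"
    for P :: "nat \<Rightarrow> (complex \<Rightarrow> complex) \<Rightarrow> bool" and U
  have pull: "(\<lambda>z\<in>dom_off_mark CP1 U. s (rho K N t z)) \<in> F P U"
    if P: "\<And>i h c. c \<noteq> 0 \<Longrightarrow> P i h \<Longrightarrow> P i (\<lambda>x. h (c * x))" and s: "s \<in> F P (map_option (rho K N t) ` U)"
    for s P U t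
    unfolding F_def
  proof (intro CollectI conjI allI impI)
    show "(\<lambda>z\<in>dom_off_mark CP1 U. s (rho K N t z)) \<in> dom_off_mark CP1 U \<rightarrow>\<^sub>E carrier_vec n"
      using s by (auto simp: F_def dom_map_option restrict_PiE_iff)
    fix i assume "i < n"
    let ?V = "map_option (rho K N t) ` U"
    have "(\<lambda>z\<in>dom_off_mark CP1 ?V. vec_index (s z) i) \<in> O_germ CP1 (P i) ?V"
      using s \<open>i < n\<close> by (simp add: F_def)
    from O_germ_rescale[OF P this]
    have "(\<lambda>z\<in>dom_off_mark CP1 U. (\<lambda>z\<in>dom_off_mark CP1 ?V. vec_index (s z) i) (rho K N t z)) \<in> O_germ CP1 (P i) U" .
    moreover have "(\<lambda>z\<in>dom_off_mark CP1 U. (\<lambda>z\<in>dom_off_mark CP1 ?V. vec_index (s z) i) (rho K N t z)) =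
        (\<lambda>z\<in>dom_off_mark CP1 U. vec_index ((\<lambda>z\<in>dom_off_mark CP1 U. s (rho K N t z)) z) i)"
      by (rule restrict_ext) (simp add: dom_map_option)
    ultimately show "(\<lambda>z\<in>dom_off_mark CP1 U. vec_index ((\<lambda>z\<in>dom_off_mark CP1 U. s (rho K N t z)) z) i)
        \<in> O_germ CP1 (P i) U" by simp
  qed
  have eq: "(\<lambda>s. \<lambda>z\<in>dom_off_mark CP1 U. s (rho K N t z)) ` F P (map_option (rho K N t) ` U) = F P U"
    if P: "\<And>i h c. c \<noteq> 0 \<Longrightarrow> P i h \<Longrightarrow> P i (\<lambda>x. h (c * x))" for P U
  proof (intro Set.set_eqI iffI)
    fix s assume "s \<in> (\<lambda>s. \<lambda>z\<in>dom_off_mark CP1 U. s (rho K N t z)) ` F P (map_option (rho K N t) ` U)"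
    then show "s \<in> F P U" using pull[of P _ t U, OF P] by blast
  next
    fix s assume s: "s \<in> F P U"
    let ?V = "map_option (rho K N t) ` U"
    define s' where "s' = (\<lambda>z\<in>dom_off_mark CP1 ?V. s (rho K N (- t) z))"
    have "s' \<in> F P ?V"
      unfolding s'_def using s by (intro pull P) (simp_all add: map_option_rho_inverse)
    moreover have "s = (\<lambda>z\<in>dom_off_mark CP1 U. s' (rho K N t z))"
    proof (rule extensionalityI[of _ "dom_off_mark CP1 U"])
      show "s z = (\<lambda>z\<in>dom_off_mark CP1 U. s' (rho K N t z)) z" if "z \<in> dom_off_mark CP1 U" for z
        using that by (simp add: s'_def dom_map_option rho_rho)
    qed (use s in \<open>auto simp: F_def PiE_def\<close>)
    ultimately show "s \<in> (\<lambda>s. \<lambda>z\<in>dom_off_mark CP1 U. s (rho K N t z)) ` F P ?V" by blast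
  qed
  have sec: "sec (line_sum n a) = F (\<lambda>_. mero)"
    by (simp add: direct_sum_def O_line_def O_mer_eq F_def[abs_def])
  have filt: "filt (line_sum n a) = (\<lambda>\<beta>. F (\<lambda>i. pole_le \<lfloor>\<beta> + a i\<rfloor>))"
    by (simp add: direct_sum_def O_line_def O_pole_eq F_def[abs_def])
  have "(\<lambda>U. (\<lambda>s. \<lambda>z\<in>dom_off_mark CP1 U. s (rho K N t z)) ` F (\<lambda>_. mero) (map_option (rho K N t) ` U)) =
      F (\<lambda>_. mero)"
    by (rule ext, rule eq) (rule mero_rescale)
  moreover have "(\<lambda>\<beta> U. (\<lambda>s. \<lambda>z\<in>dom_off_mark CP1 U. s (rho K N t z)) `
      F (\<lambda>i. pole_le \<lfloor>\<beta> + a i\<rfloor>) (map_option (rho K N t) ` U)) = (\<lambda>\<beta>. F (\<lambda>i. pole_le \<lfloor>\<beta> + a i\<rfloor>))"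
    by (rule ext, rule ext, rule eq) (rule pole_le_rescale)
  ultimately show ?thesis
    unfolding pullback_bundle_def sec filt using sec filt by simp
qed

section \<open>Gauge transformations\<close>

lemma monomial_mat_maps_sections:
  assumes p: "\<And>i. i < K \<Longrightarrow> p i < K" and a: "\<And>i. i < K \<Longrightarrow> a' i = a (p i)"
    and U: "openin (opens CP1) U"
  shows "s \<in> sec (line_sum K a) U \<Longrightarrow>
      apply_fibrewise CP1 (\<lambda>_. monomial_mat K p c) U s \<in> sec (line_sum K a') U"
    and "s \<in> filt (line_sum K a) \<alpha> U \<Longrightarrow>
      apply_fibrewise CP1 (\<lambda>_. monomial_mat K p c) U s \<in> filt (line_sum K a') \<alpha> U"
proof -
  let ?M = "monomial_mat K p c"
  have val: "apply_fibrewise CP1 (\<lambda>_. ?M) U s \<in> dom_off_mark CP1 U \<rightarrow>\<^sub>E carrier_vec K"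
    by (simp add: apply_fibrewise_def restrict_PiE_iff carrier_vecI)
  have coord: "regular CP1 P U (\<lambda>z. vec_index (apply_fibrewise CP1 (\<lambda>_. ?M) U s z) i)"
    if i: "i < K" and s: "\<forall>z\<in>dom_off_mark CP1 U. s z \<in> carrier_vec K"
      and r: "regular CP1 P U (\<lambda>z. vec_index (s z) (p i))"
      and P: "germ_property P" "\<And>h. P h \<Longrightarrow> P (\<lambda>x. c i * h x)" for i P
  proof -
    have "regular CP1 P U (\<lambda>z. c i * vec_index (s z) (p i))" using r P(2) by (rule regular_scale)
    then show ?thesis
      by (rule CP1.regular_transfer[OF U P(1)])
        (use i s p[OF i] in \<open>simp add: apply_fibrewise_def monomial_mat_mult_vec del: index_mult_mat_vec\<close>)
  qed
  show "apply_fibrewise CP1 (\<lambda>_. ?M) U s \<in> sec (line_sum K a') U" if s: "s \<in> sec (line_sum K a) U"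
    unfolding mem_sec_line_sum[OF U]
  proof (intro conjI val allI impI coord germ_property_mero mero_scale)
    show "\<forall>z\<in>dom_off_mark CP1 U. s z \<in> carrier_vec K" using s unfolding mem_sec_line_sum[OF U] by blast
    fix i assume "i < K"
    then show "regular CP1 mero U (\<lambda>z. vec_index (s z) (p i))"
      using s p unfolding mem_sec_line_sum[OF U] by blast
  qed
  show "apply_fibrewise CP1 (\<lambda>_. ?M) U s \<in> filt (line_sum K a') \<alpha> U" if s: "s \<in> filt (line_sum K a) \<alpha> U"
    unfolding mem_filt_line_sum[OF U]
  proof (intro conjI val allI impI coord germ_property_pole_le pole_le_scale)
    show "\<forall>z\<in>dom_off_mark CP1 U. s z \<in> carrier_vec K" using s unfolding mem_filt_line_sum[OF U] by blast
    fix i assume "i < K"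
    then show "regular CP1 (pole_le \<lfloor>\<alpha> + a' i\<rfloor>) U (\<lambda>z. vec_index (s z) (p i))"
      using s p a unfolding mem_filt_line_sum[OF U] by simp
  qed
qed

lemma image_eq_of_section:
  assumes "\<And>s. s \<in> A \<Longrightarrow> f s \<in> B" and "\<And>s. s \<in> B \<Longrightarrow> g s \<in> A" and "\<And>s. s \<in> B \<Longrightarrow> f (g s) = s"
  shows "f ` A = B"
proof (intro equalityI subsetI)
  show "s \<in> B" if "s \<in> f ` A" for s using that assms(1) by auto
  show "s \<in> f ` A" if "s \<in> B" for s using that assms(2,3) by (metis image_eqI)
qed

text \<open>
  A constant monomial matrix permutes the summands up to scalars; its inverse is of the same
  kind.
\<close>

lemma filtered_iso_monomial_mat:
  assumes p: "bij_betw p {..<K} {..<K}" and c: "\<And>i. i < K \<Longrightarrow> c i \<noteq> 0"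
    and a: "\<And>i. i < K \<Longrightarrow> a' i = a (p i)"
  shows "filtered_iso CP1 K (line_sum K a) (line_sum K a') (\<lambda>_. monomial_mat K p c)"
proof -
  define q where "q = inv_into {..<K} p"
  have pK: "p i < K" if "i < K" for i using bij_betwE[OF p] that by auto
  have qK: "q i < K" if "i < K" for i
    using bij_betwE[OF bij_betw_inv_into[OF p]] that by (auto simp: q_def)
  have qp: "q (p i) = i" and pq: "p (q i) = i" if "i < K" for i
    using that bij_betw_inv_into_left[OF p] bij_betw_inv_into_right[OF p] by (auto simp: q_def)
  let ?M = "monomial_mat K p c" and ?M' = "monomial_mat K q (\<lambda>i. 1 / c (q i))"
  have MM': "?M * ?M' = 1\<^sub>m K"
  proof -
    have "?M * ?M' = monomial_mat K (\<lambda>i. q (p i)) (\<lambda>i. c i * (1 / c (q (p i))))"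
      using pK by (rule monomial_mat_mult)
    also have "\<dots> = monomial_mat K (\<lambda>i. i) (\<lambda>_. 1)"
      by (rule monomial_mat_cong) (simp_all add: qp c)
    finally show ?thesis unfolding monomial_mat_one .
  qed
  have M'M: "?M' * ?M = 1\<^sub>m K"
  proof -
    have "?M' * ?M = monomial_mat K (\<lambda>i. p (q i)) (\<lambda>i. 1 / c (q i) * c (q i))"
      using qK by (rule monomial_mat_mult)
    also have "\<dots> = monomial_mat K (\<lambda>i. i) (\<lambda>_. 1)"
      by (rule monomial_mat_cong) (simp_all add: pq c qK)
    finally show ?thesis unfolding monomial_mat_one .
  qed
  have a': "a i = a' (q i)" if "i < K" for i using a[OF qK[OF that]] pq[OF that] by simp
  have section_of: "apply_fibrewise CP1 (\<lambda>_. ?M) U (apply_fibrewise CP1 (\<lambda>_. ?M') U s) = s"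
    if "s \<in> dom_off_mark CP1 U \<rightarrow>\<^sub>E carrier_vec K" for s U
  proof (rule extensionalityI[of _ "dom_off_mark CP1 U"])
    fix z assume z: "z \<in> dom_off_mark CP1 U"
    then have s: "s z \<in> carrier_vec K" using that by auto
    have "?M *\<^sub>v (?M' *\<^sub>v s z) = (?M * ?M') *\<^sub>v s z"
      by (rule assoc_mult_mat_vec[symmetric, OF monomial_mat_carrier monomial_mat_carrier s])
    then show "apply_fibrewise CP1 (\<lambda>_. ?M) U (apply_fibrewise CP1 (\<lambda>_. ?M') U s) z = s z"
      using z s MM' by (simp add: apply_fibrewise_def)
  qed (use that in \<open>auto simp: apply_fibrewise_def PiE_def\<close>)
  show ?thesis
  proof (rule filtered_isoI)
    show "invertible_mat ?M" using MM' M'M by (intro invertible_matI[of _ K ?M']) simp_all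
    fix U assume U: "openin (opens CP1) U"
    note maps = monomial_mat_maps_sections[where p = p and a = a and a' = a', OF pK a U]
      monomial_mat_maps_sections[where p = q and a = a' and a' = a, OF qK a' U]
    show "apply_fibrewise CP1 (\<lambda>_. ?M) U ` sec (line_sum K a) U = sec (line_sum K a') U"
      using maps(1,3) mem_sec_line_sum[OF U]
      by (intro image_eq_of_section[where g = "apply_fibrewise CP1 (\<lambda>_. ?M') U"] section_of) blast+
    show "apply_fibrewise CP1 (\<lambda>_. ?M) U ` filt (line_sum K a) \<alpha> U = filt (line_sum K a') \<alpha> U" for \<alpha>
      using maps(2,4) mem_filt_line_sum[OF U]
      by (intro image_eq_of_section[where g = "apply_fibrewise CP1 (\<lambda>_. ?M') U"] section_of) blast+
  qed simp
qed

lemma partition_field_eq: "partition_field K b z = twisted_field K b (\<lambda>_. 1) z"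
  by (simp add: partition_field_def twisted_field_def monomial_mat_def)

lemma partition_higgs_eq: "partition_higgs K N b = twisted_higgs K N b (\<lambda>_. 1)"
  by (simp add: partition_higgs_def twisted_higgs_def partition_field_eq[abs_def])

text \<open>
  Conjugation by \<open>diag(e/d)\<close> multiplies the entry in row \<open>i\<close> and column \<open>i + 1\<close> by
  \<open>(e\<^sub>i/d\<^sub>i) (d\<^sub>i\<^sub>+\<^sub>1/e\<^sub>i\<^sub>+\<^sub>1)\<close>.
\<close>

lemma twisted_field_conj:
  assumes "K > 0" and "\<And>i. i < K \<Longrightarrow> d i \<noteq> 0" and "\<And>i. i < K \<Longrightarrow> e i \<noteq> 0"
  shows "monomial_mat K (\<lambda>i. i) (\<lambda>i. e i / d i) * twisted_field K b d z =
    twisted_field K b e z * monomial_mat K (\<lambda>i. i) (\<lambda>i. e i / d i)"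
  unfolding twisted_field_def using assms
  by (subst (1 2) monomial_mat_mult) (auto intro!: monomial_mat_cong)

lemma higgs_iso_twisted_higgs:
  assumes "K > 0" and "\<And>i. i < K \<Longrightarrow> d i \<noteq> 0" and "\<And>i. i < K \<Longrightarrow> e i \<noteq> 0"
  shows "higgs_iso K (twisted_higgs K N b d) (twisted_higgs K N b e)"
  unfolding higgs_iso_def
proof (intro exI[of _ "\<lambda>_. monomial_mat K (\<lambda>i. i) (\<lambda>i. e i / d i)"] conjI allI)
  show "filtered_iso CP1 K (Bun (twisted_higgs K N b d)) (Bun (twisted_higgs K N b e))
      (\<lambda>_. monomial_mat K (\<lambda>i. i) (\<lambda>i. e i / d i))"
    using assms unfolding twisted_higgs_def partition_bundle_def sl_higgs.simps
    by (intro filtered_iso_monomial_mat) (auto simp: bij_betw_def inj_on_def)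
  show "monomial_mat K (\<lambda>i. i) (\<lambda>i. e i / d i) * Hig (twisted_higgs K N b d) z =
      Hig (twisted_higgs K N b e) z * monomial_mat K (\<lambda>i. i) (\<lambda>i. e i / d i)" for z
    using twisted_field_conj[OF assms] by (simp add: twisted_higgs_def)
qed

lemma gauge_factor_nonzero [simp]: "gauge_factor K N b t i \<noteq> 0"
  by (simp add: gauge_factor_def)

text \<open>
  The factor by which \<open>e\<^sup>t \<rho>\<^sub>t\<^sup>*\<close> multiplies \<open>z\<^sup>b\<^sup>(\<^sup>i\<^sup>) dz\<close> is the ratio of two gauge factors: by the relation
  between partition and weights both exponents are \<open>t (N - K b\<^sub>i) / (K + N)\<close>.
\<close>

lemma gauge_factor_ratio:
  assumes K: "K > 0" and b: "ordered_partition K N b" and i: "i < K"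
  shows "gauge_factor K N b t i / gauge_factor K N b t (Suc i mod K) =
    exp t * exp (- (of_nat K * t / of_nat (K + N))) ^ Suc (b ! i)"
proof -
  let ?a = "weights K N b"
  define k where "k = complex_of_real (real K / real (K + N))"
  have nz: "complex_of_nat K \<noteq> 0" "complex_of_nat (K + N) \<noteq> 0" using K by (simp_all del: of_nat_add)
  have k: "k = of_nat K / of_nat (K + N)" by (simp add: k_def)
  have "of_real (?a ! i) - of_real (?a ! (Suc i mod K)) = (of_nat (b ! i) - of_nat N / of_nat K :: complex)"
    using arg_cong[OF weights_step[OF K b i], of complex_of_real] by simp
  then have "- t * k * of_real (?a ! i) - - t * k * of_real (?a ! (Suc i mod K)) =
      - t * k * (of_nat (b ! i) - of_nat N / of_nat K)"
    by (metis right_diff_distrib)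
  also have "\<dots> = t + of_nat (Suc (b ! i)) * - (of_nat K * t / of_nat (K + N))"
  proof -
    have "k * of_nat (K + N) = of_nat K" using nz by (simp add: k)
    moreover have "of_nat K * t / of_nat (K + N) = k * t" by (simp add: k)
    moreover have "k * (of_nat N / of_nat K) = 1 - k" using nz by (simp add: k field_simps)
    moreover have "- t * k * (x - y) = - (k * t * x) + t * (k * y)" for x y
      by (simp add: algebra_simps)
    ultimately show ?thesis by (simp only:) (simp add: algebra_simps)
  qed
  finally have "exp (- t * k * of_real (?a ! i) - - t * k * of_real (?a ! (Suc i mod K))) =
      exp (t + of_nat (Suc (b ! i)) * - (of_nat K * t / of_nat (K + N)))" by (rule arg_cong)
  then show ?thesis
    unfolding gauge_factor_def k_def[symmetric] exp_diff exp_add exp_of_nat_mult .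
qed

lemma scaled_partition_field:
  assumes K: "K > 0" and b: "ordered_partition K N b"
  shows "exp t \<cdot>\<^sub>m pullback_form (rho K N t) (partition_field K b) z =
    twisted_field K b (gauge_factor K N b t) z"
proof -
  define c where "c = exp (- (of_nat K * t / of_nat (K + N)))"
  have rho: "rho K N t = (\<lambda>z. c * z)" by (simp add: rho_def[abs_def] c_def)
  have "deriv (rho K N t) z = c" unfolding rho by simp
  moreover have "exp t \<cdot>\<^sub>m (c \<cdot>\<^sub>m monomial_mat K p e) = monomial_mat K p (\<lambda>i. exp t * (c * e i))" for p e
    by (rule eq_matI) (auto simp: monomial_mat_def)
  ultimately have "exp t \<cdot>\<^sub>m pullback_form (rho K N t) (partition_field K b) z =
      monomial_mat K (\<lambda>i. Suc i mod K) (\<lambda>i. exp t * (c * (c * z) ^ (b ! i)))"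
    unfolding pullback_form_def partition_field_eq twisted_field_def rho by simp
  also have "\<dots> = twisted_field K b (gauge_factor K N b t) z"
    unfolding twisted_field_def
    by (rule monomial_mat_cong)
      (simp_all only: gauge_factor_ratio[OF K b] c_def[symmetric], simp add: power_mult_distrib)
  finally show ?thesis .
qed

lemma act_obj_partition_higgs:
  assumes "K > 0" and "ordered_partition K N b"
  shows "act_obj K N t (partition_higgs K N b) = twisted_higgs K N b (gauge_factor K N b t)"
  using scaled_partition_field[OF assms]
  by (simp add: act_obj_def partition_higgs_def twisted_higgs_def partition_bundle_def
      pullback_line_sum canonical_section_def fun_eq_iff)

lemma gauge_map_eq: "gauge_map K N b t z = monomial_mat K (\<lambda>i. i) (gauge_factor K N b t)"
  by (rule eq_matI) (auto simp: gauge_map_def mat_diag_def monomial_mat_def)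

lemma filtered_iso_gauge_map:
  "filtered_iso CP1 K (partition_bundle K N b)
     (pullback_bundle (rho K N t) (partition_bundle K N b)) (gauge_map K N b t)"
  unfolding partition_bundle_def pullback_line_sum gauge_map_eq[abs_def]
  by (intro filtered_iso_monomial_mat) (auto simp: bij_betw_def inj_on_def)

lemma gauge_map_canonical_section:
  assumes "i < K"
  shows "gauge_map K N b t z *\<^sub>v canonical_section K i z =
    gauge_factor K N b t i \<cdot>\<^sub>v canonical_section K i (rho K N t z)"
proof (rule eq_vecI)
  fix k assume "k < dim_vec (gauge_factor K N b t i \<cdot>\<^sub>v canonical_section K i (rho K N t z))"
  then have k: "k < K" by (simp add: canonical_section_def)
  then have "vec_index (gauge_map K N b t z *\<^sub>v unit_vec K i) k =
      gauge_factor K N b t k * vec_index (unit_vec K i) k"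
    unfolding gauge_map_eq by (intro monomial_mat_mult_vec) simp_all
  then show "vec_index (gauge_map K N b t z *\<^sub>v canonical_section K i z) k =
      vec_index (gauge_factor K N b t i \<cdot>\<^sub>v canonical_section K i (rho K N t z)) k"
    using k assms by (simp add: canonical_section_def)
qed (simp add: gauge_map_eq canonical_section_def)

text \<open>
  The previous identities give the equation with \<open>g\<^sub>t\<close> moved to the other side; multiplication by
  the inverse from the right concludes.
\<close>

lemma gauge_map_conjugates:
  assumes K: "K > 0" and b: "ordered_partition K N b"
  shows "exp t \<cdot>\<^sub>m pullback_form (rho K N t) (partition_field K b) z =
    gauge_map K N b t z * partition_field K b z * the (mat_inverse (gauge_map K N b t z))"
proof -
  let ?g = "gauge_map K N b t z" and ?T = "twisted_field K b (gauge_factor K N b t) z"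
  have g: "?g \<in> carrier_mat K K" by (simp add: gauge_map_eq)
  have "invertible_mat ?g"
    using filtered_isoD(2)[OF filtered_iso_gauge_map] .
  then obtain B' where "B' \<in> carrier_mat K K" "?g * B' = 1\<^sub>m K" "B' * ?g = 1\<^sub>m K"
    using invertible_matE[OF _ g] by blast
  then have "?g \<in> Units (ring_mat TYPE(complex) K ())"
    using g by (auto simp: Units_def ring_mat_simps)
  then obtain B where B: "mat_inverse ?g = Some B"
    using mat_inverse(1)[OF g, where b = "()"] by (cases "mat_inverse ?g") auto
  then have inv: "?g * B = 1\<^sub>m K" "B \<in> carrier_mat K K" using mat_inverse(2)[OF g] by blast+
  have T: "?T \<in> carrier_mat K K" by (simp add: twisted_field_def)
  have "?g * partition_field K b z = ?T * ?g"
    using twisted_field_conj[of K "\<lambda>_. 1" "gauge_factor K N b t" b z] K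
    by (simp add: partition_field_eq gauge_map_eq)
  then have "?g * partition_field K b z * B = ?T * (?g * B)"
    using assoc_mult_mat[OF T g inv(2)] by simp
  also have "\<dots> = ?T" using T inv(1) by simp
  finally show ?thesis unfolding scaled_partition_field[OF K b] B by simp
qed

section \<open>Rotations of the partition\<close>

lemma sum_list_rotate: "sum_list (rotate n xs) = (sum_list xs :: 'a::comm_monoid_add)"
proof (induction n)
  case (Suc n)
  have "sum_list (rotate1 ys) = sum_list ys" for ys :: "'a list"
    by (cases ys) (simp_all add: add.commute)
  then show ?case using Suc by simp
qed simp

lemma ordered_partition_rotate:
  "ordered_partition K N b \<Longrightarrow> ordered_partition K N (rotate n b)"
  by (simp add: ordered_partition_def sum_list_rotate)

text \<open>
  The conditions on the weights are invariant under simultaneous rotation, and their solution is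
  unique.
\<close>

lemma weights_rotate:
  assumes K: "K > 0" and b: "ordered_partition K N b"
  shows "weights K N (rotate n b) = rotate n (weights K N b)"
proof -
  let ?a = "weights K N b"
  have len: "length b = K" "length ?a = K"
    using b is_weights_weights[OF K b] by (simp_all add: ordered_partition_def is_weights_def)
  have "is_weights K N (rotate n b) (rotate n ?a)"
    unfolding is_weights_def
  proof (intro conjI allI impI)
    fix i assume i: "i < K"
    have lt: "(n + i) mod K < K" "Suc i mod K < K" using K by simp_all
    have "rotate n ?a ! (Suc i mod K) = ?a ! (Suc ((n + i) mod K) mod K)"
      using lt len by (simp add: nth_rotate mod_simps)
    then show "real (rotate n b ! i) - real N / real K = rotate n ?a ! i - rotate n ?a ! (Suc i mod K)"
      using weights_step[OF K b lt(1)] i len by (simp add: nth_rotate)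
  next
    show "sum_list (rotate n ?a) = 0"
      using is_weights_weights[OF K b] by (simp add: is_weights_def sum_list_rotate)
  qed (simp add: len)
  then show ?thesis
    using ex1_weights[OF K ordered_partition_rotate[OF b]]
      is_weights_weights[OF K ordered_partition_rotate[OF b]] by blast
qed

lemma bij_betw_rotate_index: "K > 0 \<Longrightarrow> bij_betw (\<lambda>i. (n + i) mod K) {..<K} {..<K :: nat}"
proof -
  assume K: "K > 0"
  have "{..<K} \<subseteq> (\<lambda>i. (n + i) mod K) ` {..<K}"
  proof
    fix j assume "j \<in> {..<K}"
    let ?i = "(j + (K - n mod K)) mod K"
    have "n + (j + (K - n mod K)) = j + (n div K + 1) * K"
      using div_mult_mod_eq[of n K] mod_less_divisor[OF K, of n] unfolding add_mult_distrib by linarith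
    then have "(n + ?i) mod K = (j + (n div K + 1) * K) mod K" by (simp only: mod_add_right_eq)
    also have "\<dots> = j" using \<open>j \<in> {..<K}\<close> by (simp only: mod_mult_self1) simp
    finally show "j \<in> (\<lambda>i. (n + i) mod K) ` {..<K}"
      using K by (intro image_eqI[of _ _ ?i]) simp_all
  qed
  moreover from this have "inj_on (\<lambda>i. (n + i) mod K) {..<K}" by (intro finite_surj_inj) simp_all
  moreover have "(\<lambda>i. (n + i) mod K) ` {..<K} \<subseteq> {..<K}" using K by auto
  ultimately show ?thesis by (auto simp: bij_betw_def)
qed

lemma higgs_iso_rotate:
  assumes K: "K > 0" and b: "ordered_partition K N b"
  shows "higgs_iso K (partition_higgs K N b) (partition_higgs K N (rotate n b))"
  unfolding higgs_iso_def
proof (intro exI[of _ "\<lambda>_. monomial_mat K (\<lambda>i. (n + i) mod K) (\<lambda>_. 1)"] conjI allI)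
  let ?M = "monomial_mat K (\<lambda>i. (n + i) mod K) (\<lambda>_. 1)"
  have len: "length b = K" "length (weights K N b) = K"
    using b is_weights_weights[OF K b] by (simp_all add: ordered_partition_def is_weights_def)
  show "filtered_iso CP1 K (Bun (partition_higgs K N b)) (Bun (partition_higgs K N (rotate n b))) (\<lambda>_. ?M)"
    unfolding partition_higgs_def partition_bundle_def sl_higgs.simps
    using bij_betw_rotate_index[OF K] len
    by (intro filtered_iso_monomial_mat) (simp_all add: weights_rotate[OF K b] nth_rotate)
  show "?M * Hig (partition_higgs K N b) z = Hig (partition_higgs K N (rotate n b)) z * ?M" for z
    unfolding partition_higgs_eq twisted_higgs_def sl_higgs.simps twisted_field_def
    using K len
    by (subst (1 2) monomial_mat_mult) (auto intro!: monomial_mat_cong simp: nth_rotate mod_simps)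
qed

section \<open>The fixed point\<close>

lemma iso_rel_trans:
  assumes "(X, Y) \<in> iso_rel K N" and "(Y, Z) \<in> iso_rel K N"
  shows "(X, Z) \<in> iso_rel K N"
  using assms higgs_iso_trans[of X K N Y Z] by (auto simp: iso_rel_def)

lemma iso_class_eqI:
  assumes "(X, Y) \<in> iso_rel K N" and "(Y, X) \<in> iso_rel K N"
  shows "iso_class K N X = iso_class K N Y"
  unfolding iso_class_def using assms iso_rel_trans by blast

text \<open>
  The translate of the Higgs bundle of the partition is isomorphic to it in both directions. Isomorphic
  objects have isomorphic translates, so the translate of any object of the class lies in the
  class.
\<close>

lemma act_iso_class_partition_higgs:
  assumes K: "K \<ge> 2" and b: "ordered_partition K N b"
  shows "act K N t (iso_class K N (partition_higgs K N b)) = iso_class K N (partition_higgs K N b)"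
proof -
  let ?X = "partition_higgs K N b" and ?g = "gauge_factor K N b t"
  have K0: "K > 0" using K by simp
  have tX: "act_obj K N t ?X = twisted_higgs K N b ?g"
    by (rule act_obj_partition_higgs[OF K0 b])
  have objs: "?X \<in> objs K N" "act_obj K N t ?X \<in> objs K N"
    unfolding tX unfolding partition_higgs_eq
    by (rule twisted_higgs_mem_objs[OF K b]; simp)+
  have refl: "(?X, ?X) \<in> iso_rel K N"
    and there: "(?X, act_obj K N t ?X) \<in> iso_rel K N" and home: "(act_obj K N t ?X, ?X) \<in> iso_rel K N"
    using objs unfolding tX unfolding partition_higgs_eq iso_rel_def
    by (auto intro: higgs_iso_twisted_higgs[OF K0])
  show ?thesis
    unfolding act_def iso_class_def
  proof (intro Set.set_eqI iffI)
    fix Z assume "Z \<in> iso_rel K N `` (act_obj K N t ` (iso_rel K N `` {?X}))"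
    then obtain Y where XY: "(?X, Y) \<in> iso_rel K N" and YZ: "(act_obj K N t Y, Z) \<in> iso_rel K N" by blast
    have "(act_obj K N t ?X, act_obj K N t Y) \<in> iso_rel K N"
      using XY YZ objs(2) higgs_iso_act_obj[of ?X K N Y] by (simp add: iso_rel_def)
    then show "Z \<in> iso_rel K N `` {?X}" using there YZ by (blast intro: iso_rel_trans)
  next
    fix Z assume "Z \<in> iso_rel K N `` {?X}"
    then have "(act_obj K N t ?X, Z) \<in> iso_rel K N" using home by (blast intro: iso_rel_trans)
    then show "Z \<in> iso_rel K N `` (act_obj K N t ` (iso_rel K N `` {?X}))" using refl by blast
  qed
qed

theorem proposition3p2:
  fixes K N :: nat and b :: "nat list"
  assumes "K \<ge> 2" and "N \<ge> 1" and "coprime K N"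
    and "ordered_partition K N b"
  shows
    "(\<exists>!a. is_weights K N b a) \<and>
     partition_higgs K N b \<in> objs K N \<and>
     (\<forall>t. filtered_iso CP1 K (partition_bundle K N b)
            (pullback_bundle (rho K N t) (partition_bundle K N b)) (gauge_map K N b t) \<and>
          (\<forall>i<K. \<forall>z. gauge_map K N b t z *\<^sub>v canonical_section K i z =
             gauge_factor K N b t i \<cdot>\<^sub>v canonical_section K i (rho K N t z)) \<and>
          (\<forall>z. exp t \<cdot>\<^sub>m pullback_form (rho K N t) (partition_field K b) z =
             gauge_map K N b t z * partition_field K b z * the (mat_inverse (gauge_map K N b t z)))) \<and>
     iso_class K N (partition_higgs K N b) \<in> moduli K N \<and>
     (\<forall>t. act K N t (iso_class K N (partition_higgs K N b)) =
            iso_class K N (partition_higgs K N b)) \<and>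
     (\<forall>b'. ordered_partition K N b' \<and> cyclic_partition b' = cyclic_partition b \<longrightarrow>
            iso_class K N (partition_higgs K N b') = iso_class K N (partition_higgs K N b))"
proof (intro conjI allI impI)
  have K0: "K > 0" using assms(1) by simp
  have objs: "partition_higgs K N b \<in> objs K N" if "ordered_partition K N b" for b
    unfolding partition_higgs_eq by (rule twisted_higgs_mem_objs[OF assms(1) that]) simp
  show "\<exists>!a. is_weights K N b a" by (rule ex1_weights[OF K0 assms(4)])
  show "partition_higgs K N b \<in> objs K N" by (rule objs[OF assms(4)])
  then show "iso_class K N (partition_higgs K N b) \<in> moduli K N"
    unfolding iso_class_def moduli_def by (rule quotientI)
  show "filtered_iso CP1 K (partition_bundle K N b)
      (pullback_bundle (rho K N t) (partition_bundle K N b)) (gauge_map K N b t)" for t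
    by (rule filtered_iso_gauge_map)
  show "gauge_map K N b t z *\<^sub>v canonical_section K i z =
      gauge_factor K N b t i \<cdot>\<^sub>v canonical_section K i (rho K N t z)" if "i < K" for t i z
    using that by (rule gauge_map_canonical_section)
  show "exp t \<cdot>\<^sub>m pullback_form (rho K N t) (partition_field K b) z =
      gauge_map K N b t z * partition_field K b z * the (mat_inverse (gauge_map K N b t z))" for t z
    by (rule gauge_map_conjugates[OF K0 assms(4)])
  show "act K N t (iso_class K N (partition_higgs K N b)) = iso_class K N (partition_higgs K N b)" for t
    by (rule act_iso_class_partition_higgs[OF assms(1,4)])
  fix b' assume b': "ordered_partition K N b' \<and> cyclic_partition b' = cyclic_partition b"
  have rot: "(partition_higgs K N c, partition_higgs K N c') \<in> iso_rel K N"
    if c: "ordered_partition K N c" and c': "ordered_partition K N c'"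
      and eq: "cyclic_partition c' = cyclic_partition c" for c c'
  proof -
    have "c' \<in> cyclic_partition c'" unfolding cyclic_partition_def by (rule CollectI, rule exI[of _ 0]) simp
    then obtain n where "c' = rotate n c" unfolding eq by (auto simp: cyclic_partition_def)
    then show ?thesis
      using objs[OF c] objs[OF c'] higgs_iso_rotate[OF K0 c] by (simp add: iso_rel_def)
  qed
  show "iso_class K N (partition_higgs K N b') = iso_class K N (partition_higgs K N b)"
    by (rule iso_class_eqI; rule rot) (use b' assms(4) in simp_all)
qed

end
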